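(* Consider the Hopf algebra $U_q(sl_2)$ with the character $\delta=\epsilon$ (the counit) and the group-like element $\sigma=K$. Then $HP^0_{\epsilon,K}(U_q(sl_2))=0$, and $HP^1_{\epsilon,K}(U_q(sl_2))\cong\mathbb{C}^2$, with generators represented by $E$ and $KF$.
   Context: $U_q(sl_2)$ ($q\in\mathbb{C}$ with $q\ne0$, $q^2\neq1$) is the algebra generated by $E,F,K,K^{-1}$ with relations $KE=q^2EK$, $KF=q^{-2}FK$, $KK^{-1}=K^{-1}K=1$, $[E,F]=(K-K^{-1})/(q-q^{-1})$; coproduct $\Delta(K)=K\otimes K$, $\Delta(E)=1\otimes E+E\otimes K$, $\Delta(F)=K^{-1}\otimes F+F\otimes1$; counit $\epsilon(K)=1$, $\epsilon(E)=\epsilon(F)=0$; antipode $S(K)=K^{-1}$, $S(E)=-EK^{-1}$, $S(F)=-KF$. One has $S^2(h)=KhK^{-1}$. For a Hopf algebra $H$ over $\mathbb{C}$ with coproduct $\Delta(h)=\sum h_0\otimes h_1$, a character (non-zero algebra map) $\delta:H\to\mathbb{C}$, $S_\delta(h)=\sum\delta(h_0)S(h_1)$, and an invertible group-like $\sigma\in H$ with $S_\delta^2(h)=\sigma h\sigma^{-1}$ for all $h$ and $\delta(\sigma)=1$, the cocyclic module $H^\sharp_{\delta,\sigma}$ has $H^{\otimes n}$ in degree $n$, with $d^0(h^1,\dots,h^n)=(1,h^1,\dots,h^n)$, $d^i(h^1,\dots,h^n)=(h^1,\dots,\Delta h^i,\dots,h^n)$ ($1\le i\le n$), $d^{n+1}(h^1,\dots,h^n)=(h^1,\dots,h^n,\sigma)$,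 $s^i(h^1,\dots,h^n)=(h^1,\dots,\epsilon(h^{i+1}),\dots,h^n)$, $t(h^1,\dots,h^n)=S_\delta(h^1)\cdot(h^2,\dots,h^n,\sigma)$ (diagonal action). $HC^*_{\delta,\sigma}(H)$ is its cyclic cohomology and $HP^*_{\delta,\sigma}(H)$ ($*\in\mathbb{Z}/2$) its periodic cyclic cohomology (the direct limit of $HC^{*+2k}_{\delta,\sigma}(H)$ under the periodicity operator). *)

theory Defs
  imports Complex_Main "HOL-Library.Poly_Mapping" "HOL-Algebra.QuotRing" "HOL-Algebra.Module"
begin

section \<open>Complex vector spaces and algebras as records\<close>

text \<open>
  A complex vector space or (not necessarily commutative) complex algebra is a HOL-Algebra
  record of type \<open>(complex, 'a) module\<close>. The fields \<open>mult\<close> and \<open>one\<close> are irrelevant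
  where only the vector space structure is meant; they are then \<open>undefined\<close>, or inherited
  from such a record.
\<close>

definition complex_alg :: "(complex, complex) module" where
  "complex_alg = \<lparr>carrier = UNIV, mult = (*), one = 1, zero = 0, add = (+), smult = (*)\<rparr>"

definition op_alg :: "(complex, 'a) module \<Rightarrow> (complex, 'a) module" where
  "op_alg A = A\<lparr>mult := \<lambda>x y. y \<otimes>\<^bsub>A\<^esub> x\<rparr>"

text \<open>The quotient of a vector space by a subspace, or of an algebra by a two-sided ideal.\<close>

definition quot_module ::
  "(complex, 'a, 'm) module_scheme \<Rightarrow> 'a set \<Rightarrow> (complex, 'a set) module" where
  "quot_module M N =
     \<lparr>carrier = carrier (M Quot N), mult = mult (M Quot N), one = one (M Quot N),
      zero = zero (M Quot N), add = add (M Quot N),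
      smult = (\<lambda>c U. \<Union>x\<in>U. N +>\<^bsub>M\<^esub> (c \<odot>\<^bsub>M\<^esub> x))\<rparr>"

definition scale :: "complex \<Rightarrow> ('k \<Rightarrow>\<^sub>0 complex) \<Rightarrow> ('k \<Rightarrow>\<^sub>0 complex)" where
  "scale c x = Poly_Mapping.map ((*) c) x"

text \<open>The bilinear extension of a binary operation on basis elements.\<close>

definition bilin_ext ::
  "('k \<Rightarrow> 'k \<Rightarrow> 'k) \<Rightarrow> ('k \<Rightarrow>\<^sub>0 complex) \<Rightarrow> ('k \<Rightarrow>\<^sub>0 complex) \<Rightarrow> ('k \<Rightarrow>\<^sub>0 complex)" where
  "bilin_ext f x y =
     (\<Sum>a\<in>Poly_Mapping.keys x. \<Sum>b\<in>Poly_Mapping.keys y.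
        Poly_Mapping.single (f a b) (Poly_Mapping.lookup x a * Poly_Mapping.lookup y b))"

definition lin_ext ::
  "(complex, 'b, 'm) module_scheme \<Rightarrow> ('k \<Rightarrow> 'b) \<Rightarrow> ('k \<Rightarrow>\<^sub>0 complex) \<Rightarrow> 'b" where
  "lin_ext V f x =
     (\<Oplus>\<^bsub>V\<^esub>k\<in>Poly_Mapping.keys x. Poly_Mapping.lookup x k \<odot>\<^bsub>V\<^esub> f k)"

text \<open>
  The linear map out of a quotient of a free vector space (an element of which is a coset
  \<open>u\<close>) that is induced by the values \<open>f\<close> on the basis; meaningful when the linear extension
  of \<open>f\<close> is constant on cosets.
\<close>

definition quot_lift ::
  "(complex, 'b, 'm) module_scheme \<Rightarrow> ('k \<Rightarrow> 'b) \<Rightarrow> ('k \<Rightarrow>\<^sub>0 complex) set \<Rightarrow> 'b" where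
  "quot_lift V f u = the_elem (lin_ext V f ` u)"


section \<open>Tensor powers\<close>

text \<open>
  The free vector space on the \<open>n\<close>-tuples of elements of \<open>M\<close>, and its subspace of multilinear
  relations. The quotient is the tensor power of \<open>M\<close>; for \<open>n = 0\<close> it is the ground field.
  If \<open>M\<close> is an algebra, then the tensor power is the usual tensor product algebra.
\<close>

definition free_tensor ::
  "(complex, 'a, 'm) module_scheme \<Rightarrow> nat \<Rightarrow> (complex, 'a list \<Rightarrow>\<^sub>0 complex) module" where
  "free_tensor M n =
     \<lparr>carrier = {x. Poly_Mapping.keys x \<subseteq> {hs. length hs = n \<and> set hs \<subseteq> carrier M}},
      mult = bilin_ext (map2 (mult M)),
      one = Poly_Mapping.single (replicate n \<one>\<^bsub>M\<^esub>) 1,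
      zero = 0, add = (+), smult = scale\<rparr>"

definition multilinear_rels ::
  "(complex, 'a, 'm) module_scheme \<Rightarrow> nat \<Rightarrow> ('a list \<Rightarrow>\<^sub>0 complex) set" where
  "multilinear_rels M n =
     {Poly_Mapping.single (xs @ [(a \<odot>\<^bsub>M\<^esub> x) \<oplus>\<^bsub>M\<^esub> (b \<odot>\<^bsub>M\<^esub> y)] @ ys) 1
        - Poly_Mapping.single (xs @ [x] @ ys) a - Poly_Mapping.single (xs @ [y] @ ys) b
      | xs ys x y a b. length xs + 1 + length ys = n
          \<and> set xs \<subseteq> carrier M \<and> set ys \<subseteq> carrier M \<and> x \<in> carrier M \<and> y \<in> carrier M}"

definition tensor_null ::
  "(complex, 'a, 'm) module_scheme \<Rightarrow> nat \<Rightarrow> ('a list \<Rightarrow>\<^sub>0 complex) set" where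
  "tensor_null M n =
     \<Inter>{N. submodule N complex_alg (free_tensor M n) \<and> multilinear_rels M n \<subseteq> N}"

definition tensor_power ::
  "(complex, 'a, 'm) module_scheme \<Rightarrow> nat \<Rightarrow> (complex, ('a list \<Rightarrow>\<^sub>0 complex) set) module" where
  "tensor_power M n = quot_module (free_tensor M n) (tensor_null M n)"

definition pure_tensor ::
  "(complex, 'a, 'm) module_scheme \<Rightarrow> 'a list \<Rightarrow> ('a list \<Rightarrow>\<^sub>0 complex) set" where
  "pure_tensor M hs =
     tensor_null M (length hs) +>\<^bsub>free_tensor M (length hs)\<^esub> Poly_Mapping.single hs 1"


section \<open>Cocyclic modules and their cyclic cohomology\<close>

text \<open>
  \<open>coface X n i\<close>, \<open>codegen X n i\<close> and \<open>cyc X n\<close> are the maps \<open>d\<^sup>i\<close>, \<open>s\<^sup>i\<close> and \<open>t\<close> defined on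
  the space in degree \<open>n\<close>. The codegeneracies do not enter the bicomplex below.
\<close>

record 'a cocyclic =
  cochains :: "nat \<Rightarrow> (complex, 'a) module"
  coface :: "nat \<Rightarrow> nat \<Rightarrow> 'a \<Rightarrow> 'a"
  codegen :: "nat \<Rightarrow> nat \<Rightarrow> 'a \<Rightarrow> 'a"
  cyc :: "nat \<Rightarrow> 'a \<Rightarrow> 'a"

definition hoch_b :: "'a cocyclic \<Rightarrow> nat \<Rightarrow> 'a \<Rightarrow> 'a" where
  "hoch_b X n x =
     (\<Oplus>\<^bsub>cochains X (n + 1)\<^esub>i\<in>{..n + 1}. (-1) ^ i \<odot>\<^bsub>cochains X (n + 1)\<^esub> coface X n i x)"

definition hoch_b' :: "'a cocyclic \<Rightarrow> nat \<Rightarrow> 'a \<Rightarrow> 'a" where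
  "hoch_b' X n x =
     (\<Oplus>\<^bsub>cochains X (n + 1)\<^esub>i\<in>{..n}. (-1) ^ i \<odot>\<^bsub>cochains X (n + 1)\<^esub> coface X n i x)"

definition cyc_sign :: "'a cocyclic \<Rightarrow> nat \<Rightarrow> 'a \<Rightarrow> 'a" where
  "cyc_sign X n x = (-1) ^ n \<odot>\<^bsub>cochains X n\<^esub> cyc X n x"

definition cyc_norm :: "'a cocyclic \<Rightarrow> nat \<Rightarrow> 'a \<Rightarrow> 'a" where
  "cyc_norm X n x = (\<Oplus>\<^bsub>cochains X n\<^esub>j\<in>{..n}. (cyc_sign X n ^^ j) x)"

text \<open>
  The first-quadrant cyclic bicomplex of Tsygan: every column \<open>p \<ge> 0\<close> is the family of
  cochain spaces, with vertical differential \<open>b\<close> in the even and \<open>- b'\<close> in the odd columns;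
  the horizontal maps are \<open>1 - \<lambda>\<close> out of the even and \<open>N = 1 + \<lambda> + \<dots> + \<lambda>\<^sup>n\<close> out of the
  odd columns, where \<open>\<lambda> = (-1)\<^sup>n t\<close>. An element of total degree \<open>n\<close> is the family of its
  entries \<open>x p\<close>, of cochain degree \<open>n - p\<close>, in the columns \<open>p \<le> n\<close>.
\<close>

definition vert_diff :: "'a cocyclic \<Rightarrow> nat \<Rightarrow> nat \<Rightarrow> 'a \<Rightarrow> 'a" where
  "vert_diff X p m x =
     (if even p then hoch_b X m x else \<ominus>\<^bsub>cochains X (m + 1)\<^esub> hoch_b' X m x)"

definition horiz_diff :: "'a cocyclic \<Rightarrow> nat \<Rightarrow> nat \<Rightarrow> 'a \<Rightarrow> 'a" where
  "horiz_diff X p m x =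
     (if even p then x \<ominus>\<^bsub>cochains X m\<^esub> cyc_sign X m x else cyc_norm X m x)"

definition tot :: "'a cocyclic \<Rightarrow> nat \<Rightarrow> (complex, nat \<Rightarrow> 'a) module" where
  "tot X n =
     \<lparr>carrier = (\<Pi>\<^sub>E p\<in>{..n}. carrier (cochains X (n - p))),
      mult = undefined, one = undefined,
      zero = (\<lambda>p\<in>{..n}. \<zero>\<^bsub>cochains X (n - p)\<^esub>),
      add = (\<lambda>x y. \<lambda>p\<in>{..n}. x p \<oplus>\<^bsub>cochains X (n - p)\<^esub> y p),
      smult = (\<lambda>c x. \<lambda>p\<in>{..n}. c \<odot>\<^bsub>cochains X (n - p)\<^esub> x p)\<rparr>"

definition tot_diff :: "'a cocyclic \<Rightarrow> nat \<Rightarrow> (nat \<Rightarrow> 'a) \<Rightarrow> (nat \<Rightarrow> 'a)" where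
  "tot_diff X n x =
     (\<lambda>p\<in>{..n + 1}.
        (if p \<le> n then vert_diff X p (n - p) (x p) else \<zero>\<^bsub>cochains X (n + 1 - p)\<^esub>)
          \<oplus>\<^bsub>cochains X (n + 1 - p)\<^esub>
        (if 0 < p then horiz_diff X (p - 1) (n + 1 - p) (x (p - 1))
         else \<zero>\<^bsub>cochains X (n + 1 - p)\<^esub>))"

definition cyclic_Z :: "'a cocyclic \<Rightarrow> nat \<Rightarrow> (complex, nat \<Rightarrow> 'a) module" where
  "cyclic_Z X n =
     (tot X n)\<lparr>carrier := {x \<in> carrier (tot X n). tot_diff X n x = \<zero>\<^bsub>tot X (n + 1)\<^esub>}\<rparr>"

definition cyclic_B :: "'a cocyclic \<Rightarrow> nat \<Rightarrow> (nat \<Rightarrow> 'a) set" where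
  "cyclic_B X n =
     (if n = 0 then {\<zero>\<^bsub>tot X 0\<^esub>} else tot_diff X (n - 1) ` carrier (tot X (n - 1)))"

definition HC :: "'a cocyclic \<Rightarrow> nat \<Rightarrow> (complex, (nat \<Rightarrow> 'a) set) module" where
  "HC X n = quot_module (cyclic_Z X n) (cyclic_B X n)"

text \<open>The periodicity operator \<open>HC\<^sup>n \<rightarrow> HC\<^sup>n\<^sup>+\<^sup>2\<close>: the shift of the bicomplex by two columns.\<close>

definition tot_shift :: "'a cocyclic \<Rightarrow> nat \<Rightarrow> (nat \<Rightarrow> 'a) \<Rightarrow> (nat \<Rightarrow> 'a)" where
  "tot_shift X n x =
     (\<lambda>p\<in>{..n + 2}. if p < 2 then \<zero>\<^bsub>cochains X (n + 2 - p)\<^esub> else x (p - 2))"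

definition HC_S :: "'a cocyclic \<Rightarrow> nat \<Rightarrow> (nat \<Rightarrow> 'a) set \<Rightarrow> (nat \<Rightarrow> 'a) set" where
  "HC_S X n U = (\<Union>x\<in>U. cyclic_B X (n + 2) +>\<^bsub>cyclic_Z X (n + 2)\<^esub> tot_shift X n x)"

text \<open>
  The class of a cyclic cocycle, i.e. of an \<open>x\<close> in degree \<open>n\<close> with \<open>b x = 0\<close> and \<open>\<lambda> x = x\<close>,
  placed in column \<open>0\<close>.
\<close>

definition HC_class :: "'a cocyclic \<Rightarrow> nat \<Rightarrow> 'a \<Rightarrow> (nat \<Rightarrow> 'a) set" where
  "HC_class X n x =
     cyclic_B X n +>\<^bsub>cyclic_Z X n\<^esub> (\<lambda>p\<in>{..n}. if p = 0 then x else \<zero>\<^bsub>cochains X (n - p)\<^esub>)"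


section \<open>Direct limits and periodic cyclic cohomology\<close>

text \<open>
  The direct limit of a sequence \<open>V 0 \<rightarrow> V 1 \<rightarrow> \<dots>\<close> with transition maps \<open>f k : V k \<rightarrow> V (k + 1)\<close>:
  pairs \<open>(k, x)\<close> with \<open>x\<close> in \<open>V k\<close>, identified when their images eventually agree.
\<close>

primrec push :: "(nat \<Rightarrow> 'v \<Rightarrow> 'v) \<Rightarrow> nat \<Rightarrow> nat \<Rightarrow> 'v \<Rightarrow> 'v" where
  "push f k 0 x = x"
| "push f k (Suc j) x = f (k + j) (push f k j x)"

definition dirlim_rel ::
  "(nat \<Rightarrow> (complex, 'v) module) \<Rightarrow> (nat \<Rightarrow> 'v \<Rightarrow> 'v) \<Rightarrow> ((nat \<times> 'v) \<times> (nat \<times> 'v)) set" where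
  "dirlim_rel V f =
     {((k, x), (l, y)). x \<in> carrier (V k) \<and> y \<in> carrier (V l) \<and>
        (\<exists>i j. k + i = l + j \<and> push f k i x = push f l j y)}"

definition dirlim_in ::
  "(nat \<Rightarrow> (complex, 'v) module) \<Rightarrow> (nat \<Rightarrow> 'v \<Rightarrow> 'v) \<Rightarrow> nat \<Rightarrow> 'v \<Rightarrow> (nat \<times> 'v) set" where
  "dirlim_in V f k x = dirlim_rel V f `` {(k, x)}"

definition dirlim ::
  "(nat \<Rightarrow> (complex, 'v) module) \<Rightarrow> (nat \<Rightarrow> 'v \<Rightarrow> 'v) \<Rightarrow> (complex, (nat \<times> 'v) set) module" where
  "dirlim V f =
     \<lparr>carrier = (SIGMA k:UNIV. carrier (V k)) // dirlim_rel V f,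
      mult = undefined, one = undefined,
      zero = dirlim_in V f 0 \<zero>\<^bsub>V 0\<^esub>,
      add = (\<lambda>P Q. \<Union>(k, x)\<in>P. \<Union>y\<in>{y. (k, y) \<in> Q}. dirlim_in V f k (x \<oplus>\<^bsub>V k\<^esub> y)),
      smult = (\<lambda>c P. \<Union>(k, x)\<in>P. dirlim_in V f k (c \<odot>\<^bsub>V k\<^esub> x))\<rparr>"

definition HP :: "'a cocyclic \<Rightarrow> nat \<Rightarrow> (complex, (nat \<times> (nat \<Rightarrow> 'a) set) set) module" where
  "HP X r = dirlim (\<lambda>k. HC X (r mod 2 + 2 * k)) (\<lambda>k. HC_S X (r mod 2 + 2 * k))"

text \<open>
  The class in \<open>HP\<close>, in the parity of \<open>n\<close>, of a cyclic cocycle of degree \<open>n\<close>.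
\<close>

definition HP_class :: "'a cocyclic \<Rightarrow> nat \<Rightarrow> 'a \<Rightarrow> (nat \<times> (nat \<Rightarrow> 'a) set) set" where
  "HP_class X n x =
     dirlim_in (\<lambda>k. HC X (n mod 2 + 2 * k)) (\<lambda>k. HC_S X (n mod 2 + 2 * k))
       (n div 2) (HC_class X n x)"


section \<open>The cocyclic module of a Hopf algebra with a modular pair\<close>

record 'a hopf = "(complex, 'a) module" +
  comult :: "'a \<Rightarrow> ('a list \<Rightarrow>\<^sub>0 complex) set"
  counit :: "'a \<Rightarrow> complex"
  antipode :: "'a \<Rightarrow> 'a"

definition twisted_antipode :: "'a hopf \<Rightarrow> ('a \<Rightarrow> complex) \<Rightarrow> 'a \<Rightarrow> 'a" where
  "twisted_antipode H \<delta> h =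
     quot_lift H (\<lambda>hs. \<delta> (hs ! 0) \<odot>\<^bsub>H\<^esub> antipode H (hs ! 1)) (comult H h)"

text \<open>
  The iterated coproduct with values in the \<open>n\<close>-th tensor power; it is the counit for \<open>n = 0\<close>
  and the identity for \<open>n = 1\<close>.
\<close>

primrec iter_comult :: "'a hopf \<Rightarrow> nat \<Rightarrow> 'a \<Rightarrow> ('a list \<Rightarrow>\<^sub>0 complex) set" where
  "iter_comult H 0 h = counit H h \<odot>\<^bsub>tensor_power H 0\<^esub> pure_tensor H []"
| "iter_comult H (Suc n) h =
     quot_lift (tensor_power H (Suc n))
       (\<lambda>hs. quot_lift (tensor_power H (Suc n)) (\<lambda>gs. pure_tensor H (hs ! 0 # gs))
                (iter_comult H n (hs ! 1)))
       (comult H h)"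

definition diag_act ::
  "'a hopf \<Rightarrow> nat \<Rightarrow> 'a \<Rightarrow> ('a list \<Rightarrow>\<^sub>0 complex) set \<Rightarrow> ('a list \<Rightarrow>\<^sub>0 complex) set" where
  "diag_act H n h v = iter_comult H n h \<otimes>\<^bsub>tensor_power H n\<^esub> v"

text \<open>
  In the list \<open>hs\<close> the tensor factor \<open>h\<^sup>i\<close> (for \<open>1 \<le> i \<le> n\<close>) is \<open>hs ! (i - 1)\<close>. In degree \<open>0\<close>,
  where the formula for the cyclic operator makes no sense, it is the identity, as is forced
  by \<open>t\<^sup>n\<^sup>+\<^sup>1 = 1\<close>.
\<close>

definition hopf_coface ::
  "'a hopf \<Rightarrow> 'a \<Rightarrow> nat \<Rightarrow> nat \<Rightarrow> ('a list \<Rightarrow>\<^sub>0 complex) set \<Rightarrow> ('a list \<Rightarrow>\<^sub>0 complex) set" where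
  "hopf_coface H \<sigma> n i =
     quot_lift (tensor_power H (n + 1))
       (\<lambda>hs. if i = 0 then pure_tensor H (\<one>\<^bsub>H\<^esub> # hs)
             else if i \<le> n then
               quot_lift (tensor_power H (n + 1))
                 (\<lambda>gs. pure_tensor H (take (i - 1) hs @ gs @ drop i hs))
                 (comult H (hs ! (i - 1)))
             else pure_tensor H (hs @ [\<sigma>]))"

definition hopf_codegen ::
  "'a hopf \<Rightarrow> nat \<Rightarrow> nat \<Rightarrow> ('a list \<Rightarrow>\<^sub>0 complex) set \<Rightarrow> ('a list \<Rightarrow>\<^sub>0 complex) set" where
  "hopf_codegen H n i =
     quot_lift (tensor_power H (n - 1))
       (\<lambda>hs. counit H (hs ! i) \<odot>\<^bsub>tensor_power H (n - 1)\<^esub>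
               pure_tensor H (take i hs @ drop (i + 1) hs))"

definition hopf_cyc ::
  "'a hopf \<Rightarrow> ('a \<Rightarrow> complex) \<Rightarrow> 'a \<Rightarrow> nat
     \<Rightarrow> ('a list \<Rightarrow>\<^sub>0 complex) set \<Rightarrow> ('a list \<Rightarrow>\<^sub>0 complex) set" where
  "hopf_cyc H \<delta> \<sigma> n =
     (if n = 0 then (\<lambda>u. u)
      else quot_lift (tensor_power H n)
        (\<lambda>hs. diag_act H n (twisted_antipode H \<delta> (hd hs)) (pure_tensor H (tl hs @ [\<sigma>]))))"

definition hopf_cocyclic ::
  "'a hopf \<Rightarrow> ('a \<Rightarrow> complex) \<Rightarrow> 'a \<Rightarrow> ('a list \<Rightarrow>\<^sub>0 complex) set cocyclic" where
  "hopf_cocyclic H \<delta> \<sigma> =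
     \<lparr>cochains = tensor_power H, coface = hopf_coface H \<sigma>,
      codegen = hopf_codegen H, cyc = hopf_cyc H \<delta> \<sigma>\<rparr>"


section \<open>The quantum group \<open>U\<^sub>q(sl\<^sub>2)\<close>\<close>

datatype gen = gE | gF | gK | gKi

text \<open>The free algebra on \<open>E\<close>, \<open>F\<close>, \<open>K\<close>, \<open>K\<^sup>-\<^sup>1\<close>, with basis the words in these letters.\<close>

definition free_alg :: "(complex, gen list \<Rightarrow>\<^sub>0 complex) module" where
  "free_alg =
     \<lparr>carrier = UNIV, mult = bilin_ext (@), one = Poly_Mapping.single [] 1,
      zero = 0, add = (+), smult = scale\<rparr>"

definition Uq_rels :: "complex \<Rightarrow> (gen list \<Rightarrow>\<^sub>0 complex) set" where
  "Uq_rels q =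
     (let w = (\<lambda>xs. Poly_Mapping.single xs 1) in
       {w [gK, gE] - scale (q\<^sup>2) (w [gE, gK]),
        w [gK, gF] - scale (inverse (q\<^sup>2)) (w [gF, gK]),
        w [gK, gKi] - w [],
        w [gKi, gK] - w [],
        w [gE, gF] - w [gF, gE] - scale (1 / (q - inverse q)) (w [gK] - w [gKi])})"

definition Uq_alg :: "complex \<Rightarrow> (complex, (gen list \<Rightarrow>\<^sub>0 complex) set) module" where
  "Uq_alg q = quot_module free_alg (Idl\<^bsub>free_alg\<^esub> (Uq_rels q))"

definition Uq_gen :: "complex \<Rightarrow> gen \<Rightarrow> (gen list \<Rightarrow>\<^sub>0 complex) set" where
  "Uq_gen q g = Idl\<^bsub>free_alg\<^esub> (Uq_rels q) +>\<^bsub>free_alg\<^esub> Poly_Mapping.single [g] 1"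

text \<open>The algebra homomorphism from \<open>U\<^sub>q(sl\<^sub>2)\<close> to \<open>B\<close> with given values on the generators.\<close>

definition Uq_hom ::
  "(complex, 'b) module \<Rightarrow> (gen \<Rightarrow> 'b) \<Rightarrow> (gen list \<Rightarrow>\<^sub>0 complex) set \<Rightarrow> 'b" where
  "Uq_hom B f = quot_lift B (\<lambda>w. foldr (\<lambda>g r. f g \<otimes>\<^bsub>B\<^esub> r) w \<one>\<^bsub>B\<^esub>)"

definition Uq_comult_gen :: "complex \<Rightarrow> gen \<Rightarrow> ((gen list \<Rightarrow>\<^sub>0 complex) set list \<Rightarrow>\<^sub>0 complex) set" where
  "Uq_comult_gen q g =
     (let A = Uq_alg q; T = tensor_power A 2;
          E = Uq_gen q gE; F = Uq_gen q gF; K = Uq_gen q gK; Ki = Uq_gen q gKi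
      in case g of
           gE \<Rightarrow> pure_tensor A [\<one>\<^bsub>A\<^esub>, E] \<oplus>\<^bsub>T\<^esub> pure_tensor A [E, K]
         | gF \<Rightarrow> pure_tensor A [Ki, F] \<oplus>\<^bsub>T\<^esub> pure_tensor A [F, \<one>\<^bsub>A\<^esub>]
         | gK \<Rightarrow> pure_tensor A [K, K]
         | gKi \<Rightarrow> pure_tensor A [Ki, Ki])"

definition Uq_counit_gen :: "gen \<Rightarrow> complex" where
  "Uq_counit_gen g = (case g of gE \<Rightarrow> 0 | gF \<Rightarrow> 0 | gK \<Rightarrow> 1 | gKi \<Rightarrow> 1)"

definition Uq_antipode_gen :: "complex \<Rightarrow> gen \<Rightarrow> (gen list \<Rightarrow>\<^sub>0 complex) set" where
  "Uq_antipode_gen q g =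
     (let A = Uq_alg q;
          E = Uq_gen q gE; F = Uq_gen q gF; K = Uq_gen q gK; Ki = Uq_gen q gKi
      in case g of
           gE \<Rightarrow> \<ominus>\<^bsub>A\<^esub> (E \<otimes>\<^bsub>A\<^esub> Ki)
         | gF \<Rightarrow> \<ominus>\<^bsub>A\<^esub> (K \<otimes>\<^bsub>A\<^esub> F)
         | gK \<Rightarrow> Ki
         | gKi \<Rightarrow> K)"

text \<open>The antipode is an anti-homomorphism, hence a homomorphism to the opposite algebra.\<close>

definition Uq :: "complex \<Rightarrow> (gen list \<Rightarrow>\<^sub>0 complex) set hopf" where
  "Uq q =
     \<lparr>carrier = carrier (Uq_alg q), mult = mult (Uq_alg q), one = one (Uq_alg q),
      zero = zero (Uq_alg q), add = add (Uq_alg q), smult = smult (Uq_alg q),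
      comult = Uq_hom (tensor_power (Uq_alg q) 2) (Uq_comult_gen q),
      counit = Uq_hom complex_alg Uq_counit_gen,
      antipode = Uq_hom (op_alg (Uq_alg q)) (Uq_antipode_gen q)\<rparr>"

end

(*
The PBW monomials F^j E^i K^n can be viewed as arrows n - j -> n + i of a graph on the integers, and
the coproduct of a monomial is a combination of its factorizations into two composable arrows, in
which the trivial factorizations K^(n-j) (x) b and b (x) K^(n+i) have coefficient 1. The Hochschild
complex with end points 1 and K therefore splits into tuples of arrows that have a mismatch
somewhere, which are contractible, and composable tuples from 0 to 1. The latter consist of
identities and exactly one arrow of degree one, namely E or FK, so Hochschild cohomology is spanned
by E and KF in degree 1 and vanishes otherwise; this needs no assumption on roots of unity. Since
the b'-columns are acyclic, the periodicity operator is then bijective on HC^n for n >= 1, HC^n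
vanishes for even n, and HC^1 = C^2 is the Hochschild cohomology.

That the bicomplex is a complex rests on the relations between the cyclic operator t and the
cofaces and on t^(n+1) = 1. They are reduced to generators: the key identity is
t(S(x) v) = t(v) (1 (x) ... (x) 1 (x) x), both sides of which are multiplicative in x.
*)
theory Submission
  imports Defs "HOL-Library.Function_Algebras"
begin

section \<open>Finitely supported vectors\<close>

text \<open>The objects of the statement are nested cosets: a free algebra modulo an ideal, free
  spaces on tuples of such cosets modulo multilinearity, and quotients of cocycles by coboundaries.
  All computation is therefore done in coordinates, with finitely supported functions on triples
  \<open>(j, i, n)\<close> and on lists of triples. It is transferred at the end by exhibiting each
  algebraic quotient as the target of a linear map with the right kernel. The price is the PBW
  theorem, whose difficult half, independence of the monomials, comes from an explicit action on
  triples that respects the relations. The same device, a space on which four operators satisfy the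
  relations, yields the iterated coproducts and the antipode as well-defined maps. Most identities
  then follow by induction on left multiplication by a generator. The condition on S^2 is never
  treated by itself: it enters when S(g) is moved through t for a generator g. The cyclicity of t
  becomes visible on the coinvariants of the diagonal action on one more tensor factor, where t is a
  rotation up to K.\<close>

abbreviation basis :: "'k \<Rightarrow> ('k \<Rightarrow>\<^sub>0 complex)" where
  "basis k \<equiv> Poly_Mapping.single k 1"

lemma lookup_scale [simp]: "Poly_Mapping.lookup (scale c x) k = c * Poly_Mapping.lookup x k"
  unfolding scale_def by (simp add: Poly_Mapping.map.rep_eq when_def)

lemma scale_simps [simp]:
  "scale c 0 = 0" "scale 0 x = 0" "scale 1 x = x" "scale c (scale d x) = scale (c * d) x"
  "scale (- 1) x = - x" "scale c (- x) = - scale c x" "scale (- c) x = - scale c x"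
  by (rule poly_mapping_eqI; simp)+

lemma scale_add: "scale c (x + y) = scale c x + scale c y"
  by (rule poly_mapping_eqI) (simp add: lookup_add algebra_simps)

lemma scale_diff: "scale c (x - y) = scale c x - scale c y"
  by (rule poly_mapping_eqI) (simp add: lookup_minus algebra_simps)

lemma scale_left_add: "scale (c + d) x = scale c x + scale d x"
  by (rule poly_mapping_eqI) (simp add: lookup_add algebra_simps)

lemma scale_left_diff: "scale (c - d) x = scale c x - scale d x"
  by (rule poly_mapping_eqI) (simp add: lookup_minus algebra_simps)

lemma scale_sum: "scale c (sum f A) = (\<Sum>a\<in>A. scale c (f a))"
  by (induction A rule: infinite_finite_induct) (auto simp: scale_add)

lemma single_scale: "Poly_Mapping.single k c = scale c (basis k)"
  by (rule poly_mapping_eqI) (simp add: lookup_single when_def)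

lemma keys_scale: "Poly_Mapping.keys (scale c x) \<subseteq> Poly_Mapping.keys x"
  by (auto simp: in_keys_iff)

lemma keys_uminus [simp]: "Poly_Mapping.keys (- (x :: 'k \<Rightarrow>\<^sub>0 complex)) = Poly_Mapping.keys x"
  by (auto simp: in_keys_iff)

lemma keys_minus: "Poly_Mapping.keys (x - y) \<subseteq> Poly_Mapping.keys x \<union> Poly_Mapping.keys (y :: 'k \<Rightarrow>\<^sub>0 complex)"
  by (auto simp: in_keys_iff lookup_minus)

lemma keys_basis [simp]: "Poly_Mapping.keys (basis k) = {k}"
  by simp

lemma basis_nonzero [simp]: "basis k \<noteq> 0"
  by (metis keys_basis keys_zero insert_not_empty)

text \<open>Counterpart of \<open>lin_ext\<close> with values in a free space. Together with
  \<open>lmap\<close> it replaces universal properties: a multilinear identity is checked on basis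
  elements by \<open>lmap_eqI\<close>, one argument at a time.\<close>

definition lin :: "('k \<Rightarrow> ('l \<Rightarrow>\<^sub>0 complex)) \<Rightarrow> ('k \<Rightarrow>\<^sub>0 complex) \<Rightarrow> ('l \<Rightarrow>\<^sub>0 complex)" where
  "lin f x = (\<Sum>k\<in>Poly_Mapping.keys x. scale (Poly_Mapping.lookup x k) (f k))"

lemma lin_superset:
  assumes "finite A" "Poly_Mapping.keys x \<subseteq> A"
  shows "lin f x = (\<Sum>k\<in>A. scale (Poly_Mapping.lookup x k) (f k))"
  unfolding lin_def using assms
  by (intro sum.mono_neutral_left) (auto simp: in_keys_iff)

definition lmap :: "(('k \<Rightarrow>\<^sub>0 complex) \<Rightarrow> ('l \<Rightarrow>\<^sub>0 complex)) \<Rightarrow> bool" where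
  "lmap F \<longleftrightarrow> (\<forall>x y. F (x + y) = F x + F y) \<and> (\<forall>c x. F (scale c x) = scale c (F x))"

named_theorems lmap_intros

lemma lmap_add: "lmap F \<Longrightarrow> F (x + y) = F x + F y"
  by (simp add: lmap_def)

lemma lmap_scale: "lmap F \<Longrightarrow> F (scale c x) = scale c (F x)"
  by (simp add: lmap_def)

lemma lmap_zero: "lmap F \<Longrightarrow> F 0 = 0"
  using lmap_scale[of F 0 0] by simp

lemma lmap_uminus: "lmap F \<Longrightarrow> F (- x) = - F x"
  using lmap_scale[of F "- 1" x] by simp

lemma lmap_diff: "lmap F \<Longrightarrow> F (x - y) = F x - F y"
  using lmap_add[of F x "- y"] by (simp add: lmap_uminus)

lemma lmap_sum: "lmap F \<Longrightarrow> F (sum g A) = (\<Sum>a\<in>A. F (g a))"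
  by (induction A rule: infinite_finite_induct) (auto simp: lmap_add lmap_zero)

lemmas lmap_simps = lmap_add lmap_scale lmap_zero lmap_uminus lmap_diff

lemma lin_add: "lin f (x + y) = lin f x + lin f y"
proof -
  let ?A = "Poly_Mapping.keys x \<union> Poly_Mapping.keys y"
  have "Poly_Mapping.keys (x + y) \<subseteq> ?A" by (rule keys_add)
  then show ?thesis
    by (simp add: lin_superset[of ?A] lookup_add scale_left_add sum.distrib)
qed

lemma lin_scale: "lin f (scale c x) = scale c (lin f x)"
  using keys_scale[of c x]
  by (subst (1 2) lin_superset[of "Poly_Mapping.keys x"]) (auto simp: scale_sum)

lemma lmap_lin: "lmap (lin f)"
  by (simp add: lmap_def lin_add lin_scale)

lemma lin_basis [simp]: "lin f (basis k) = f k"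
  by (simp add: lin_def)

lemma lin_simps [simp]:
  "lin f 0 = 0" "lin f (x + y) = lin f x + lin f y" "lin f (x - y) = lin f x - lin f y"
  "lin f (- x) = - lin f x" "lin f (scale c x) = scale c (lin f x)"
  "lin f (Poly_Mapping.single k c) = scale c (f k)"
  by (simp_all add: lmap_simps[OF lmap_lin])
     (metis lin_basis lin_scale single_scale)

lemma lin_cong: "(\<And>k. k \<in> Poly_Mapping.keys x \<Longrightarrow> f k = g k) \<Longrightarrow> lin f x = lin g x"
  by (simp add: lin_def)

lemma lin_basis_id [simp]: "lin basis x = x"
proof (rule poly_mapping_eqI)
  fix k
  have "Poly_Mapping.lookup (lin basis x) k
      = (\<Sum>j\<in>Poly_Mapping.keys x. Poly_Mapping.lookup x j * (1 when j = k))"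
    by (simp add: lin_def lookup_sum lookup_single)
  also have "\<dots> = (\<Sum>j\<in>Poly_Mapping.keys x. if j = k then Poly_Mapping.lookup x k else 0)"
    by (intro sum.cong) (auto simp: when_def)
  also have "\<dots> = Poly_Mapping.lookup x k"
    by (auto simp: in_keys_iff)
  finally show "Poly_Mapping.lookup (lin basis x) k = Poly_Mapping.lookup x k" .
qed

lemma lmap_eq_lin: "lmap F \<Longrightarrow> F x = lin (\<lambda>k. F (basis k)) x"
proof -
  assume F: "lmap F"
  have "F x = F (lin basis x)" by simp
  also have "\<dots> = lin (\<lambda>k. F (basis k)) x"
    by (simp only: lin_def lmap_sum[OF F] lmap_scale[OF F])
  finally show ?thesis .
qed

lemma lmap_eqI:
  assumes "lmap F" "lmap G" "\<And>k. k \<in> Poly_Mapping.keys x \<Longrightarrow> F (basis k) = G (basis k)"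
  shows "F x = G x"
  by (simp only: lmap_eq_lin[OF assms(1), of x] lmap_eq_lin[OF assms(2), of x])
     (auto intro: lin_cong assms(3))

lemma lin_lin: "lin f (lin g x) = lin (\<lambda>k. lin f (g k)) x"
  by (rule lmap_eqI) (simp_all add: lmap_def)

lemma lmap_lin_comp: "lmap F \<Longrightarrow> F (lin g x) = lin (\<lambda>k. F (g k)) x"
  by (simp add: lin_def lmap_sum lmap_scale)

lemma lin_fun_add: "lin (\<lambda>k. f k + g k) x = lin f x + lin g x"
  by (simp add: lin_def scale_add sum.distrib)

lemma lin_fun_scale: "lin (\<lambda>k. scale c (f k)) x = scale c (lin f x)"
  by (simp add: lin_def scale_sum mult.commute)

lemma lin_fun_zero [simp]: "lin (\<lambda>k. 0) x = 0"
  by (simp add: lin_def)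

lemma lin_fun_uminus: "lin (\<lambda>k. - f k) x = - lin f x"
  using lin_fun_scale[of "-1"] by simp

lemma lin_fun_diff: "lin (\<lambda>k. f k - g k) x = lin f x - lin g x"
  using lin_fun_add[of f "\<lambda>k. - g k"] by (simp add: lin_fun_uminus)

lemma lmap_id [lmap_intros]: "lmap (\<lambda>x. x)"
  by (simp add: lmap_def)

lemma lmap_linI [lmap_intros]: "lmap G \<Longrightarrow> lmap (\<lambda>x. lin f (G x))"
  by (simp add: lmap_def)

lemma lmap_const_zero [lmap_intros]: "lmap (\<lambda>x. 0)"
  by (simp add: lmap_def)

lemma lmap_scaleI [lmap_intros]: "lmap G \<Longrightarrow> lmap (\<lambda>x. scale c (G x))"
  by (simp add: lmap_def scale_add mult.commute)

lemma lmap_addI [lmap_intros]: "lmap F \<Longrightarrow> lmap G \<Longrightarrow> lmap (\<lambda>x. F x + G x)"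
  by (simp add: lmap_def scale_add algebra_simps)

lemma lmap_diffI [lmap_intros]: "lmap F \<Longrightarrow> lmap G \<Longrightarrow> lmap (\<lambda>x. F x - G x)"
  by (simp add: lmap_def scale_diff algebra_simps)

lemma lmap_uminusI [lmap_intros]: "lmap G \<Longrightarrow> lmap (\<lambda>x. - G x)"
  by (simp add: lmap_def)

lemma lmap_lin_fun: "(\<And>k. lmap (\<lambda>x. f x k)) \<Longrightarrow> lmap (\<lambda>x. lin (f x) y)"
  by (simp add: lmap_def lin_def scale_add sum.distrib scale_sum mult.commute)

lemma lin_commute: "lin (\<lambda>a. lin (\<lambda>b. f a b) y) x = lin (\<lambda>b. lin (\<lambda>a. f a b) x) y"
  by (rule lmap_eqI[where F = "lin (\<lambda>a. lin (\<lambda>b. f a b) y)" and G = "\<lambda>x. lin (\<lambda>b. lin (\<lambda>a. f a b) x) y"])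
     (auto intro: lmap_lin lmap_lin_fun)

lemma lmap_comp: "lmap F \<Longrightarrow> lmap G \<Longrightarrow> lmap (\<lambda>x. F (G x))"
  by (simp add: lmap_def)

lemma lmap_sumI [lmap_intros]: "(\<And>a. a \<in> A \<Longrightarrow> lmap (F a)) \<Longrightarrow> lmap (\<lambda>x. \<Sum>a\<in>A. F a x)"
  by (induction A rule: infinite_finite_induct) (auto intro!: lmap_intros)

text \<open>The span of part of the basis. Degrees and end points of arrows are all expressed by
  such sets, so closure is proved on basis elements.\<close>

definition supp_in :: "'k set \<Rightarrow> ('k \<Rightarrow>\<^sub>0 complex) set" where
  "supp_in A = {x. Poly_Mapping.keys x \<subseteq> A}"

lemma supp_in_simps [simp]:
  "0 \<in> supp_in A" "x \<in> supp_in A \<Longrightarrow> y \<in> supp_in A \<Longrightarrow> x + y \<in> supp_in A"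
  "x \<in> supp_in A \<Longrightarrow> y \<in> supp_in A \<Longrightarrow> x - y \<in> supp_in A"
  "x \<in> supp_in A \<Longrightarrow> - x \<in> supp_in A"
  "x \<in> supp_in A \<Longrightarrow> scale c x \<in> supp_in A"
  "basis k \<in> supp_in A \<longleftrightarrow> k \<in> A"
  using keys_add[of x y] keys_minus[of x y] keys_scale[of c x]
  by (auto simp: supp_in_def)

lemma supp_in_sum: "(\<And>a. a \<in> I \<Longrightarrow> f a \<in> supp_in A) \<Longrightarrow> sum f I \<in> supp_in A"
  by (induction I rule: infinite_finite_induct) auto

lemma supp_in_lin: "x \<in> supp_in A \<Longrightarrow> (\<And>k. k \<in> A \<Longrightarrow> f k \<in> supp_in C) \<Longrightarrow> lin f x \<in> supp_in C"
  unfolding lin_def by (intro supp_in_sum) (auto simp: supp_in_def[of A])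

lemma supp_in_keys: "x \<in> supp_in A \<Longrightarrow> k \<in> Poly_Mapping.keys x \<Longrightarrow> k \<in> A"
  by (auto simp: supp_in_def)

lemma supp_in_eqI:
  assumes "x \<in> supp_in A" "lmap F" "lmap G" "\<And>k. k \<in> A \<Longrightarrow> F (basis k) = G (basis k)"
  shows "F x = G x"
  by (rule lmap_eqI[OF assms(2,3)]) (rule assms(4)[OF supp_in_keys[OF assms(1)]])

lemma bilin_ext_lin: "bilin_ext f x y = lin (\<lambda>a. lin (\<lambda>b. basis (f a b)) y) x"
  by (simp add: bilin_ext_def lin_def scale_sum single_scale[of _ "_ * _"])

section \<open>A PBW basis of the quantum group\<close>

abbreviation fmult :: "(gen list \<Rightarrow>\<^sub>0 complex) \<Rightarrow> (gen list \<Rightarrow>\<^sub>0 complex) \<Rightarrow> (gen list \<Rightarrow>\<^sub>0 complex)" where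
  "fmult \<equiv> bilin_ext (@)"

lemma fmult_assoc: "fmult (fmult x y) z = fmult x (fmult y z)"
  by (simp add: bilin_ext_lin lin_lin)

lemma fmult_distrib:
  "fmult (x + y) z = fmult x z + fmult y z" "fmult z (x + y) = fmult z x + fmult z y"
  "fmult (x - y) z = fmult x z - fmult y z" "fmult z (x - y) = fmult z x - fmult z y"
  "fmult (scale c x) z = scale c (fmult x z)" "fmult z (scale c x) = scale c (fmult z x)"
  by (simp_all add: bilin_ext_lin lin_fun_add lin_fun_diff lin_fun_scale)

lemma fmult_basis [simp]: "fmult (basis xs) (basis ys) = basis (xs @ ys)"
  by (simp add: bilin_ext_lin)

lemma fmult_one [simp]: "fmult (basis []) x = x" "fmult x (basis []) = x"
  by (simp_all add: bilin_ext_lin)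

lemma free_alg_simps [simp]:
  "carrier free_alg = UNIV" "x \<otimes>\<^bsub>free_alg\<^esub> y = fmult x y" "\<one>\<^bsub>free_alg\<^esub> = basis []"
  "\<zero>\<^bsub>free_alg\<^esub> = 0" "x \<oplus>\<^bsub>free_alg\<^esub> y = x + y" "c \<odot>\<^bsub>free_alg\<^esub> x = scale c x"
  by (simp_all add: free_alg_def)

lemma ring_free_alg: "ring free_alg"
proof (rule ringI)
  show "abelian_group free_alg"
    by (rule abelian_groupI) (auto simp: add.assoc add.commute intro: exI[of _ "- _"] ab_left_minus)
  show "monoid free_alg"
    by (rule monoidI) (auto simp: fmult_assoc)
qed (auto simp: fmult_distrib)

lemma a_inv_free_alg: "a_inv free_alg x = - x"
proof -
  interpret ring free_alg by (rule ring_free_alg)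
  show ?thesis by (rule minus_equality) auto
qed

lemma ideal_free_algI:
  assumes "0 \<in> I" "\<And>x y. x \<in> I \<Longrightarrow> y \<in> I \<Longrightarrow> x + y \<in> I" "\<And>x. x \<in> I \<Longrightarrow> - x \<in> I"
    and "\<And>x y. x \<in> I \<Longrightarrow> fmult y x \<in> I" "\<And>x y. x \<in> I \<Longrightarrow> fmult x y \<in> I"
  shows "ideal I free_alg"
proof (rule idealI)
  have "m_inv (add_monoid free_alg) x = - x" for x
    by (metis a_inv_def a_inv_free_alg)
  then show "subgroup I (add_monoid free_alg)"
    using assms by (auto intro!: subgroup.intro simp: free_alg_def)
qed (use assms ring_free_alg in auto)

lemma ideal_free_algD:
  assumes "ideal I free_alg"
  shows "0 \<in> I" "x \<in> I \<Longrightarrow> y \<in> I \<Longrightarrow> x + y \<in> I" "x \<in> I \<Longrightarrow> - x \<in> I"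
    and "x \<in> I \<Longrightarrow> fmult y x \<in> I" "x \<in> I \<Longrightarrow> fmult x y \<in> I" "x \<in> I \<Longrightarrow> scale c x \<in> I"
proof -
  interpret ideal I free_alg by fact
  show "0 \<in> I" using additive_subgroup.zero_closed[OF is_additive_subgroup] by simp
  show "x \<in> I \<Longrightarrow> y \<in> I \<Longrightarrow> x + y \<in> I" using additive_subgroup.a_closed[OF is_additive_subgroup] by simp
  show "x \<in> I \<Longrightarrow> - x \<in> I" using additive_subgroup.a_inv_closed[OF is_additive_subgroup, of x] by (simp add: a_inv_free_alg)
  show l: "x \<in> I \<Longrightarrow> fmult y x \<in> I" for y using I_l_closed[of x y] by simp
  show "x \<in> I \<Longrightarrow> fmult x y \<in> I" using I_r_closed[of x y] by simp
  \<comment> \<open>Scaling is multiplication by a multiple of the empty word, which is why a ring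
    ideal is automatically a subspace.\<close>
  have "scale c x = fmult (scale c (basis [])) x" by (simp add: fmult_distrib)
  then show "x \<in> I \<Longrightarrow> scale c x \<in> I" using l by simp
qed

section \<open>The regular representation on PBW triples\<close>

type_synonym pbw = "nat \<times> nat \<times> int"
type_synonym pbwV = "pbw \<Rightarrow>\<^sub>0 complex"
type_synonym pbwT = "pbw list \<Rightarrow>\<^sub>0 complex"

text \<open>The triple \<open>(j, i, n)\<close> stands for the monomial \<open>F\<^sup>j E\<^sup>i K\<^sup>n\<close>.\<close>

definition pbw_word :: "pbw \<Rightarrow> gen list" where
  "pbw_word b = (case b of (j, i, n) \<Rightarrow> replicate j gF @ replicate i gE @
     (if 0 \<le> n then replicate (nat n) gK else replicate (nat (- n)) gKi))"

locale quantum =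
  fixes q :: complex
  assumes q_nonzero: "q \<noteq> 0" and q_square: "q\<^sup>2 \<noteq> 1"
begin

definition Q :: "int \<Rightarrow> complex" where "Q n = (q\<^sup>2) powi n"

lemma Q_add: "Q (m + n) = Q m * Q n"
  using q_nonzero by (simp add: power_int_add Q_def)

lemma Q_nonzero [simp]: "Q n \<noteq> 0"
  using q_nonzero by (simp add: Q_def)

lemma Q_0 [simp]: "Q 0 = 1"
  by (simp add: Q_def)

lemma Q_square: "q\<^sup>2 = Q 1" "inverse (q\<^sup>2) = Q (- 1)" "inverse (Q n) = Q (- n)"
  by (simp_all add: Q_def power_int_minus)

definition cc :: complex where "cc = 1 / (q - inverse q)"

text \<open>From E F^j - F^j E = sum over r < j of F^(j-1-r) [E,F] F^r. Moving K or K^-1 to the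
  right past F^r costs q^(-2r) or q^(2r), whence \<open>s = - 1\<close> and \<open>s = 1\<close>.
  The value 0 at \<open>j = 0\<close> makes the truncated \<open>j - 1\<close> in
  \<open>act_basis\<close> harmless.\<close>

definition EF_coeff :: "int \<Rightarrow> nat \<Rightarrow> complex" where
  "EF_coeff s j = (\<Sum>r<j. cc * Q (s * int r))"

lemma EF_coeff_simps [simp]:
  "EF_coeff s 0 = 0" "EF_coeff s (Suc j) = EF_coeff s j + cc * Q (s * int j)"
  by (simp_all add: EF_coeff_def)

text \<open>Left multiplication on monomials; the last two terms for \<open>E\<close> come from \<open>[E, F\<^sup>j] E\<^sup>i K\<^sup>n\<close>.\<close>

fun act_basis :: "gen \<Rightarrow> pbw \<Rightarrow> pbwV" where
  "act_basis gF (j, i, n) = basis (Suc j, i, n)"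
| "act_basis gK (j, i, n) = scale (Q (int i - int j)) (basis (j, i, n + 1))"
| "act_basis gKi (j, i, n) = scale (Q (int j - int i)) (basis (j, i, n - 1))"
| "act_basis gE (j, i, n) = basis (j, Suc i, n)
     + scale (EF_coeff (- 1) j * Q (int i)) (basis (j - 1, i, n + 1))
     - scale (EF_coeff 1 j * Q (- int i)) (basis (j - 1, i, n - 1))"

abbreviation act :: "gen \<Rightarrow> pbwV \<Rightarrow> pbwV" where
  "act g \<equiv> lin (act_basis g)"

abbreviation one_H :: "pbw \<Rightarrow>\<^sub>0 complex" where "one_H \<equiv> basis (0, 0, 0)"

end

text \<open>A representation given by four operators on the span of \<open>A\<close>. Instances are
  the regular representation, multiplication by iterated coproducts and, for the antipode, right
  multiplication. The relations are required on that span only, because the coproduct in degree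
  \<open>n\<close> annihilates tensors of other lengths.\<close>

locale uq_module = quantum +
  fixes G :: "gen \<Rightarrow> ('l \<Rightarrow>\<^sub>0 complex) \<Rightarrow> ('l \<Rightarrow>\<^sub>0 complex)" and A :: "'l set"
  assumes G_lmap: "lmap (G g)"
    and G_closed: "v \<in> supp_in A \<Longrightarrow> G g v \<in> supp_in A"
    and G_KE: "v \<in> supp_in A \<Longrightarrow> G gK (G gE v) = scale (q\<^sup>2) (G gE (G gK v))"
    and G_KF: "v \<in> supp_in A \<Longrightarrow> G gK (G gF v) = scale (inverse (q\<^sup>2)) (G gF (G gK v))"
    and G_KKi: "v \<in> supp_in A \<Longrightarrow> G gK (G gKi v) = v"
    and G_KiK: "v \<in> supp_in A \<Longrightarrow> G gKi (G gK v) = v"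
    and G_EF: "v \<in> supp_in A \<Longrightarrow> G gE (G gF v) - G gF (G gE v) = scale cc (G gK v - G gKi v)"
begin

lemma G_word_lmap: "lmap (foldr G w)"
  by (induction w) (auto simp: id_def o_def intro: lmap_id lmap_comp[OF G_lmap])

lemma G_word_closed: "v \<in> supp_in A \<Longrightarrow> foldr G w v \<in> supp_in A"
  by (induction w) (auto simp: G_closed)

definition wact :: "(gen list \<Rightarrow>\<^sub>0 complex) \<Rightarrow> ('l \<Rightarrow>\<^sub>0 complex) \<Rightarrow> ('l \<Rightarrow>\<^sub>0 complex)" where
  "wact p v = lin (\<lambda>w. foldr G w v) p"

lemma wact_simps [simp]:
  "wact (basis w) v = foldr G w v" "wact (x + y) v = wact x v + wact y v"
  "wact (x - y) v = wact x v - wact y v" "wact (- x) v = - wact x v"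
  "wact (scale c x) v = scale c (wact x v)" "wact 0 v = 0"
  by (simp_all add: wact_def)

lemma wact_lmap: "lmap (wact p)"
proof -
  have "lmap (\<lambda>v. lin (\<lambda>w. foldr G w v) p)"
    using G_word_lmap by (rule lmap_lin_fun)
  then show ?thesis by (simp add: wact_def[abs_def])
qed

lemma wact_fmult: "wact (fmult x y) v = wact x (wact y v)"
  unfolding wact_def
  by (simp add: bilin_ext_lin lin_lin lmap_lin_comp[OF G_word_lmap])

lemma wact_closed: "v \<in> supp_in A \<Longrightarrow> wact p v \<in> supp_in A"
  unfolding wact_def by (rule supp_in_lin[of _ UNIV]) (auto simp: supp_in_def[of UNIV] G_word_closed)

text \<open>Two-sided since the action is multiplicative and preserves the span of \<open>A\<close>.
  It contains the relations, hence the ideal that they generate, so the quotient algebra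
  acts.\<close>

lemma ideal_annihilator: "ideal {p. \<forall>v\<in>supp_in A. wact p v = 0} free_alg"
  by (rule ideal_free_algI)
     (auto simp: wact_fmult wact_closed lmap_zero[OF wact_lmap])

lemma Uq_rels_annihilate:
  assumes "p \<in> Uq_rels q" "v \<in> supp_in A"
  shows "wact p v = 0"
  using assms G_EF[OF assms(2)] unfolding Uq_rels_def Let_def
  by (auto simp: G_KE G_KF G_KKi G_KiK cc_def)

lemma Idl_annihilates:
  assumes "p \<in> Idl\<^bsub>free_alg\<^esub> (Uq_rels q)" "v \<in> supp_in A"
  shows "wact p v = 0"
proof -
  have "Idl\<^bsub>free_alg\<^esub> (Uq_rels q) \<subseteq> {p. \<forall>v\<in>supp_in A. wact p v = 0}"
    unfolding genideal_def using ideal_annihilator Uq_rels_annihilate by (intro Inter_lower) auto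
  then show ?thesis using assms by auto
qed

end

context quantum
begin

text \<open>Rewriting towards a normal form: powers of q move to the front and merge, after which
  both sides of a relation can be compared termwise.\<close>

lemma Q_norm:
  "Q m * Q n = Q (m + n)" "Q m * (Q n * z) = Q (m + n) * z"
  "cc * Q m = Q m * cc" "cc * (Q m * z) = Q m * (cc * z)"
  "EF_coeff s j * Q m = Q m * EF_coeff s j" "EF_coeff s j * (Q m * z) = Q m * (EF_coeff s j * z)"
  "EF_coeff s j * cc = cc * EF_coeff s j"
  by (simp_all add: Q_add algebra_simps)

text \<open>The source of the independence of the PBW monomials: the ideal acts by zero on a space
  whose basis consists of the triples.\<close>

sublocale regular: uq_module q act UNIV
proof
  fix v :: "pbw \<Rightarrow>\<^sub>0 complex"
  show "lmap (act g)" for g by (rule lmap_lin)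
  show "act g v \<in> supp_in UNIV" for g by (simp add: supp_in_def)
  note rules = lmap_intros
  have *: "int (j - Suc 0) = int j - 1" if "j \<noteq> 0" for j using that by simp
  show "act gK (act gE v) = scale (q\<^sup>2) (act gE (act gK v))"
  proof (rule lmap_eqI[of _ _ v])
    fix b :: pbw
    obtain j i n where b: "b = (j, i, n)" by (cases b)
    show "act gK (act gE (basis b)) = scale (q\<^sup>2) (act gE (act gK (basis b)))"
      \<comment> \<open>Splitting \<open>j\<close> into zero and successor removes the truncated
        \<open>j - 1\<close>.\<close>
      by (cases j) (simp_all add: b scale_add scale_diff Q_square Q_norm distrib_left distrib_right mult.assoc left_diff_distrib right_diff_distrib add_ac diff_add_eq diff_diff_add add_diff_eq diff_diff_eq2)
  qed (intro rules)+
  show "act gK (act gF v) = scale (inverse (q\<^sup>2)) (act gF (act gK v))"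
  proof (rule lmap_eqI[of _ _ v])
    fix b :: pbw
    obtain j i n where b: "b = (j, i, n)" by (cases b)
    show "act gK (act gF (basis b)) = scale (inverse (q\<^sup>2)) (act gF (act gK (basis b)))"
      by (simp add: b Q_square Q_norm distrib_left distrib_right mult.assoc left_diff_distrib right_diff_distrib add_ac diff_add_eq diff_diff_add add_diff_eq diff_diff_eq2)
  qed (intro rules)+
  show "act gK (act gKi v) = v"
  proof (rule lmap_eqI[of _ _ v])
    fix b :: pbw
    obtain j i n where b: "b = (j, i, n)" by (cases b)
    show "act gK (act gKi (basis b)) = basis b"
      by (simp add: b Q_square Q_norm distrib_left distrib_right mult.assoc left_diff_distrib right_diff_distrib add_ac diff_add_eq diff_diff_add add_diff_eq diff_diff_eq2)
  qed (intro rules)+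
  show "act gKi (act gK v) = v"
  proof (rule lmap_eqI[of _ _ v])
    fix b :: pbw
    obtain j i n where b: "b = (j, i, n)" by (cases b)
    show "act gKi (act gK (basis b)) = basis b"
      by (simp add: b Q_square Q_norm distrib_left distrib_right mult.assoc left_diff_distrib right_diff_distrib add_ac diff_add_eq diff_diff_add add_diff_eq diff_diff_eq2)
  qed (intro rules)+
  show "act gE (act gF v) - act gF (act gE v) = scale cc (act gK v - act gKi v)"
  proof (rule lmap_eqI[of _ _ v])
    fix b :: pbw
    obtain j i n where b: "b = (j, i, n)" by (cases b)
    show "act gE (act gF (basis b)) - act gF (act gE (basis b)) = scale cc (act gK (basis b) - act gKi (basis b))"
      by (cases j) (simp_all add: b scale_add scale_diff scale_left_add scale_left_diff Q_square Q_norm distrib_left distrib_right mult.assoc left_diff_distrib right_diff_distrib add_ac diff_add_eq diff_diff_add add_diff_eq diff_diff_eq2)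
  qed (intro rules)+
qed

section \<open>Normal forms modulo the defining relations\<close>

definition I_rel :: "(gen list \<Rightarrow>\<^sub>0 complex) set" where
  "I_rel = Idl\<^bsub>free_alg\<^esub> (Uq_rels q)"

definition cong :: "(gen list \<Rightarrow>\<^sub>0 complex) \<Rightarrow> (gen list \<Rightarrow>\<^sub>0 complex) \<Rightarrow> bool" (infix "\<approx>" 50) where
  "x \<approx> y \<longleftrightarrow> x - y \<in> I_rel"

lemma ideal_I_rel: "ideal I_rel free_alg"
  unfolding I_rel_def by (rule ring.genideal_ideal[OF ring_free_alg]) simp

lemmas I_relD = ideal_free_algD[OF ideal_I_rel]

lemma cong_rel: "x - y \<in> Uq_rels q \<Longrightarrow> x \<approx> y"
  unfolding cong_def I_rel_def using ring.genideal_self[OF ring_free_alg, of "Uq_rels q"] by auto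

lemma cong_refl [simp]: "x \<approx> x"
  by (simp add: cong_def I_relD)

lemma cong_sym: "x \<approx> y \<Longrightarrow> y \<approx> x"
  using I_relD(3)[of "x - y"] by (simp add: cong_def)

lemma cong_trans [trans]: "x \<approx> y \<Longrightarrow> y \<approx> z \<Longrightarrow> x \<approx> z"
  using I_relD(2)[of "x - y" "y - z"] by (simp add: cong_def)

lemma cong_eq_trans [trans]: "x \<approx> y \<Longrightarrow> y = z \<Longrightarrow> x \<approx> z" "x = y \<Longrightarrow> y \<approx> z \<Longrightarrow> x \<approx> z"
  by simp_all

lemma cong_add: "x \<approx> y \<Longrightarrow> x' \<approx> y' \<Longrightarrow> x + x' \<approx> y + y'"
  using I_relD(2)[of "x - y" "x' - y'"] by (simp add: cong_def algebra_simps)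

lemma cong_diff: "x \<approx> y \<Longrightarrow> x' \<approx> y' \<Longrightarrow> x - x' \<approx> y - y'"
  using I_relD(2)[of "x - y" "y' - x'"] cong_sym[of x' y'] by (simp add: cong_def algebra_simps)

lemma cong_scale: "x \<approx> y \<Longrightarrow> scale c x \<approx> scale c y"
  using I_relD(6)[of "x - y"] by (simp add: cong_def scale_diff)

lemma cong_left: "x \<approx> y \<Longrightarrow> fmult z x \<approx> fmult z y"
  using I_relD(4)[of "x - y"] by (simp add: cong_def fmult_distrib)

lemma cong_right: "x \<approx> y \<Longrightarrow> fmult x z \<approx> fmult y z"
  using I_relD(5)[of "x - y"] by (simp add: cong_def fmult_distrib)

lemma cong_lin: "(\<And>k. f k \<approx> g k) \<Longrightarrow> lin f x \<approx> lin g x"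
proof -
  assume *: "\<And>k. f k \<approx> g k"
  have "(\<Sum>k\<in>A. scale (Poly_Mapping.lookup x k) (f k)) \<approx> (\<Sum>k\<in>A. scale (Poly_Mapping.lookup x k) (g k))" for A
    by (induction A rule: infinite_finite_induct) (auto intro: cong_add cong_scale *)
  then show ?thesis by (simp add: lin_def)
qed

lemma cong_gens:
  "basis (gK # gE # ys) \<approx> scale (Q 1) (basis (gE # gK # ys))"
  "basis (gK # gF # ys) \<approx> scale (Q (- 1)) (basis (gF # gK # ys))"
  "basis (gK # gKi # ys) \<approx> basis ys"
  "basis (gKi # gK # ys) \<approx> basis ys"
  "basis (gE # gF # ys) \<approx> basis (gF # gE # ys) + (scale cc (basis (gK # ys)) - scale cc (basis (gKi # ys)))"
proof -
  have r: "basis [gK, gE] \<approx> scale (Q 1) (basis [gE, gK])"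
    "basis [gK, gF] \<approx> scale (Q (- 1)) (basis [gF, gK])"
    "basis [gK, gKi] \<approx> basis []" "basis [gKi, gK] \<approx> basis []"
    "basis [gE, gF] \<approx> basis [gF, gE] + (scale cc (basis [gK]) - scale cc (basis [gKi]))"
    by (auto intro!: cong_rel simp: Uq_rels_def Let_def Q_square cc_def scale_diff algebra_simps)
  note m = r[THEN cong_right, of "basis ys"]
  show "basis (gK # gE # ys) \<approx> scale (Q 1) (basis (gE # gK # ys))" using m(1) by (simp add: fmult_distrib)
  show "basis (gK # gF # ys) \<approx> scale (Q (- 1)) (basis (gF # gK # ys))" using m(2) by (simp add: fmult_distrib)
  show "basis (gK # gKi # ys) \<approx> basis ys" using m(3) by (simp add: fmult_distrib)
  show "basis (gKi # gK # ys) \<approx> basis ys" using m(4) by (simp add: fmult_distrib)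
  show "basis (gE # gF # ys) \<approx> basis (gF # gE # ys) + (scale cc (basis (gK # ys)) - scale cc (basis (gKi # ys)))"
    using m(5) by (simp add: fmult_distrib)
qed

lemma cong_Cons:
  assumes "basis xs \<approx> scale c (basis ys)"
  shows "basis (g # xs) \<approx> scale c (basis (g # ys))"
  using cong_left[OF assms, of "basis [g]"] by (simp add: fmult_distrib)

lemma cong_append:
  assumes "basis xs \<approx> scale c (basis ys)"
  shows "basis (w @ xs) \<approx> scale c (basis (w @ ys))"
  using cong_left[OF assms, of "basis w"] by (simp add: fmult_distrib)

lemma cong_scale_trans:
  "x \<approx> scale c y \<Longrightarrow> y \<approx> scale d z \<Longrightarrow> x \<approx> scale (c * d) z"
  using cong_trans[of x "scale c y" "scale c (scale d z)"] cong_scale[of y "scale d z" c] by simp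

text \<open>Insert K K^-1 behind g and move K to the left past g; there it cancels against the
  leading K^-1.\<close>

lemma cong_Ki:
  assumes "\<And>ys. basis (gK # g # ys) \<approx> scale (Q s) (basis (g # gK # ys))"
  shows "basis (gKi # g # ys) \<approx> scale (Q (- s)) (basis (g # gKi # ys))"
proof -
  have 1: "basis (gKi # g # ys) \<approx> scale 1 (basis (gKi # g # gK # gKi # ys))"
    using cong_sym[OF cong_gens(3)[of ys]] by (intro cong_Cons) simp
  have "scale (Q (- s)) (scale (Q s) (basis (g # gK # gKi # ys))) \<approx> scale (Q (- s)) (basis (gK # g # gKi # ys))"
    by (rule cong_scale[OF cong_sym[OF assms]])
  then have 2: "basis (g # gK # gKi # ys) \<approx> scale (Q (- s)) (basis (gK # g # gKi # ys))"
    by (simp add: Q_norm)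
  have 3: "basis (gKi # gK # g # gKi # ys) \<approx> scale 1 (basis (g # gKi # ys))"
    using cong_gens(4)[of "g # gKi # ys"] by simp
  show ?thesis
    using cong_scale_trans[OF cong_scale_trans[OF 1 cong_Cons[OF 2]] 3] by simp
qed

lemma cong_replicate:
  assumes "\<And>ys. basis (h # g # ys) \<approx> scale (Q s) (basis (g # h # ys))"
  shows "basis (h # replicate m g @ ys) \<approx> scale (Q (s * int m)) (basis (replicate m g @ h # ys))"
proof (induction m)
  case (Suc m)
  show ?case
    using cong_scale_trans[OF assms[of "replicate m g @ ys"] cong_Cons[OF Suc, of g]]
    by (simp add: Q_norm algebra_simps)
qed simp

lemmas cong_K_replicate =
  cong_replicate[OF cong_gens(1)] cong_replicate[OF cong_gens(2)]
  cong_replicate[OF cong_Ki[OF cong_gens(1)]] cong_replicate[OF cong_Ki[OF cong_gens(2)]]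

text \<open>Induction on \<open>j\<close> with E F = F E + [E,F] in front: the new terms K F^j and
  K^-1 F^j, once normalised, supply the next summands of \<open>EF_coeff\<close>.\<close>

lemma cong_E_replicate:
  "basis (gE # replicate j gF @ ys) \<approx> basis (replicate j gF @ gE # ys)
     + (scale (EF_coeff (- 1) j) (basis (replicate (j - 1) gF @ gK # ys))
      - scale (EF_coeff 1 j) (basis (replicate (j - 1) gF @ gKi # ys)))"
proof (induction j)
  case (Suc j)
  let ?w = "replicate j gF @ ys"
  have step: "basis (gF # gE # ?w) \<approx> basis (replicate (Suc j) gF @ gE # ys)
     + (scale (EF_coeff (- 1) j) (basis (replicate j gF @ gK # ys))
      - scale (EF_coeff 1 j) (basis (replicate j gF @ gKi # ys)))"
    using cong_left[OF Suc, of "basis [gF]"] by (cases j) (auto simp: fmult_distrib)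
  have k: "basis (gK # ?w) \<approx> scale (Q (- int j)) (basis (replicate j gF @ gK # ys))"
    "basis (gKi # ?w) \<approx> scale (Q (int j)) (basis (replicate j gF @ gKi # ys))"
    using cong_K_replicate(2,4)[of j ys] by simp_all
  have "basis (gE # gF # ?w) \<approx> basis (gF # gE # ?w) + (scale cc (basis (gK # ?w)) - scale cc (basis (gKi # ?w)))"
    by (rule cong_gens)
  also have "\<dots> \<approx> (basis (replicate (Suc j) gF @ gE # ys)
     + (scale (EF_coeff (- 1) j) (basis (replicate j gF @ gK # ys))
      - scale (EF_coeff 1 j) (basis (replicate j gF @ gKi # ys))))
      + (scale cc (scale (Q (- int j)) (basis (replicate j gF @ gK # ys)))
      - scale cc (scale (Q (int j)) (basis (replicate j gF @ gKi # ys))))"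
    by (intro cong_add cong_diff cong_scale step k)
  also have "\<dots> = basis (replicate (Suc j) gF @ gE # ys)
     + (scale (EF_coeff (- 1) (Suc j)) (basis (replicate j gF @ gK # ys))
      - scale (EF_coeff 1 (Suc j)) (basis (replicate j gF @ gKi # ys)))"
    by (simp add: scale_left_add algebra_simps)
  finally show ?case by simp
qed simp

definition K_word :: "int \<Rightarrow> gen list" where
  "K_word n = (if 0 \<le> n then replicate (nat n) gK else replicate (nat (- n)) gKi)"

lemma pbw_word_eq: "pbw_word (j, i, n) = replicate j gF @ replicate i gE @ K_word n"
  by (simp add: pbw_word_def K_word_def)

lemma K_word_simps: "K_word (int m) = replicate m gK" "K_word (- int m) = replicate m gKi"
  by (auto simp: K_word_def)

lemma cong_K_word: "basis (gK # K_word n) \<approx> basis (K_word (n + 1))"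
proof (cases n rule: int_cases)
  case (nonneg m)
  then show ?thesis using K_word_simps(1)[of "Suc m"] by (simp add: K_word_simps add.commute)
next
  case (neg m)
  have "n + 1 = - int m" using neg by simp
  then have "K_word (n + 1) = replicate m gKi" by (simp only: K_word_simps)
  moreover have "K_word n = gKi # replicate m gKi" unfolding neg by (simp only: K_word_simps) simp
  ultimately show ?thesis by (simp add: cong_gens)
qed

lemma cong_Ki_word: "basis (gKi # K_word n) \<approx> basis (K_word (n - 1))"
proof (cases "- n" rule: int_cases)
  case (nonneg m)
  then have "n = - int m" "n - 1 = - int (Suc m)" by simp_all
  then have "K_word n = replicate m gKi" "K_word (n - 1) = gKi # replicate m gKi"
    by (simp_all only: K_word_simps) simp
  then show ?thesis by simp
next
  case (neg m)
  then have "n = int (Suc m)" "n - 1 = int m" by simp_all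
  then have "K_word n = gK # replicate m gK" "K_word (n - 1) = replicate m gK"
    by (simp_all only: K_word_simps) simp
  then show ?thesis by (simp add: cong_gens)
qed

definition rep :: "pbwV \<Rightarrow> (gen list \<Rightarrow>\<^sub>0 complex)" where
  "rep x = lin (\<lambda>b. basis (pbw_word b)) x"

lemma rep_simps [simp]:
  "rep (basis b) = basis (pbw_word b)" "rep (x + y) = rep x + rep y" "rep (x - y) = rep x - rep y"
  "rep (scale c x) = scale c (rep x)" "rep 0 = 0"
  by (simp_all add: rep_def)

text \<open>The explicit action agrees with multiplication in the quotient. Normal forms are thus
  stable under left multiplication by generators, which is the spanning half of PBW.\<close>

lemma cong_act_basis: "basis (g # pbw_word b) \<approx> rep (act_basis g b)"
proof -
  obtain j i n where b: "b = (j, i, n)" by (cases b)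
  let ?w = "\<lambda>m. replicate i gE @ K_word m"
  have K: "basis (gK # ?w n) \<approx> scale (Q (int i)) (basis (?w (n + 1)))"
    using cong_scale_trans[OF cong_K_replicate(1)[of i "K_word n"] cong_append[of _ 1]]
      cong_K_word[of n] by simp
  have Ki: "basis (gKi # ?w n) \<approx> scale (Q (- int i)) (basis (?w (n - 1)))"
    using cong_scale_trans[OF cong_K_replicate(3)[of i "K_word n"] cong_append[of _ 1]]
      cong_Ki_word[of n] by simp
  show ?thesis
  proof (cases g)
    case gF
    then show ?thesis by (simp add: b pbw_word_eq)
  next
    case gK
    show ?thesis
      using cong_scale_trans[OF cong_K_replicate(2)[of j "?w n"] cong_append[OF K]]
      by (simp add: b pbw_word_eq gK Q_norm)
  next
    case gKi
    show ?thesis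
      using cong_scale_trans[OF cong_K_replicate(4)[of j "?w n"] cong_append[OF Ki]]
      by (simp add: b pbw_word_eq gKi Q_norm)
  next
    case gE
    have "basis (gE # replicate j gF @ ?w n) \<approx> basis (replicate j gF @ gE # ?w n)
     + (scale (EF_coeff (- 1) j) (basis (replicate (j - 1) gF @ gK # ?w n))
      - scale (EF_coeff 1 j) (basis (replicate (j - 1) gF @ gKi # ?w n)))"
      by (rule cong_E_replicate)
    also have "\<dots> \<approx> basis (replicate j gF @ gE # ?w n)
     + (scale (EF_coeff (- 1) j) (scale (Q (int i)) (basis (replicate (j - 1) gF @ ?w (n + 1))))
      - scale (EF_coeff 1 j) (scale (Q (- int i)) (basis (replicate (j - 1) gF @ ?w (n - 1)))))"
      by (intro cong_add cong_diff cong_scale cong_append K Ki cong_refl)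
    finally show ?thesis by (simp add: b pbw_word_eq gE algebra_simps)
  qed
qed

lemma cong_fmult_rep: "fmult (basis [g]) (rep x) \<approx> rep (act g x)"
proof -
  have "fmult (basis [g]) (rep x) = lin (\<lambda>b. basis (g # pbw_word b)) x"
    by (simp add: rep_def bilin_ext_lin lin_lin)
  also have "\<dots> \<approx> lin (\<lambda>b. rep (act_basis g b)) x"
    by (rule cong_lin) (rule cong_act_basis)
  also have "\<dots> = rep (act g x)"
    by (simp add: rep_def lin_lin)
  finally show ?thesis .
qed

text \<open>The normal form of a combination of words, obtained by letting it act on the cyclic
  vector 1; \<open>rep\<close> is a section.\<close>

definition Psi :: "(gen list \<Rightarrow>\<^sub>0 complex) \<Rightarrow> pbwV" where
  "Psi p = regular.wact p one_H"

lemma Psi_simps [simp]: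
  "Psi (basis w) = foldr act w one_H" "Psi (x + y) = Psi x + Psi y" "Psi (x - y) = Psi x - Psi y"
  "Psi (scale c x) = scale c (Psi x)" "Psi 0 = 0" "Psi (- x) = - Psi x"
  by (simp_all add: Psi_def)

lemma lmap_Psi: "lmap Psi"
  by (simp add: lmap_def)

lemma cong_rep_Psi: "p \<approx> rep (Psi p)"
proof -
  have "basis w \<approx> rep (Psi (basis w))" for w
  proof (induction w)
    case Nil
    show ?case by (simp add: pbw_word_def)
  next
    case (Cons g w)
    have "basis (g # w) \<approx> fmult (basis [g]) (rep (Psi (basis w)))"
      using cong_left[OF Cons, of "basis [g]"] by simp
    also have "\<dots> \<approx> rep (act g (Psi (basis w)))" by (rule cong_fmult_rep)
    finally show ?case by simp
  qed
  then have "lin basis p \<approx> lin (\<lambda>w. rep (Psi (basis w))) p" by (rule cong_lin)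
  also have "\<dots> = rep (Psi p)"
    by (rule lmap_eqI[of _ _ p]) (auto simp: rep_def[abs_def] intro!: lmap_intros lmap_Psi)
  finally show ?thesis by simp
qed

lemma Psi_pbw_word: "foldr act (pbw_word b) one_H = basis b"
proof -
  obtain j i n where b: "b = (j, i, n)" by (cases b)
  have K: "foldr act (replicate m gK) one_H = basis (0, 0, int m)" for m
    by (induction m) (auto simp: algebra_simps)
  have Ki: "foldr act (replicate m gKi) one_H = basis (0, 0, - int m)" for m
    by (induction m) (auto intro!: arg_cong[where f = "\<lambda>n. basis (0, 0, n)"])
  have "foldr act (K_word n) one_H = basis (0, 0, n)"
    using K[of "nat n"] Ki[of "nat (- n)"] by (auto simp: K_word_def)
  moreover have "foldr act (replicate m gE) (basis (0, i, n)) = basis (0, m + i, n)" for m i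
    by (induction m) auto
  moreover have "foldr act (replicate m gF) (basis (j, i, n)) = basis (m + j, i, n)" for m j i
    by (induction m) auto
  ultimately show ?thesis by (simp add: b pbw_word_eq)
qed

lemma Psi_rep [simp]: "Psi (rep x) = x"
proof -
  have "Psi (rep x) = lin basis x"
    unfolding rep_def by (simp add: lmap_lin_comp[OF lmap_Psi] Psi_pbw_word)
  then show ?thesis by simp
qed

text \<open>The PBW theorem. The ideal kills 1 in the regular representation; conversely
  \<open>p\<close> is congruent to \<open>rep (Psi p)\<close>.\<close>

lemma I_rel_eq: "I_rel = {p. Psi p = 0}"
proof
  show "I_rel \<subseteq> {p. Psi p = 0}"
    using regular.Idl_annihilates[of _ one_H] by (auto simp: I_rel_def Psi_def supp_in_def)
  show "{p. Psi p = 0} \<subseteq> I_rel"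
  proof
    fix p assume "p \<in> {p. Psi p = 0}"
    then show "p \<in> I_rel" using cong_rep_Psi[of p] by (simp add: cong_def)
  qed
qed

end

section \<open>Multiplication and tensor powers in coordinates\<close>

context quantum
begin

text \<open>Every element is a combination of words applied to 1. An identity linear in
  \<open>x\<close> therefore needs only the unit and compatibility with left multiplication by a
  generator.\<close>

lemma H_induct [case_names one add scale act]:
  assumes "P one_H" "\<And>x y. P x \<Longrightarrow> P y \<Longrightarrow> P (x + y)" "\<And>c x. P x \<Longrightarrow> P (scale c x)"
    and "\<And>g x. P x \<Longrightarrow> P (act g x)"
  shows "P x"
proof -
  have w: "P (foldr act w one_H)" for w
    using assms by (induction w) auto
  have "P 0" using assms(3)[of one_H 0] assms(1) by simp
  then have "P (\<Sum>b\<in>A. scale (Poly_Mapping.lookup x b) (foldr act (pbw_word b) one_H))" for A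
    by (induction A rule: infinite_finite_induct) (auto intro: assms w)
  from this[of "Poly_Mapping.keys x"] have "P (lin (\<lambda>b. foldr act (pbw_word b) one_H) x)"
    by (simp add: lin_def)
  then show ?thesis by (simp add: Psi_pbw_word)
qed

end

context uq_module
begin

lemma wact_cong:
  assumes "x \<approx> y" "v \<in> supp_in A"
  shows "wact x v = wact y v"
  using Idl_annihilates[of "x - y" v] assms by (simp add: cong_def I_rel_def)

definition hact :: "pbwV \<Rightarrow> ('l \<Rightarrow>\<^sub>0 complex) \<Rightarrow> ('l \<Rightarrow>\<^sub>0 complex)" where
  "hact x v = wact (rep x) v"

lemma wact_eq_hact: "v \<in> supp_in A \<Longrightarrow> wact p v = hact (Psi p) v"
  unfolding hact_def by (rule wact_cong[OF cong_rep_Psi])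

lemma hact_simps [simp]:
  "hact (x + y) v = hact x v + hact y v" "hact (scale c x) v = scale c (hact x v)"
  "hact one_H v = v"
  by (simp_all add: hact_def pbw_word_def)

lemma hact_lmap: "lmap (hact x)"
  unfolding hact_def[abs_def] by (rule wact_lmap)

lemma hact_lmap_left: "lmap (\<lambda>x. hact x v)"
  by (simp add: lmap_def)

lemma hact_closed: "v \<in> supp_in A \<Longrightarrow> hact x v \<in> supp_in A"
  unfolding hact_def by (rule wact_closed)

lemma hact_act: "v \<in> supp_in A \<Longrightarrow> hact (act g x) v = G g (hact x v)"
proof -
  assume v: "v \<in> supp_in A"
  have "hact (act g x) v = wact (fmult (basis [g]) (rep x)) v"
    unfolding hact_def by (rule wact_cong[OF cong_sym[OF cong_fmult_rep] v])
  also have "\<dots> = G g (hact x v)"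
    by (simp add: wact_fmult hact_def)
  finally show ?thesis .
qed

end

context quantum
begin

text \<open>The product in PBW coordinates. Taking the regular action as definition makes left
  multiplication by a generator equal to \<open>act\<close>, and associativity follows by
  \<open>H_induct\<close>.\<close>

definition star :: "pbwV \<Rightarrow> pbwV \<Rightarrow> pbwV" (infixl "\<star>" 72) where
  "x \<star> y = regular.hact x y"

lemma lmap_star: "lmap (\<lambda>x. x \<star> y)" "lmap (\<lambda>y. x \<star> y)"
  unfolding star_def by (rule regular.hact_lmap_left regular.hact_lmap)+

lemma lmap_starI [lmap_intros]:
  "lmap F \<Longrightarrow> lmap (\<lambda>x. F x \<star> y)" "lmap F \<Longrightarrow> lmap (\<lambda>x. y \<star> F x)"
  using lmap_comp[OF lmap_star(1)] lmap_comp[OF lmap_star(2)] by auto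

lemmas star_simps [simp] = lmap_simps[OF lmap_star(1)] lmap_simps[OF lmap_star(2)]

lemma star_act: "act g x \<star> y = act g (x \<star> y)"
  unfolding star_def by (rule regular.hact_act) (simp add: supp_in_def)

lemma star_one [simp]: "one_H \<star> x = x" "x \<star> one_H = x"
proof -
  show "one_H \<star> x = x" by (simp add: star_def)
  have "x \<star> one_H = Psi (rep x)"
    unfolding star_def regular.hact_def by (simp only: Psi_def)
  then show "x \<star> one_H = x" by simp
qed

lemma star_assoc: "x \<star> y \<star> z = x \<star> (y \<star> z)"
  by (induction x rule: H_induct) (simp_all add: star_act)

lemma Psi_fmult: "Psi (fmult x y) = Psi x \<star> Psi y"
proof -
  have "Psi (fmult x y) = regular.wact x (Psi y)"
    by (simp add: Psi_def regular.wact_fmult)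
  also have "\<dots> = Psi x \<star> Psi y"
    unfolding star_def by (rule regular.wact_eq_hact) (simp add: supp_in_def)
  finally show ?thesis .
qed

fun hg :: "gen \<Rightarrow> pbwV" where
  "hg gE = basis (0, 1, 0)"
| "hg gF = basis (1, 0, 0)"
| "hg gK = basis (0, 0, 1)"
| "hg gKi = basis (0, 0, - 1)"

lemma act_one: "act_basis g (0, 0, 0) = hg g"
  by (cases g) auto

lemma hg_star: "hg g \<star> x = act g x"
  using star_act[of g one_H x] by (simp add: act_one)

abbreviation "hE \<equiv> hg gE"
abbreviation "hF \<equiv> hg gF"
abbreviation "hK \<equiv> hg gK"
abbreviation "hKi \<equiv> hg gKi"

end

context uq_module
begin

end

section \<open>Tensors in coordinates\<close>

definition tcons :: "('a \<Rightarrow>\<^sub>0 complex) \<Rightarrow> ('a list \<Rightarrow>\<^sub>0 complex) \<Rightarrow> ('a list \<Rightarrow>\<^sub>0 complex)" (infixr "\<triangleright>" 68) where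
  "x \<triangleright> u = lin (\<lambda>b. lin (\<lambda>bs. basis (b # bs)) u) x"

definition tsnoc :: "('a list \<Rightarrow>\<^sub>0 complex) \<Rightarrow> ('a \<Rightarrow>\<^sub>0 complex) \<Rightarrow> ('a list \<Rightarrow>\<^sub>0 complex)" (infixl "\<triangleleft>" 68) where
  "u \<triangleleft> x = lin (\<lambda>bs. lin (\<lambda>b. basis (bs @ [b])) x) u"

definition tconc :: "('a list \<Rightarrow>\<^sub>0 complex) \<Rightarrow> ('a list \<Rightarrow>\<^sub>0 complex) \<Rightarrow> ('a list \<Rightarrow>\<^sub>0 complex)" (infixr "\<bowtie>" 69) where
  "u \<bowtie> v = lin (\<lambda>bs. lin (\<lambda>cs. basis (bs @ cs)) v) u"

lemma lmap_tcons: "lmap (\<lambda>x. x \<triangleright> u)" "lmap (\<lambda>u. x \<triangleright> u)"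
  unfolding tcons_def by (rule lmap_lin lmap_lin_fun)+

lemma lmap_tsnoc: "lmap (\<lambda>u. u \<triangleleft> x)" "lmap (\<lambda>x. u \<triangleleft> x)"
  unfolding tsnoc_def by (rule lmap_lin lmap_lin_fun)+

lemma lmap_tconc: "lmap (\<lambda>u. u \<bowtie> v)" "lmap (\<lambda>v. u \<bowtie> v)"
  unfolding tconc_def by (rule lmap_lin lmap_lin_fun)+

lemma lmap_tensorI [lmap_intros]:
  "lmap F \<Longrightarrow> lmap (\<lambda>x. F x \<triangleright> u)" "lmap G \<Longrightarrow> lmap (\<lambda>x. a \<triangleright> G x)"
  "lmap G \<Longrightarrow> lmap (\<lambda>x. G x \<triangleleft> a)" "lmap F \<Longrightarrow> lmap (\<lambda>x. u \<triangleleft> F x)"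
  "lmap G \<Longrightarrow> lmap (\<lambda>x. G x \<bowtie> v)" "lmap G \<Longrightarrow> lmap (\<lambda>x. v \<bowtie> G x)"
  using lmap_comp[OF lmap_tcons(1)] lmap_comp[OF lmap_tcons(2)]
    lmap_comp[OF lmap_tsnoc(1)] lmap_comp[OF lmap_tsnoc(2)]
    lmap_comp[OF lmap_tconc(1)] lmap_comp[OF lmap_tconc(2)] by auto

lemmas tensor_simps [simp] =
  lmap_simps[OF lmap_tcons(1)] lmap_simps[OF lmap_tcons(2)]
  lmap_simps[OF lmap_tsnoc(1)] lmap_simps[OF lmap_tsnoc(2)]
  lmap_simps[OF lmap_tconc(1)] lmap_simps[OF lmap_tconc(2)]

lemma tensor_basis:
  "basis b \<triangleright> basis bs = basis (b # bs)" "basis bs \<triangleleft> basis b = basis (bs @ [b])"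
  "basis bs \<bowtie> basis cs = basis (bs @ cs)"
  by (simp_all add: tcons_def tsnoc_def tconc_def)

lemma tconc_Nil [simp]: "basis [] \<bowtie> u = u" "u \<bowtie> basis [] = u"
  by (simp_all add: tconc_def)

lemma tconc_assoc: "(u \<bowtie> v) \<bowtie> w = u \<bowtie> v \<bowtie> w"
  by (simp add: tconc_def lin_lin)

lemma tcons_tconc: "(x \<triangleright> u) \<bowtie> v = x \<triangleright> u \<bowtie> v"
  by (simp add: tconc_def tcons_def lin_lin)

lemma tcons_tsnoc: "(x \<triangleright> u) \<triangleleft> y = x \<triangleright> (u \<triangleleft> y)"
  by (simp add: tsnoc_def tcons_def lin_lin)

lemma tconc_tsnoc: "(u \<bowtie> v) \<triangleleft> y = u \<bowtie> (v \<triangleleft> y)"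
  by (simp add: tsnoc_def tconc_def lin_lin)

text \<open>All tensor powers share one type and the degree is a support condition. Operators can
  thus be defined on lists of every length at once, without a degree parameter.\<close>

abbreviation V :: "nat \<Rightarrow> ('a list \<Rightarrow>\<^sub>0 complex) set" where
  "V n \<equiv> supp_in {bs. length bs = n}"

lemma tensor_closed [simp]:
  "u \<in> V n \<Longrightarrow> x \<triangleright> u \<in> V (Suc n)" "u \<in> V n \<Longrightarrow> u \<triangleleft> x \<in> V (Suc n)"
  "u \<in> V m \<Longrightarrow> v \<in> V n \<Longrightarrow> u \<bowtie> v \<in> V (m + n)"
proof -
  show "u \<in> V n \<Longrightarrow> x \<triangleright> u \<in> V (Suc n)"
    unfolding tcons_def by (rule supp_in_lin[of _ UNIV], simp add: supp_in_def, rule supp_in_lin) auto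
  show "u \<in> V n \<Longrightarrow> u \<triangleleft> x \<in> V (Suc n)"
    unfolding tsnoc_def by (rule supp_in_lin, assumption, rule supp_in_lin[of _ UNIV]) (auto simp: supp_in_def[of UNIV])
  show "u \<in> V m \<Longrightarrow> v \<in> V n \<Longrightarrow> u \<bowtie> v \<in> V (m + n)"
    unfolding tconc_def by (rule supp_in_lin, assumption, rule supp_in_lin) auto
qed

lemma V_Suc_eqI:
  assumes "u \<in> V (Suc n)" "lmap F" "lmap G"
    and "\<And>a v. v \<in> V n \<Longrightarrow> F (a \<triangleright> v) = G (a \<triangleright> v)"
  shows "F u = G u"
proof (rule supp_in_eqI[OF assms(1-3)])
  fix bs :: "'a list" assume "bs \<in> {bs. length bs = Suc n}"
  then obtain c cs where "bs = c # cs" "length cs = n"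
    by (auto simp: length_Suc_conv)
  then show "F (basis bs) = G (basis bs)"
    using assms(4)[of "basis cs" "basis c"] by (simp add: tensor_basis)
qed

lemma V_0_eqI:
  assumes "u \<in> V 0" "lmap F" "lmap G" "F (basis []) = G (basis [])"
  shows "F u = G u"
  using assms by (intro supp_in_eqI[OF assms(1-3)]) auto

primrec tpow :: "('a \<Rightarrow>\<^sub>0 complex) \<Rightarrow> nat \<Rightarrow> ('a list \<Rightarrow>\<^sub>0 complex)" where
  "tpow x 0 = basis []"
| "tpow x (Suc n) = x \<triangleright> tpow x n"

lemma tpow_closed [simp]: "tpow x n \<in> V n"
  by (induction n) auto

lemma tsnoc_Nil: "basis [] \<triangleleft> x = x \<triangleright> basis []"
  by (simp add: tsnoc_def tcons_def)

lemma tpow_snoc: "tpow x (Suc n) = tpow x n \<triangleleft> x"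
proof (induction n)
  case (Suc n)
  then show ?case by (metis tcons_tsnoc tpow.simps(2))
qed (simp add: tsnoc_Nil)

context quantum
begin

text \<open>Lists of different lengths multiply to 0, so a product has degree \<open>n\<close> as
  soon as one factor has.\<close>

fun mulL :: "pbw list \<Rightarrow> pbw list \<Rightarrow> pbwT" where
  "mulL [] [] = basis []"
| "mulL (x # xs) (y # ys) = (basis x \<star> basis y) \<triangleright> mulL xs ys"
| "mulL _ _ = 0"

definition tmul :: "pbwT \<Rightarrow> pbwT \<Rightarrow> pbwT" (infixl "\<bullet>" 70) where
  "u \<bullet> v = lin (\<lambda>xs. lin (\<lambda>ys. mulL xs ys) v) u"

lemma lmap_tmul: "lmap (\<lambda>u. u \<bullet> v)" "lmap (\<lambda>v. u \<bullet> v)"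
  unfolding tmul_def by (rule lmap_lin lmap_lin_fun)+

lemma lmap_tmulI [lmap_intros]:
  "lmap F \<Longrightarrow> lmap (\<lambda>x. F x \<bullet> u)" "lmap G \<Longrightarrow> lmap (\<lambda>x. u \<bullet> G x)"
  using lmap_comp[OF lmap_tmul(1)] lmap_comp[OF lmap_tmul(2)] by auto

lemmas tmul_simps [simp] = lmap_simps[OF lmap_tmul(1)] lmap_simps[OF lmap_tmul(2)]

lemma tmul_basis: "basis xs \<bullet> basis ys = mulL xs ys"
  by (simp add: tmul_def)

lemma tmul_tcons: "(a \<triangleright> u) \<bullet> (b \<triangleright> v) = (a \<star> b) \<triangleright> (u \<bullet> v)"
proof -
  have 1: "(basis x \<triangleright> basis xs) \<bullet> (basis y \<triangleright> basis ys) = (basis x \<star> basis y) \<triangleright> (basis xs \<bullet> basis ys)" for x xs y ys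
    by (simp add: tensor_basis tmul_basis)
  have 2: "(basis x \<triangleright> basis xs) \<bullet> (basis y \<triangleright> v) = (basis x \<star> basis y) \<triangleright> (basis xs \<bullet> v)" for x xs y
    by (rule lmap_eqI[of _ _ v]) (auto simp: 1 intro!: lmap_intros)
  have 3: "(basis x \<triangleright> basis xs) \<bullet> (b \<triangleright> v) = (basis x \<star> b) \<triangleright> (basis xs \<bullet> v)" for x xs
    by (rule lmap_eqI[of _ _ b]) (auto simp: 2 intro!: lmap_intros)
  have 4: "(basis x \<triangleright> u) \<bullet> (b \<triangleright> v) = (basis x \<star> b) \<triangleright> (u \<bullet> v)" for x
    by (rule lmap_eqI[of _ _ u]) (auto simp: 3 intro!: lmap_intros)
  show ?thesis
    by (rule lmap_eqI[of _ _ a]) (auto simp: 4 intro!: lmap_intros)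
qed

lemma tmul_Nil [simp]: "basis [] \<bullet> basis [] = basis []"
  by (simp add: tmul_basis)

lemma tmul_Cons_Nil [simp]: "(a \<triangleright> u) \<bullet> basis [] = 0" "basis [] \<bullet> (a \<triangleright> u) = 0"
  by (simp_all add: tmul_def tcons_def lin_lin)

lemma tmul_assoc: "u \<bullet> v \<bullet> w = u \<bullet> (v \<bullet> w)"
proof -
  have 1: "basis xs \<bullet> basis ys \<bullet> basis zs = basis xs \<bullet> (basis ys \<bullet> basis zs)" for xs ys zs
  proof (induction xs arbitrary: ys zs)
    case Nil
    show ?case
    proof (cases ys)
      case Nil then show ?thesis by (cases zs) (auto simp: tensor_basis[symmetric])
    next
      case (Cons y ys') then show ?thesis
        by (cases zs) (auto simp: tensor_basis[symmetric] tmul_tcons)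
    qed
  next
    case (Cons x xs)
    show ?case
    proof (cases ys)
      case Nil then show ?thesis by (cases zs) (auto simp: tensor_basis[symmetric] tmul_tcons)
    next
      case (Cons y ys') then show ?thesis
        by (cases zs) (auto simp: tensor_basis[symmetric] tmul_tcons star_assoc Cons.IH)
    qed
  qed
  have 2: "basis xs \<bullet> basis ys \<bullet> w = basis xs \<bullet> (basis ys \<bullet> w)" for xs ys
    by (rule lmap_eqI[of _ _ w]) (auto simp: 1 intro!: lmap_intros)
  have 3: "basis xs \<bullet> v \<bullet> w = basis xs \<bullet> (v \<bullet> w)" for xs
    by (rule lmap_eqI[of _ _ v]) (auto simp: 2 intro!: lmap_intros)
  show ?thesis
    by (rule lmap_eqI[of _ _ u]) (auto simp: 3 intro!: lmap_intros)
qed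

lemma tmul_closed [simp]: "u \<in> V n \<Longrightarrow> u \<bullet> v \<in> V n" "v \<in> V n \<Longrightarrow> u \<bullet> v \<in> V n"
proof -
  have "mulL xs ys \<in> V (length xs)" "mulL xs ys \<in> V (length ys)" for xs ys
    by (induction xs ys rule: mulL.induct) auto
  then have *: "length xs = n \<Longrightarrow> mulL xs ys \<in> V n" "length ys = n \<Longrightarrow> mulL xs ys \<in> V n" for xs ys
    by blast+
  show "u \<in> V n \<Longrightarrow> u \<bullet> v \<in> V n"
    unfolding tmul_def by (rule supp_in_lin, assumption, rule supp_in_lin[of _ UNIV])
      (auto simp: supp_in_def[of UNIV] *)
  show "v \<in> V n \<Longrightarrow> u \<bullet> v \<in> V n"
    unfolding tmul_def by (rule supp_in_lin[of u UNIV], simp add: supp_in_def, rule supp_in_lin, assumption)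
      (auto simp: *)
qed

abbreviation one_T :: "nat \<Rightarrow> pbwT" where "one_T n \<equiv> tpow one_H n"

lemma tmul_one [simp]: "u \<in> V n \<Longrightarrow> one_T n \<bullet> u = u" "u \<in> V n \<Longrightarrow> u \<bullet> one_T n = u"
proof -
  have "u \<in> V n \<Longrightarrow> one_T n \<bullet> u = u \<and> u \<bullet> one_T n = u"
  proof (induction n arbitrary: u)
    case 0
    have "basis [] \<bullet> u = u" "u \<bullet> basis [] = u"
      by (rule V_0_eqI[OF 0]; auto intro!: lmap_intros)+
    then show ?case by simp
  next
    case (Suc n)
    have "one_T (Suc n) \<bullet> u = u" "u \<bullet> one_T (Suc n) = u"
      by (rule V_Suc_eqI[OF Suc.prems]; use Suc.IH in \<open>auto intro!: lmap_intros simp: tmul_tcons\<close>)+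
    then show ?case by simp
  qed
  then show "u \<in> V n \<Longrightarrow> one_T n \<bullet> u = u" "u \<in> V n \<Longrightarrow> u \<bullet> one_T n = u" by auto
qed

lemma tmul_conc:
  assumes "u \<in> V m" "u' \<in> V m"
  shows "(u \<bowtie> v) \<bullet> (u' \<bowtie> v') = (u \<bullet> u') \<bowtie> (v \<bullet> v')"
  using assms
proof (induction m arbitrary: u u')
  case 0
  have "(basis [] \<bowtie> v) \<bullet> (u' \<bowtie> v') = (basis [] \<bullet> u') \<bowtie> (v \<bullet> v')"
    by (rule V_0_eqI[OF 0(2)]) (auto intro!: lmap_intros)
  then show ?case
    by (rule V_0_eqI[OF 0(1), rotated 2]) (auto intro!: lmap_intros)
next
  case (Suc m)
  have "((a \<triangleright> w) \<bowtie> v) \<bullet> (u' \<bowtie> v') = ((a \<triangleright> w) \<bullet> u') \<bowtie> (v \<bullet> v')" if "w \<in> V m" for a w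
    by (rule V_Suc_eqI[OF Suc.prems(2)]; use Suc.IH[OF that] in \<open>auto intro!: lmap_intros simp: tmul_tcons tcons_tconc\<close>)
  then show ?case
    by (rule V_Suc_eqI[OF Suc.prems(1), rotated 2]) (auto intro!: lmap_intros)
qed

lemma tsnoc_conc: "u \<triangleleft> a = u \<bowtie> (a \<triangleright> basis [])"
  by (simp add: tsnoc_def tconc_def tcons_def lin_lin)

lemma tmul_tsnoc:
  assumes "u \<in> V m" "u' \<in> V m"
  shows "(u \<triangleleft> a) \<bullet> (u' \<triangleleft> b) = (u \<bullet> u') \<triangleleft> (a \<star> b)"
  by (simp add: tsnoc_conc tmul_conc[OF assms] tmul_tcons)

end

section \<open>The Hopf algebra structure and the cyclic operator\<close>

lemma V_2_eqI:
  assumes "u \<in> V 2" "lmap F" "lmap G" "\<And>a b. F (a \<triangleright> b \<triangleright> basis []) = G (a \<triangleright> b \<triangleright> basis [])"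
  shows "F u = G u"
proof (rule supp_in_eqI[OF assms(1-3)])
  fix bs :: "'a list" assume "bs \<in> {bs. length bs = 2}"
  then obtain x y where "bs = [x, y]" by (auto simp: numeral_2_eq_2 length_Suc_conv)
  then show "F (basis bs) = G (basis bs)"
    using assms(4)[of "basis x" "basis y"] by (simp add: tensor_basis)
qed

context quantum
begin

declare hg.simps [simp del]

section \<open>Iterated coproducts, counit and antipode\<close>

lemma hg_rels:
  "hK \<star> hE = scale (Q 1) (hE \<star> hK)" "hK \<star> hF = scale (Q (- 1)) (hF \<star> hK)"
  "hKi \<star> hE = scale (Q (- 1)) (hE \<star> hKi)" "hKi \<star> hF = scale (Q 1) (hF \<star> hKi)"
  "hK \<star> hKi = one_H" "hKi \<star> hK = one_H"
  "hE \<star> hF = hF \<star> hE + scale cc (hK - hKi)"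
  by (simp_all only: hg_star) (simp_all add: hg.simps Q_norm scale_diff)

text \<open>In closed form, E goes to the sum of the tensors 1,...,1,E,K,...,K and F to that of
  K^-1,...,K^-1,F,1,...,1. For \<open>n = 0\<close> the values are those of the counit.\<close>

fun Dg :: "nat \<Rightarrow> gen \<Rightarrow> pbwT" where
  "Dg n gK = tpow hK n"
| "Dg n gKi = tpow hKi n"
| "Dg 0 gE = 0"
| "Dg (Suc n) gE = one_H \<triangleright> Dg n gE + hE \<triangleright> tpow hK n"
| "Dg 0 gF = 0"
| "Dg (Suc n) gF = hKi \<triangleright> Dg n gF + hF \<triangleright> one_T n"

lemma Dg_closed [simp]: "Dg n g \<in> V n"
  by (induction n g rule: Dg.induct) auto

lemma tmul_tpow: "tpow x n \<bullet> tpow y n = tpow (x \<star> y) n"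
  by (induction n) (auto simp: tmul_tcons)

lemma Dg_KE: "Dg n gK \<bullet> Dg n gE = scale (Q 1) (Dg n gE \<bullet> Dg n gK)"
  by (induction n) (auto simp: tmul_tcons hg_rels scale_add)

lemma Dg_KF: "Dg n gK \<bullet> Dg n gF = scale (Q (- 1)) (Dg n gF \<bullet> Dg n gK)"
  by (induction n) (auto simp: tmul_tcons hg_rels scale_add)

lemma Dg_KKi: "Dg n gK \<bullet> Dg n gKi = one_T n" "Dg n gKi \<bullet> Dg n gK = one_T n"
  by (simp_all add: tmul_tpow hg_rels)

text \<open>The delicate mixed terms are E K^-1 (x) K F and K^-1 E (x) F K. Moving K past F and K^-1
  past E costs the same factor q^(-2), so they cancel.\<close>

lemma Dg_EF: "Dg n gE \<bullet> Dg n gF - Dg n gF \<bullet> Dg n gE = scale cc (Dg n gK - Dg n gKi)"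
proof (induction n)
  case (Suc n)
  have KF: "tpow hK n \<bullet> Dg n gF = scale (Q (- 1)) (Dg n gF \<bullet> tpow hK n)"
    using Dg_KF[of n] by simp
  have EF: "Dg n gE \<bullet> Dg n gF = Dg n gF \<bullet> Dg n gE + scale cc (tpow hK n - tpow hKi n)"
    using Suc by (simp add: algebra_simps)
  show ?case
    by (simp add: tmul_tcons KF hg_rels EF scale_add scale_diff algebra_simps)
qed simp

lemma uq_module_D: "uq_module q (\<lambda>g v. Dg n g \<bullet> v) {bs. length bs = n}"
proof
  fix v assume v: "v \<in> supp_in {bs :: pbw list. length bs = n}"
  show "Dg n gK \<bullet> (Dg n gE \<bullet> v) = scale (q\<^sup>2) (Dg n gE \<bullet> (Dg n gK \<bullet> v))"
    by (simp add: tmul_assoc[symmetric] Dg_KE Q_square del: Dg.simps)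
  show "Dg n gK \<bullet> (Dg n gF \<bullet> v) = scale (inverse (q\<^sup>2)) (Dg n gF \<bullet> (Dg n gK \<bullet> v))"
    by (simp add: tmul_assoc[symmetric] Dg_KF Q_square(2) del: Dg.simps)
  show "Dg n gK \<bullet> (Dg n gKi \<bullet> v) = v" "Dg n gKi \<bullet> (Dg n gK \<bullet> v) = v"
    using v by (simp_all add: tmul_assoc[symmetric] Dg_KKi del: Dg.simps)
  show "Dg n gE \<bullet> (Dg n gF \<bullet> v) - Dg n gF \<bullet> (Dg n gE \<bullet> v) = scale cc (Dg n gK \<bullet> v - Dg n gKi \<bullet> v)"
    using arg_cong[OF Dg_EF[of n], of "\<lambda>u. u \<bullet> v"] by (simp add: tmul_assoc[symmetric] del: Dg.simps)
qed (auto intro: lmap_intros)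

text \<open>The iterated coproducts, including the counit \<open>D 0\<close> and the identity \<open>D 1\<close>.\<close>

definition D :: "nat \<Rightarrow> pbwV \<Rightarrow> pbwT" where
  "D n x = uq_module.hact (\<lambda>g v. Dg n g \<bullet> v) x (one_T n)"

lemma lmap_D: "lmap (D n)"
  unfolding D_def[abs_def] by (rule uq_module.hact_lmap_left[OF uq_module_D])

lemmas D_simps [simp] = lmap_simps[OF lmap_D]
lemmas lmap_DI [lmap_intros] = lmap_comp[OF lmap_D]

lemma D_one [simp]: "D n one_H = one_T n"
  unfolding D_def by (rule uq_module.hact_simps[OF uq_module_D])

lemma D_closed [simp]: "D n x \<in> V n"
  unfolding D_def by (rule uq_module.hact_closed[OF uq_module_D]) simp

lemma D_act: "D n (act g x) = Dg n g \<bullet> D n x"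
  unfolding D_def by (rule uq_module.hact_act[OF uq_module_D]) simp

lemma D_hg [simp]: "D n (hg g) = Dg n g"
  using D_act[of n g one_H] by (simp add: act_one)

lemma D_star: "D n (x \<star> y) = D n x \<bullet> D n y"
  by (induction x rule: H_induct) (simp_all add: star_act D_act tmul_assoc)

text \<open>The shape is dictated by \<open>Uq_hom\<close>, which evaluates words by
  \<open>foldr\<close>; this identifies the coproduct of the statement with
  \<open>D 2\<close>.\<close>

lemma D_Psi: "lin (\<lambda>w. foldr (\<lambda>g v. Dg n g \<bullet> v) w (one_T n)) p = D n (Psi p)"
  using uq_module.wact_eq_hact[OF uq_module_D, of "one_T n" n p]
  by (simp add: D_def uq_module.wact_def[OF uq_module_D])

lemma D_Suc_0: "D (Suc 0) x = x \<triangleright> basis []"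
proof (induction x rule: H_induct)
  case (act g x)
  have "Dg (Suc 0) g = hg g \<triangleright> basis []" by (cases g) auto
  then show ?case by (simp add: D_act act tmul_tcons hg_star)
qed (simp_all)

lemma D_2: "D 2 hE = one_H \<triangleright> hE \<triangleright> basis [] + hE \<triangleright> hK \<triangleright> basis []"
  "D 2 hF = hKi \<triangleright> hF \<triangleright> basis [] + hF \<triangleright> one_H \<triangleright> basis []"
  "D 2 hK = hK \<triangleright> hK \<triangleright> basis []" "D 2 hKi = hKi \<triangleright> hKi \<triangleright> basis []"
  "D 2 one_H = one_H \<triangleright> one_H \<triangleright> basis []"
  by (simp_all add: numeral_2_eq_2)

lemma Dg_2: "Dg 2 gE = one_H \<triangleright> hE \<triangleright> basis [] + hE \<triangleright> hK \<triangleright> basis []"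
  "Dg 2 gF = hKi \<triangleright> hF \<triangleright> basis [] + hF \<triangleright> one_H \<triangleright> basis []"
  "Dg 2 gK = hK \<triangleright> hK \<triangleright> basis []" "Dg 2 gKi = hKi \<triangleright> hKi \<triangleright> basis []"
  by (simp_all add: numeral_2_eq_2)

definition eps :: "pbwV \<Rightarrow> complex" where
  "eps x = Poly_Mapping.lookup (D 0 x) []"

lemma V_0_scale: "u \<in> V 0 \<Longrightarrow> u = scale (Poly_Mapping.lookup u []) (basis [])"
  by (rule poly_mapping_eqI)
     (auto simp: supp_in_def lookup_single when_def subset_iff in_keys_iff)

lemma D_0: "D 0 x = scale (eps x) (basis [])"
  unfolding eps_def by (rule V_0_scale) (rule D_closed)

lemma eps_simps [simp]:
  "eps (x + y) = eps x + eps y" "eps (scale c x) = c * eps x" "eps one_H = 1"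
  by (simp_all add: eps_def lookup_add)

lemma eps_act: "eps (act g x) = (case g of gE \<Rightarrow> 0 | gF \<Rightarrow> 0 | gK \<Rightarrow> eps x | gKi \<Rightarrow> eps x)"
  unfolding eps_def D_act by (subst (1 2 3) D_0) (cases g; simp)

fun Sg :: "gen \<Rightarrow> pbwV" where
  "Sg gE = - (hE \<star> hKi)"
| "Sg gF = - (hK \<star> hF)"
| "Sg gK = hKi"
| "Sg gKi = hK"

text \<open>Right multiplication reverses the order of factors, so the antihomomorphism S arises
  from a left action and the general construction applies.\<close>

lemma uq_module_S: "uq_module q (\<lambda>g v. v \<star> Sg g) UNIV"
proof
  fix v :: "pbw \<Rightarrow>\<^sub>0 complex"
  show "v \<star> Sg gE \<star> Sg gK = scale (q\<^sup>2) (v \<star> Sg gK \<star> Sg gE)"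
    by (simp add: star_assoc hg_star star_act) (simp add: hg.simps Q_norm Q_square)
  show "v \<star> Sg gF \<star> Sg gK = scale (inverse (q\<^sup>2)) (v \<star> Sg gK \<star> Sg gF)"
    by (simp add: star_assoc hg_star star_act) (simp add: hg.simps Q_norm Q_square)
  show "v \<star> Sg gKi \<star> Sg gK = v" "v \<star> Sg gK \<star> Sg gKi = v"
    by (simp_all add: star_assoc hg_rels)
  have "Sg gF \<star> Sg gE - Sg gE \<star> Sg gF = scale cc (Sg gK - Sg gKi)"
    by (simp add: star_assoc hg_star star_act) (simp add: hg.simps Q_norm scale_diff)
  from arg_cong[OF this, of "\<lambda>x. v \<star> x"]
  show "v \<star> Sg gF \<star> Sg gE - v \<star> Sg gE \<star> Sg gF = scale cc (v \<star> Sg gK - v \<star> Sg gKi)"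
    by (simp only: star_simps star_assoc)
qed (auto simp: supp_in_def[of UNIV] intro: lmap_star)

definition S :: "pbwV \<Rightarrow> pbwV" where
  "S x = uq_module.hact (\<lambda>g v. v \<star> Sg g) x one_H"

lemma lmap_S: "lmap S"
  unfolding S_def[abs_def] by (rule uq_module.hact_lmap_left[OF uq_module_S])

lemmas S_simps [simp] = lmap_simps[OF lmap_S]
lemmas lmap_SI [lmap_intros] = lmap_comp[OF lmap_S]

lemma S_one [simp]: "S one_H = one_H"
  unfolding S_def by (rule uq_module.hact_simps[OF uq_module_S])

lemma S_act: "S (act g x) = S x \<star> Sg g"
  unfolding S_def by (rule uq_module.hact_act[OF uq_module_S]) (simp add: supp_in_def)

lemma S_hg [simp]: "S (hg g) = Sg g"
  using S_act[of g one_H] by (simp add: act_one)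

lemma S_star: "S (x \<star> y) = S y \<star> S x"
  by (induction x rule: H_induct) (simp_all add: star_act S_act star_assoc)

lemma S_Psi: "lin (\<lambda>w. foldr (\<lambda>g v. v \<star> Sg g) w one_H) p = S (Psi p)"
  using uq_module.wact_eq_hact[OF uq_module_S, of "one_H" p]
  by (simp add: S_def uq_module.wact_def[OF uq_module_S] supp_in_def)

text \<open>Coassociativity on generators: the definition splits off the first factor, whereas t
  works at the last one.\<close>

lemma Dg_snoc:
  "Dg (Suc n) gE = one_T n \<triangleleft> hE + Dg n gE \<triangleleft> hK"
  "Dg (Suc n) gF = tpow hKi n \<triangleleft> hF + Dg n gF \<triangleleft> one_H"
proof -
  show "Dg (Suc n) gE = one_T n \<triangleleft> hE + Dg n gE \<triangleleft> hK"
  proof (induction n)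
    case (Suc n)
    show ?case
      by (subst Dg.simps(4), subst Suc, subst tpow_snoc) (simp add: tcons_tsnoc)
  qed (simp add: tsnoc_Nil)
  show "Dg (Suc n) gF = tpow hKi n \<triangleleft> hF + Dg n gF \<triangleleft> one_H"
  proof (induction n)
    case (Suc n)
    show ?case
      by (subst Dg.simps(6), subst Suc, subst tpow_snoc) (simp add: tcons_tsnoc)
  qed (simp add: tsnoc_Nil)
qed

subsection \<open>Coface operators\<close>

text \<open>Counting down along the list, the index 0 meets either an entry, to which the coproduct
  is applied, or the end, where K is appended. So inner and last cofaces share one recursion; larger
  indices give 0.\<close>

fun ddB :: "nat \<Rightarrow> pbw list \<Rightarrow> pbwT" where
  "ddB 0 [] = hK \<triangleright> basis []"
| "ddB 0 (x # xs) = D 2 (basis x) \<bowtie> basis xs"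
| "ddB (Suc j) [] = 0"
| "ddB (Suc j) (x # xs) = basis x \<triangleright> ddB j xs"

text \<open>On \<open>V n\<close> the operator \<open>dd j\<close> is \<open>d\<^sup>j\<^sup>+\<^sup>1\<close> for \<open>j \<le> n\<close>.\<close>

definition dd :: "nat \<Rightarrow> pbwT \<Rightarrow> pbwT" where
  "dd j = lin (ddB j)"

lemma lmap_dd: "lmap (dd j)"
  by (simp add: dd_def lmap_lin)

lemmas dd_simps [simp] = lmap_simps[OF lmap_dd]
lemmas lmap_ddI [lmap_intros] = lmap_comp[OF lmap_dd]

lemma D_2_conc_closed [simp]: "u \<in> V n \<Longrightarrow> D 2 x \<bowtie> u \<in> V (Suc (Suc n))"
  using tensor_closed(3)[OF D_closed, of u n 2 x] by simp

lemma dd_tcons [simp]: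
  "dd 0 (a \<triangleright> u) = D 2 a \<bowtie> u" "dd (Suc j) (a \<triangleright> u) = a \<triangleright> dd j u"
proof -
  have 1: "dd 0 (basis x \<triangleright> u) = D 2 (basis x) \<bowtie> u" for x
    by (rule lmap_eqI[of _ _ u]) (auto simp: tensor_basis dd_def intro!: lmap_intros)
  show "dd 0 (a \<triangleright> u) = D 2 a \<bowtie> u"
    by (rule lmap_eqI[of _ _ a]) (auto simp: 1 intro!: lmap_intros)
  have 2: "dd (Suc j) (basis x \<triangleright> u) = basis x \<triangleright> dd j u" for x
    by (rule lmap_eqI[of _ _ u]) (auto simp: tensor_basis dd_def intro!: lmap_intros)
  show "dd (Suc j) (a \<triangleright> u) = a \<triangleright> dd j u"
    by (rule lmap_eqI[of _ _ a]) (auto simp: 2 intro!: lmap_intros)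
qed

lemma dd_Nil [simp]: "dd 0 (basis []) = hK \<triangleright> basis []" "dd (Suc j) (basis []) = 0"
  by (simp_all add: dd_def)

lemma dd_closed: "u \<in> V n \<Longrightarrow> dd j u \<in> V (Suc n)"
proof -
  have "ddB j bs \<in> V (Suc (length bs))" for bs
    by (induction j bs rule: ddB.induct) auto
  then show "u \<in> V n \<Longrightarrow> dd j u \<in> V (Suc n)"
    unfolding dd_def by (intro supp_in_lin) auto
qed

text \<open>Inner cofaces are algebra maps because the coproduct is one. The bound excludes the last
  coface, which would append K to the product but K twice over to the two factors.\<close>

lemma dd_mult:
  assumes "u \<in> V n" "v \<in> V n" "j < n"
  shows "dd j (u \<bullet> v) = dd j u \<bullet> dd j v"
  using assms
proof (induction n arbitrary: j u v)
  case (Suc n)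
  have "dd j ((a \<triangleright> u') \<bullet> (b \<triangleright> v')) = dd j (a \<triangleright> u') \<bullet> dd j (b \<triangleright> v')"
    if "u' \<in> V n" "v' \<in> V n" for a u' b v'
  proof (cases j)
    case 0
    then show ?thesis by (simp add: tmul_tcons D_star tmul_conc[of _ 2])
  next
    case (Suc k)
    then show ?thesis using Suc.IH[of u' v' k] that Suc.prems by (simp add: tmul_tcons)
  qed
  then have "dd j ((a \<triangleright> u') \<bullet> v) = dd j (a \<triangleright> u') \<bullet> dd j v" if "u' \<in> V n" for a u'
    using that by (intro V_Suc_eqI[OF Suc.prems(2), of "\<lambda>v. dd j (_ \<bullet> v)" "\<lambda>v. _ \<bullet> dd j v"]) (auto intro!: lmap_intros)
  then show ?case
    by (intro V_Suc_eqI[OF Suc.prems(1), of "\<lambda>u. dd j (u \<bullet> v)" "\<lambda>u. dd j u \<bullet> dd j v"]) (auto intro!: lmap_intros)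
qed simp

lemma dd_tpow:
  assumes "D 2 x = x \<triangleright> x \<triangleright> basis []" "j < n"
  shows "dd j (tpow x n) = tpow x (Suc n)"
  using assms(2)
proof (induction n arbitrary: j)
  case (Suc n)
  then show ?case by (cases j) (simp_all add: assms(1) tcons_tconc)
qed simp

lemma dd_Dg: "j < n \<Longrightarrow> dd j (Dg n g) = Dg (Suc n) g"
proof (induction n arbitrary: j)
  case (Suc n)
  note p = dd_tpow[OF D_2(3)] dd_tpow[OF D_2(4)] dd_tpow[OF D_2(5)]
  show ?case
  proof (cases j)
    case 0
    then show ?thesis by (cases g) (simp_all add: numeral_2_eq_2 tcons_tconc)
  next
    case (Suc k)
    then show ?thesis using Suc.IH[of k] Suc.prems by (cases g) (simp_all add: p)
  qed
qed simp

lemma dd_D: "j < n \<Longrightarrow> dd j (D n x) = D (Suc n) x"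
proof (induction x rule: H_induct)
  case one
  then show ?case using dd_tpow[OF D_2(5)] by simp
next
  case (act g x)
  then show ?case by (simp only: D_act dd_mult[of _ n] Dg_closed D_closed dd_Dg)
qed simp_all

lemma dd_D_tmul: "v \<in> V n \<Longrightarrow> j < n \<Longrightarrow> dd j (D n x \<bullet> v) = D (Suc n) x \<bullet> dd j v"
  by (simp add: dd_mult[of _ n] dd_D)

lemma dd_snoc:
  assumes "u \<in> V n"
  shows "j < n \<Longrightarrow> dd j (u \<triangleleft> a) = dd j u \<triangleleft> a" "dd n (u \<triangleleft> a) = u \<bowtie> D 2 a"
    and "dd n u = u \<triangleleft> hK"
  using assms
proof (induction n arbitrary: j u)
  case 0
  {
    case 2
    then show ?case by (rule V_0_eqI) (auto intro!: lmap_intros simp: tsnoc_Nil)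
  next
    case 3
    then show ?case by (rule V_0_eqI) (auto intro!: lmap_intros simp: tsnoc_Nil)
  }
next
  case (Suc n)
  {
    case 1
    have "dd j ((b \<triangleright> v) \<triangleleft> a) = dd j (b \<triangleright> v) \<triangleleft> a" if "v \<in> V n" for b v
      using Suc.IH(1)[OF _ that] 1 by (cases j) (simp_all add: tcons_tsnoc tconc_tsnoc)
    then show ?case
      using 1 by (intro V_Suc_eqI[of u n "\<lambda>u. dd j (u \<triangleleft> a)" "\<lambda>u. dd j u \<triangleleft> a"]) (auto intro!: lmap_intros)
  next
    case 2
    then show ?case
      by (rule V_Suc_eqI) (auto intro!: lmap_intros simp: Suc.IH(2) tcons_tsnoc tcons_tconc)
  next
    case 3
    then show ?case
      by (rule V_Suc_eqI) (auto intro!: lmap_intros simp: Suc.IH(3) tcons_tsnoc)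
  }
qed simp_all

text \<open>Sweedler notation: for bilinear \<open>f\<close>, \<open>pair_lin f (D 2 x)\<close> is
  the sum of the values of \<open>f\<close> on the pairs of tensor factors of the coproduct of
  \<open>x\<close>.\<close>

definition pair_lin :: "(pbwV \<Rightarrow> pbwV \<Rightarrow> ('l \<Rightarrow>\<^sub>0 complex)) \<Rightarrow> pbwT \<Rightarrow> ('l \<Rightarrow>\<^sub>0 complex)" where
  "pair_lin f = lin (\<lambda>bs. f (basis (bs ! 0)) (basis (bs ! 1)))"

lemma lmap_pair_lin: "lmap (pair_lin f)"
  by (simp add: pair_lin_def lmap_lin)

lemmas pair_lin_simps [simp] = lmap_simps[OF lmap_pair_lin]
lemmas lmap_pair_linI [lmap_intros] = lmap_comp[OF lmap_pair_lin]

lemma pair_lin_tcons: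
  assumes "\<And>a. lmap (f a)" "\<And>b. lmap (\<lambda>a. f a b)"
  shows "pair_lin f (a \<triangleright> b \<triangleright> basis []) = f a b"
proof -
  have 1: "pair_lin f (basis x \<triangleright> b \<triangleright> basis []) = f (basis x) b" for x
    by (rule lmap_eqI[of _ _ b]) (auto intro!: lmap_intros assms(1), simp add: tensor_basis pair_lin_def)
  show ?thesis
    by (rule lmap_eqI[of _ _ a]) (auto simp: 1 intro!: lmap_intros assms(2))
qed

text \<open>Links \<open>D\<close> to the recursion of \<open>iter_comult\<close>. The map applied
  to \<open>D 2 x\<close> intertwines multiplication by \<open>Dg 2 g\<close> with multiplication by
  \<open>Dg (Suc n) g\<close>.\<close>

lemma D_Suc_pair: "D (Suc n) x = pair_lin (\<lambda>a b. a \<triangleright> D n b) (D 2 x)"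
proof (induction x rule: H_induct)
  have p: "pair_lin (\<lambda>a b. a \<triangleright> D n b) (a \<triangleright> b \<triangleright> basis []) = a \<triangleright> D n b" for a b
    by (rule pair_lin_tcons) (auto intro!: lmap_intros)
  case one
  show ?case by (simp add: numeral_2_eq_2 p[simplified])
next
  have p: "pair_lin (\<lambda>a b. a \<triangleright> D n b) (a \<triangleright> b \<triangleright> basis []) = a \<triangleright> D n b" for a b
    by (rule pair_lin_tcons) (auto intro!: lmap_intros)
  case (act g x)
  have "pair_lin (\<lambda>a b. a \<triangleright> D n b) (Dg 2 g \<bullet> z) = Dg (Suc n) g \<bullet> pair_lin (\<lambda>a b. a \<triangleright> D n b) z"
    if "z \<in> V 2" for z
  proof (rule V_2_eqI[OF that])
    fix a b
    show "pair_lin (\<lambda>a b. a \<triangleright> D n b) (Dg 2 g \<bullet> (a \<triangleright> b \<triangleright> basis []))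
        = Dg (Suc n) g \<bullet> pair_lin (\<lambda>a b. a \<triangleright> D n b) (a \<triangleright> b \<triangleright> basis [])"
      by (cases g) (simp_all add: numeral_2_eq_2 tmul_tcons p D_star)
  qed (auto intro!: lmap_intros)
  then show ?case by (simp only: D_act D_closed act)
qed simp_all

lemma D_counit: "pair_lin (\<lambda>a b. scale (eps a) b) (D 2 x) = x"
proof (induction x rule: H_induct)
  have p: "pair_lin (\<lambda>a b. scale (eps a) b) (a \<triangleright> b \<triangleright> basis []) = scale (eps a) b" for a b
    by (rule pair_lin_tcons) (auto simp: lmap_def scale_add scale_left_add mult.commute)
  case one
  show ?case by (simp add: numeral_2_eq_2 p)
next
  have p: "pair_lin (\<lambda>a b. scale (eps a) b) (a \<triangleright> b \<triangleright> basis []) = scale (eps a) b" for a b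
    by (rule pair_lin_tcons) (auto simp: lmap_def scale_add scale_left_add mult.commute)
  case (act g x)
  have "pair_lin (\<lambda>a b. scale (eps a) b) (Dg 2 g \<bullet> z) = act g (pair_lin (\<lambda>a b. scale (eps a) b) z)"
    if "z \<in> V 2" for z
  proof (rule V_2_eqI[OF that])
    fix a b
    show "pair_lin (\<lambda>a b. scale (eps a) b) (Dg 2 g \<bullet> (a \<triangleright> b \<triangleright> basis []))
        = act g (pair_lin (\<lambda>a b. scale (eps a) b) (a \<triangleright> b \<triangleright> basis []))"
      by (cases g) (simp_all add: numeral_2_eq_2 tmul_tcons p hg_star eps_act)
  qed (auto intro!: lmap_intros)
  then show ?case by (simp only: D_act D_closed act)
qed simp_all

end

section \<open>The cyclic operator and its relations with the cofaces\<close>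

context quantum
begin

fun cycB :: "pbw list \<Rightarrow> pbwT" where
  "cycB [] = basis []"
| "cycB (x # xs) = D (Suc (length xs)) (S (basis x)) \<bullet> (basis xs \<triangleleft> hK)"

definition cycT :: "pbwT \<Rightarrow> pbwT" where
  "cycT = lin cycB"

lemma lmap_cycT: "lmap cycT"
  by (simp add: cycT_def lmap_lin)

lemmas cycT_simps [simp] = lmap_simps[OF lmap_cycT]
lemmas lmap_cycTI [lmap_intros] = lmap_comp[OF lmap_cycT]

lemma cycT_Nil [simp]: "cycT (basis []) = basis []"
  by (simp add: cycT_def)

lemma cycT_tcons: "u \<in> V n \<Longrightarrow> cycT (a \<triangleright> u) = D (Suc n) (S a) \<bullet> (u \<triangleleft> hK)"
proof -
  assume u: "u \<in> V n"
  have 1: "cycT (basis x \<triangleright> u) = D (Suc n) (S (basis x)) \<bullet> (u \<triangleleft> hK)" for x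
    by (rule supp_in_eqI[OF u]) (auto simp: tensor_basis cycT_def intro!: lmap_intros)
  show ?thesis
    by (rule lmap_eqI[of _ _ a]) (auto simp: 1 intro!: lmap_intros)
qed

lemma cycT_closed [simp]: "u \<in> V n \<Longrightarrow> cycT u \<in> V n"
proof -
  have "cycB bs \<in> V (length bs)" for bs
    by (cases bs) auto
  then show "u \<in> V n \<Longrightarrow> cycT u \<in> V n"
    unfolding cycT_def by (intro supp_in_lin) auto
qed

lemma D_tcons:
  "D (Suc n) hK \<bullet> (a \<triangleright> w) = (hK \<star> a) \<triangleright> (D n hK \<bullet> w)"
  "D (Suc n) hKi \<bullet> (a \<triangleright> w) = (hKi \<star> a) \<triangleright> (D n hKi \<bullet> w)"
  "w \<in> V n \<Longrightarrow> D (Suc n) hE \<bullet> (a \<triangleright> w) = a \<triangleright> (D n hE \<bullet> w) + (hE \<star> a) \<triangleright> (D n hK \<bullet> w)"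
  "w \<in> V n \<Longrightarrow> D (Suc n) hF \<bullet> (a \<triangleright> w) = (hKi \<star> a) \<triangleright> (D n hF \<bullet> w) + (hF \<star> a) \<triangleright> w"
  by (simp_all add: tmul_tcons)

lemma D_tsnoc:
  assumes "w \<in> V n"
  shows "D (Suc n) hK \<bullet> (w \<triangleleft> a) = (D n hK \<bullet> w) \<triangleleft> (hK \<star> a)"
    "D (Suc n) hKi \<bullet> (w \<triangleleft> a) = (D n hKi \<bullet> w) \<triangleleft> (hKi \<star> a)"
    "D (Suc n) hE \<bullet> (w \<triangleleft> a) = w \<triangleleft> (hE \<star> a) + (D n hE \<bullet> w) \<triangleleft> (hK \<star> a)"
    "D (Suc n) hF \<bullet> (w \<triangleleft> a) = (D n hKi \<bullet> w) \<triangleleft> (hF \<star> a) + (D n hF \<bullet> w) \<triangleleft> a"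
  using assms
  by (simp_all add: tpow_snoc Dg_snoc tmul_tsnoc[of _ n] del: tpow.simps(2) Dg.simps(4,6))

lemma D_cancel:
  assumes "w \<in> V n"
  shows "D n hK \<bullet> (D n hKi \<bullet> w) = w" "D n hKi \<bullet> (D n hK \<bullet> w) = w"
  using assms by (simp_all add: tmul_assoc[symmetric] tmul_tpow hg_rels)

text \<open>For E and F the two terms in which the generator acts on \<open>w\<close> cancel. What
  remains has K g in the last slot, because S^2(g) K = K g: here the choice of K as group-like
  element matches the square of the antipode.\<close>

lemma cycT_Sg:
  assumes "v \<in> V (Suc n)"
  shows "cycT (D (Suc n) (Sg g) \<bullet> v) = cycT v \<bullet> (one_T n \<triangleleft> hg g)"
proof (rule V_Suc_eqI[OF assms])
  fix a and w :: "pbwT" assume w [simp]: "w \<in> V n"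
  have r: "(w \<triangleleft> hK) \<bullet> (one_T n \<triangleleft> x) = w \<triangleleft> (hK \<star> x)" for x
    by (simp add: tmul_tsnoc[of _ n])
  show "cycT (D (Suc n) (Sg g) \<bullet> (a \<triangleright> w)) = cycT (a \<triangleright> w) \<bullet> (one_T n \<triangleleft> hg g)"
    by (cases g)
      (simp_all only: Sg.simps D_simps D_star tmul_assoc D_tcons D_tsnoc D_cancel cycT_tcons[of _ n] r w
        cycT_simps S_simps S_star S_hg tmul_simps tmul_closed D_closed star_assoc star_simps
        hg_rels(5,6) star_one tensor_simps minus_add_distrib minus_minus add_uminus_conv_diff, simp_all)
qed (auto intro!: lmap_intros)

text \<open>The cyclic operator intertwines the antipode on the left with right multiplication on
  the last factor; both sides are multiplicative in \<open>x\<close>, so generators suffice.\<close>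

lemma cycT_S: "v \<in> V (Suc n) \<Longrightarrow> cycT (D (Suc n) (S x) \<bullet> v) = cycT v \<bullet> (one_T n \<triangleleft> x)"
proof (induction x arbitrary: v rule: H_induct)
  case one
  have "one_T n \<triangleleft> one_H = one_T (Suc n)" by (rule tpow_snoc[symmetric])
  then show ?case using one by (simp del: tpow.simps(2))
next
  case (act g x)
  have "cycT (D (Suc n) (S (act g x)) \<bullet> v) = cycT (D (Suc n) (Sg g) \<bullet> v) \<bullet> (one_T n \<triangleleft> x)"
    using act.IH[of "D (Suc n) (Sg g) \<bullet> v"] act.prems by (simp add: S_act D_star tmul_assoc)
  also have "\<dots> = cycT v \<bullet> ((one_T n \<triangleleft> hg g) \<bullet> (one_T n \<triangleleft> x))"
    by (simp only: cycT_Sg[OF act.prems] tmul_assoc)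
  also have "(one_T n \<triangleleft> hg g) \<bullet> (one_T n \<triangleleft> x) = one_T n \<triangleleft> act g x"
    by (simp add: tmul_tsnoc[of _ n] hg_star)
  finally show ?case .
qed (simp_all)

text \<open>The antipode axiom inside a diagonal action: S(h_0) applied to h_1 (x) v sums to 1 (x)
  S(h) v. This is what turns t d^1 into d^0 t.\<close>

lemma antipode_pair:
  assumes "v \<in> V m"
  shows "pair_lin (\<lambda>a b. D (Suc m) (S a) \<bullet> (b \<triangleright> v)) (D 2 x) = one_H \<triangleright> (D m (S x) \<bullet> v)"
proof -
  let ?f = "\<lambda>v. pair_lin (\<lambda>a b. D (Suc m) (S a) \<bullet> (b \<triangleright> v))"
  have p: "?f v (a \<triangleright> b \<triangleright> basis []) = D (Suc m) (S a) \<bullet> (b \<triangleright> v)" for v a b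
    by (rule pair_lin_tcons) (auto intro!: lmap_intros)
  \<comment> \<open>A generator in front of \<open>x\<close> can be traded for S(g) acting on
    \<open>v\<close>, so the induction runs with \<open>v\<close> arbitrary.\<close>
  have gen: "?f v (Dg 2 g \<bullet> z) = ?f (D m (Sg g) \<bullet> v) z" if v [simp]: "v \<in> V m" and z: "z \<in> V 2" for v g z
  proof (rule V_2_eqI[OF z])
    fix a b
    show "?f v (Dg 2 g \<bullet> (a \<triangleright> b \<triangleright> basis [])) = ?f (D m (Sg g) \<bullet> v) (a \<triangleright> b \<triangleright> basis [])"
      by (cases g) (simp_all only: Dg_2 tmul_simps tmul_tcons p pair_lin_simps tmul_Nil star_one,
         simp_all only: S_star S_hg Sg.simps D_simps D_star tmul_assoc D_tcons D_cancel v
        tmul_simps tmul_closed D_closed star_assoc[symmetric] hg_rels(5,6) star_one tensor_simps S_simps star_simps D_tcons,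
        simp_all add: star_assoc hg_rels)
  qed (auto intro!: lmap_intros)
  show ?thesis
    using assms
  proof (induction x arbitrary: v rule: H_induct)
    case one
    show ?case using one p[of v one_H one_H] by (simp add: numeral_2_eq_2 tmul_tcons)
  next
    case (act g x)
    have "?f v (D 2 (act g x)) = ?f (D m (Sg g) \<bullet> v) (D 2 x)"
      unfolding D_act by (rule gen[OF act.prems D_closed])
    also have "\<dots> = one_H \<triangleright> (D m (S x) \<bullet> (D m (Sg g) \<bullet> v))"
      by (rule act.IH) (simp add: act.prems)
    finally show ?case by (simp only: S_act D_star tmul_assoc)
  qed (simp_all)
qed

lemma cycT_coface_first: "w \<in> V n \<Longrightarrow> cycT (one_H \<triangleright> w) = w \<triangleleft> hK"
  using tmul_one(1)[of "w \<triangleleft> hK" "Suc n"] by (simp add: cycT_tcons[of _ n] del: tpow.simps(2) tmul_one)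

lemma cycT_dd_0: "w \<in> V n \<Longrightarrow> cycT (dd 0 w) = one_H \<triangleright> cycT w"
proof (cases n)
  \<comment> \<open>In degree 0 the coface d^1 is already the last one; it appends K, and S(K) K =
    1.\<close>
  case 0
  assume "w \<in> V n"
  then show ?thesis
    unfolding 0
  proof (rule V_0_eqI)
    have "cycT (hK \<triangleright> basis []) = D (Suc 0) (S hK) \<bullet> (basis [] \<triangleleft> hK)"
      by (rule cycT_tcons) simp
    then show "cycT (dd 0 (basis [])) = one_H \<triangleright> cycT (basis [])"
      by (simp add: tsnoc_Nil tmul_tcons hg_rels)
  qed (auto intro!: lmap_intros)
next
  case (Suc m)
  assume "w \<in> V n"
  then show ?thesis
    unfolding Suc
  proof (rule V_Suc_eqI)
    fix a and u :: "pbwT" assume u [simp]: "u \<in> V m"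
    have p: "pair_lin (\<lambda>a b. D (Suc (Suc m)) (S a) \<bullet> (b \<triangleright> (u \<triangleleft> hK))) (a \<triangleright> b \<triangleright> basis [])
       = D (Suc (Suc m)) (S a) \<bullet> (b \<triangleright> (u \<triangleleft> hK))" for a b
      by (rule pair_lin_tcons) (auto intro!: lmap_intros)
    have "cycT (z \<bowtie> u) = pair_lin (\<lambda>a b. D (Suc (Suc m)) (S a) \<bullet> (b \<triangleright> (u \<triangleleft> hK))) z" if "z \<in> V 2" for z
      using that
      by (rule V_2_eqI) (auto intro!: lmap_intros simp: tcons_tconc cycT_tcons[of _ "Suc m"] tcons_tsnoc p)
    from this[OF D_closed, of a] show "cycT (dd 0 (a \<triangleright> u)) = one_H \<triangleright> cycT (a \<triangleright> u)"
      by (simp add: antipode_pair[of _ "Suc m"] cycT_tcons[of _ m])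
  qed (auto intro!: lmap_intros)
qed

lemma cycT_dd_Suc: "w \<in> V (Suc n) \<Longrightarrow> j \<le> n \<Longrightarrow> cycT (dd (Suc j) w) = dd j (cycT w)"
proof (rule V_Suc_eqI, assumption)
  fix a and u :: "pbwT" assume j: "j \<le> n" and u [simp]: "u \<in> V n"
  \<comment> \<open>For \<open>j = n\<close> the left side doubles the appended K while the right
    side appends K twice; they agree as K is group-like.\<close>
  have "dd j (u \<triangleleft> hK) = dd j u \<triangleleft> hK"
  proof (cases "j = n")
    case True
    then show ?thesis
      by (simp add: dd_snoc(2,3)[OF u] D_2[simplified])
        (simp add: numeral_2_eq_2 tsnoc_conc tconc_assoc tcons_tconc)
  next
    case False
    then show ?thesis using j by (simp add: dd_snoc(1)[OF u])
  qed
  moreover have "dd j (D (Suc n) (S a) \<bullet> (u \<triangleleft> hK)) = D (Suc (Suc n)) (S a) \<bullet> dd j (u \<triangleleft> hK)"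
    using j by (intro dd_D_tmul) auto
  ultimately show "cycT (dd (Suc j) (a \<triangleright> u)) = dd j (cycT (a \<triangleright> u))"
    by (simp add: cycT_tcons[of _ n] cycT_tcons[of _ "Suc n"] dd_closed)
qed (auto intro!: lmap_intros)

subsection \<open>Cyclicity\<close>

primrec tens :: "pbwV list \<Rightarrow> pbwT" where
  "tens [] = basis []"
| "tens (h # hs) = h \<triangleright> tens hs"

lemma tens_closed [simp]: "tens hs \<in> V (length hs)"
  by (induction hs) auto

lemma tens_snoc: "tens (hs @ [h]) = tens hs \<triangleleft> h"
  by (induction hs) (auto simp: tsnoc_Nil tcons_tsnoc)

lemma tens_basis: "tens (map basis bs) = basis bs"
  by (induction bs) (auto simp: tensor_basis)

lemma tens_map_star: "tens (map ((\<star>) x) hs) = tpow x (length hs) \<bullet> tens hs"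
  by (induction hs) (auto simp: tmul_tcons)

text \<open>The projection of n + 1 tensor factors to the coinvariants of the diagonal action, which
  are identified with n factors by means of the antipode. The empty list is a dummy case.\<close>

fun coinv :: "pbwV list \<Rightarrow> pbwT" where
  "coinv [] = 0"
| "coinv (h # hs) = D (length hs) (S h) \<bullet> tens hs"

text \<open>Under \<open>h\<^sub>0 \<otimes> w \<mapsto> S(h\<^sub>0) w\<close> the cyclic operator becomes a rotation twisted by \<open>K\<close>.\<close>

lemma cycT_coinv: "cycT (coinv (h # h' # hs)) = coinv (h' # hs @ [hK \<star> h])"
proof -
  let ?n = "length hs"
  have "cycT (coinv (h # h' # hs)) = cycT (h' \<triangleright> tens hs) \<bullet> (one_T ?n \<triangleleft> h)"
    by (simp add: cycT_S)
  also have "\<dots> = D (Suc ?n) (S h') \<bullet> ((tens hs \<triangleleft> hK) \<bullet> (one_T ?n \<triangleleft> h))"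
    by (simp only: cycT_tcons[OF tens_closed] tmul_assoc)
  also have "(tens hs \<triangleleft> hK) \<bullet> (one_T ?n \<triangleleft> h) = tens (hs @ [hK \<star> h])"
    by (simp add: tmul_tsnoc[of _ ?n] tens_snoc)
  finally show ?thesis by simp
qed

text \<open>Each step sends the first factor to the end with K multiplied on its left. The length
  bound provides the second entry that has to become the new first one.\<close>

lemma cycT_pow_coinv:
  "2 \<le> length (as @ bs) \<Longrightarrow> (cycT ^^ length as) (coinv (as @ bs)) = coinv (bs @ map ((\<star>) hK) as)"
proof (induction as arbitrary: bs)
  case (Cons a as)
  obtain c cs where c: "as @ bs = c # cs" using Cons.prems by (cases "as @ bs") auto
  have "(cycT ^^ length (a # as)) (coinv ((a # as) @ bs)) = (cycT ^^ length as) (cycT (coinv (a # as @ bs)))"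
    by (simp add: funpow_swap1)
  also have "cycT (coinv (a # as @ bs)) = coinv (as @ bs @ [hK \<star> a])"
    using cycT_coinv[of a c cs] c by (simp add: append_assoc[symmetric] del: append_assoc)
  also have "(cycT ^^ length as) \<dots> = coinv ((bs @ [hK \<star> a]) @ map ((\<star>) hK) as)"
    using Cons.IH[of "bs @ [hK \<star> a]"] Cons.prems by simp
  finally show ?case by simp
qed simp

lemma funpow_lmap: "lmap (F :: ('k \<Rightarrow>\<^sub>0 complex) \<Rightarrow> ('k \<Rightarrow>\<^sub>0 complex)) \<Longrightarrow> lmap (F ^^ n)"
  by (induction n) (simp_all add: lmap_def)

text \<open>A basis tensor is \<open>coinv\<close> of itself with 1 prepended. After a full rotation
  every factor, the prepended 1 included, carries a K, and the diagonal action of S(K) removes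
  them.\<close>

theorem cycT_pow:
  assumes "u \<in> V n"
  shows "(cycT ^^ Suc n) u = u"
proof (rule supp_in_eqI[OF assms funpow_lmap[OF lmap_cycT] lmap_id])
  fix bs :: "pbw list" assume "bs \<in> {bs. length bs = n}"
  then have n: "length bs = n" by simp
  show "(cycT ^^ Suc n) (basis bs) = basis bs"
  proof (cases n)
    case 0
    then show ?thesis using n by simp
  next
    case (Suc m)
    let ?hs = "map basis bs"
    have "tens ?hs \<in> V n" using tens_closed[of ?hs] n by simp
    note t = this
    have *: "D n (S (hK \<star> one_H)) \<bullet> (tpow hK n \<bullet> tens ?hs) = tens ?hs"
      using D_cancel(2)[OF t] by simp
    have c: "coinv (one_H # ?hs) = basis bs"
      using t n by (simp add: tens_basis)
    have "(cycT ^^ Suc n) (basis bs) = (cycT ^^ length (one_H # ?hs)) (coinv ((one_H # ?hs) @ []))"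
      using c n by simp
    also have "\<dots> = coinv ([] @ map ((\<star>) hK) (one_H # ?hs))"
      by (rule cycT_pow_coinv) (use n Suc in simp)
    also have "\<dots> = basis bs"
      using n * by (simp only: append_Nil list.map coinv.simps length_map tens_map_star tens_basis)
    finally show ?thesis .
  qed
qed

end

section \<open>The Hochschild and cyclic differentials\<close>

context quantum
begin

text \<open>The sum of the cofaces \<open>(-1)\<^sup>j d\<^sup>j\<^sup>+\<^sup>1\<close>; the last coface appends \<open>e\<close>. For
  \<open>e = K\<close> this leads to \<open>b\<close>, for \<open>e = 0\<close> to \<open>b'\<close>.\<close>

fun betB :: "pbwV \<Rightarrow> pbw list \<Rightarrow> pbwT" where
  "betB e [] = e \<triangleright> basis []"
| "betB e (x # xs) = D 2 (basis x) \<bowtie> basis xs - basis x \<triangleright> betB e xs"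

definition bet :: "pbwV \<Rightarrow> pbwT \<Rightarrow> pbwT" where
  "bet e = lin (betB e)"

definition bo :: "pbwV \<Rightarrow> pbwT \<Rightarrow> pbwT" where
  "bo e u = one_H \<triangleright> u - bet e u"

lemma lmap_bet: "lmap (bet e)"
  by (simp add: bet_def lmap_lin)

lemmas bet_simps [simp] = lmap_simps[OF lmap_bet]
lemmas lmap_betI [lmap_intros] = lmap_comp[OF lmap_bet]

lemma lmap_bo: "lmap (bo e)"
  unfolding bo_def[abs_def] by (intro lmap_intros)

lemmas bo_simps [simp] = lmap_simps[OF lmap_bo]
lemmas lmap_boI [lmap_intros] = lmap_comp[OF lmap_bo]

lemma bet_Nil [simp]: "bet e (basis []) = e \<triangleright> basis []"
  by (simp add: bet_def)

lemma bet_basis_tcons: "bet e (basis x \<triangleright> u) = D 2 (basis x) \<bowtie> u - basis x \<triangleright> bet e u"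
  by (rule lmap_eqI[of _ _ u]) (auto simp: tensor_basis bet_def intro!: lmap_intros)

lemma bet_tcons [simp]: "bet e (a \<triangleright> u) = D 2 a \<bowtie> u - a \<triangleright> bet e u"
  by (rule lmap_eqI[of _ _ a]) (auto simp: bet_basis_tcons intro!: lmap_intros)

lemma bet_closed [simp]: "u \<in> V n \<Longrightarrow> bet e u \<in> V (Suc n)"
proof -
  have "betB e bs \<in> V (Suc (length bs))" for bs
    by (induction bs) auto
  then show "u \<in> V n \<Longrightarrow> bet e u \<in> V (Suc n)"
    unfolding bet_def by (intro supp_in_lin) auto
qed

lemma bo_closed [simp]: "u \<in> V n \<Longrightarrow> bo e u \<in> V (Suc n)"
  by (simp add: bo_def)

lemma bet_conc:
  assumes "z \<in> V 2"
  shows "bet e (z \<bowtie> u) = dd 0 z \<bowtie> u - dd 1 z \<bowtie> u + z \<bowtie> bet e u"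
  by (rule V_2_eqI[OF assms]) (auto intro!: lmap_intros simp: tcons_tconc tconc_assoc)

text \<open>The two terms in which a coproduct hits a factor of the coproduct of \<open>x\<close>
  cancel by coassociativity.\<close>

lemma bet_D_2: "bet e (D 2 x \<bowtie> u) = D 2 x \<bowtie> bet e u"
  using dd_D[of 0 2 x] dd_D[of 1 2 x] by (simp add: bet_conc)

text \<open>Satisfied by 0 as well as by group-likes, so that one argument gives b b = 0 and b' b' =
  0.\<close>

definition last_ok :: "pbwV \<Rightarrow> bool" where
  "last_ok e \<longleftrightarrow> D 2 e = e \<triangleright> e \<triangleright> basis []"

lemma last_ok [simp]: "last_ok 0" "last_ok hK"
  by (simp_all add: last_ok_def numeral_2_eq_2)

lemma bet_bet:
  assumes "last_ok e"
  shows "bet e (bet e u) = 0"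
proof -
  have "bet e (bet e (basis bs)) = 0" for bs
    using assms by (induction bs) (auto simp: last_ok_def tensor_basis[symmetric] bet_D_2)
  then show ?thesis
    by (rule_tac lmap_eqI[of "\<lambda>u. bet e (bet e u)" "\<lambda>u. 0"]) (auto intro!: lmap_intros)
qed

lemma bo_bo: "last_ok e \<Longrightarrow> bo e (bo e u) = 0"
  using bet_bet[of e u] by (simp add: bo_def D_2[simplified])
    (simp add: numeral_2_eq_2 tcons_tconc)

definition cf :: "nat \<Rightarrow> pbwT \<Rightarrow> pbwT" where
  "cf i u = (if i = 0 then one_H \<triangleright> u else dd (i - 1) u)"

lemma lmap_cf: "lmap (cf i)"
  unfolding cf_def[abs_def] by (cases "i = 0") (auto intro!: lmap_intros)

lemmas cf_simps [simp] = lmap_simps[OF lmap_cf]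
lemmas lmap_cfI [lmap_intros] = lmap_comp[OF lmap_cf]

lemma cf_closed [simp]: "u \<in> V n \<Longrightarrow> cf i u \<in> V (Suc n)"
  by (simp add: cf_def dd_closed)

text \<open>Proofs use the recursion, the bicomplex the alternating sum. With \<open>e = 0\<close>
  the last coface drops out, hence the shorter range.\<close>

lemma bet_sum:
  assumes "u \<in> V n"
  shows "bet hK u = (\<Sum>j\<le>n. scale ((-1) ^ j) (dd j u))" "bet 0 u = (\<Sum>j<n. scale ((-1) ^ j) (dd j u))"
proof -
  show "bet hK u = (\<Sum>j\<le>n. scale ((-1) ^ j) (dd j u))"
    using assms
  proof (induction n arbitrary: u)
    case 0
    then show ?case by (rule V_0_eqI) (auto intro!: lmap_intros)
  next
    case (Suc n)
    from Suc.prems show ?case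
      by (rule V_Suc_eqI)
         (auto intro!: lmap_intros simp: Suc.IH sum.atMost_Suc_shift lmap_sum[OF lmap_tcons(2)] sum_negf simp del: sum.atMost_Suc)
  qed
  show "bet 0 u = (\<Sum>j<n. scale ((-1) ^ j) (dd j u))"
    using assms
  proof (induction n arbitrary: u)
    case 0
    then show ?case by (rule V_0_eqI) (auto intro!: lmap_intros)
  next
    case (Suc n)
    from Suc.prems show ?case
      by (rule V_Suc_eqI)
         (auto intro!: lmap_intros simp: Suc.IH sum.lessThan_Suc_shift lmap_sum[OF lmap_tcons(2)] sum_negf simp del: sum.lessThan_Suc)
  qed
qed

lemma bo_sum:
  assumes "u \<in> V n"
  shows "bo hK u = (\<Sum>i\<le>Suc n. scale ((-1) ^ i) (cf i u))" "bo 0 u = (\<Sum>i\<le>n. scale ((-1) ^ i) (cf i u))"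
proof -
  show "bo hK u = (\<Sum>i\<le>Suc n. scale ((-1) ^ i) (cf i u))"
    by (simp add: bo_def bet_sum[OF assms] sum.atMost_Suc_shift cf_def sum_negf del: sum.atMost_Suc)
  have "(\<Sum>i\<le>n. scale ((-1) ^ i) (cf i u)) = (\<Sum>i<Suc n. scale ((-1) ^ i) (cf i u))"
    by (simp add: lessThan_Suc_atMost)
  also have "\<dots> = one_H \<triangleright> u - (\<Sum>j<n. scale ((-1) ^ j) (dd j u))"
    by (simp add: sum.lessThan_Suc_shift cf_def sum_negf del: sum.lessThan_Suc)
  finally show "bo 0 u = (\<Sum>i\<le>n. scale ((-1) ^ i) (cf i u))"
    by (simp add: bo_def bet_sum[OF assms])
qed

section \<open>Cyclic relations, the sign operator and the norm\<close>

lemma cycT_cf_0: "w \<in> V n \<Longrightarrow> cycT (cf 0 w) = cf (Suc n) w"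
  by (simp add: cf_def cycT_coface_first dd_snoc(3))

lemma cycT_cf_Suc: "w \<in> V n \<Longrightarrow> i \<le> n \<Longrightarrow> cycT (cf (Suc i) w) = cf i (cycT w)"
  by (cases i; cases n) (auto simp: cf_def cycT_dd_0[of _ n] cycT_dd_0[of _ 0] cycT_dd_0[of _ "Suc _"] cycT_dd_Suc)

text \<open>The sign, and in \<open>norm_op\<close> the number of summands, is read off the length
  of each list, which makes both operators linear on all degrees together.\<close>

definition lam :: "pbwT \<Rightarrow> pbwT" where
  "lam = lin (\<lambda>bs. scale ((-1) ^ length bs) (cycB bs))"

lemma lmap_lam: "lmap lam"
  by (simp add: lam_def lmap_lin)

lemmas lam_simps [simp] = lmap_simps[OF lmap_lam]
lemmas lmap_lamI [lmap_intros] = lmap_comp[OF lmap_lam]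

lemma lam_V: "u \<in> V n \<Longrightarrow> lam u = scale ((-1) ^ n) (cycT u)"
  by (rule supp_in_eqI[of u]) (auto simp: lam_def cycT_def intro!: lmap_intros)

lemma lam_closed [simp]: "u \<in> V n \<Longrightarrow> lam u \<in> V n"
  by (simp add: lam_V)

lemma lam_pow_closed [simp]: "u \<in> V n \<Longrightarrow> (lam ^^ k) u \<in> V n"
  by (induction k) auto

lemma lmap_lam_pow: "lmap (lam ^^ k)"
  by (rule funpow_lmap[OF lmap_lam])

lemmas lam_pow_simps [simp] = lmap_simps[OF lmap_lam_pow]
lemmas lmap_lam_powI [lmap_intros] = lmap_comp[OF lmap_lam_pow]

lemma lam_pow:
  assumes "u \<in> V n"
  shows "(lam ^^ Suc n) u = u"
proof -
  have "(lam ^^ k) u = scale (((-1) ^ n) ^ k) ((cycT ^^ k) u) \<and> (cycT ^^ k) u \<in> V n" for k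
    using assms by (induction k) (auto simp: lam_V[of _ n] mult.commute)
  \<comment> \<open>The accumulated sign has exponent n (n + 1), which is even.\<close>
  from conjunct1[OF this, of "Suc n"] show ?thesis
    using cycT_pow[OF assms] by (simp add: power_mult[symmetric] del: funpow.simps power_Suc)
qed

definition norm_op :: "pbwT \<Rightarrow> pbwT" where
  "norm_op = lin (\<lambda>bs. \<Sum>j\<le>length bs. (lam ^^ j) (basis bs))"

lemma lmap_norm_op: "lmap norm_op"
  by (simp add: norm_op_def lmap_lin)

lemmas norm_op_simps [simp] = lmap_simps[OF lmap_norm_op]
lemmas lmap_norm_opI [lmap_intros] = lmap_comp[OF lmap_norm_op]

lemma norm_op_V: "u \<in> V n \<Longrightarrow> norm_op u = (\<Sum>j\<le>n. (lam ^^ j) u)"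
  by (rule supp_in_eqI[of u]) (auto simp: norm_op_def intro!: lmap_intros)

lemma norm_op_closed [simp]: "u \<in> V n \<Longrightarrow> norm_op u \<in> V n"
  by (auto simp: norm_op_V intro!: supp_in_sum)

lemma norm_lam:
  assumes "u \<in> V n"
  shows "norm_op (lam u) = norm_op u" "lam (norm_op u) = norm_op u"
proof -
  have "(\<Sum>j\<le>n. (lam ^^ Suc j) u) = (\<Sum>j\<le>n. (lam ^^ j) u)"
  proof -
    have "u + (\<Sum>j\<le>n. (lam ^^ Suc j) u) = (\<Sum>j\<le>Suc n. (lam ^^ j) u)"
      by (simp only: sum.atMost_Suc_shift) simp
    also have "\<dots> = (\<Sum>j\<le>n. (lam ^^ j) u) + u"
      using lam_pow[OF assms] by (simp only: sum.atMost_Suc)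
    finally show ?thesis by simp
  qed
  then show "norm_op (lam u) = norm_op u" "lam (norm_op u) = norm_op u"
    using assms by (simp_all add: norm_op_V[of _ n] funpow_swap1 lmap_sum[OF lmap_lam])
qed

lemma norm_lam_pow: "u \<in> V n \<Longrightarrow> norm_op ((lam ^^ k) u) = norm_op u"
  "u \<in> V n \<Longrightarrow> (lam ^^ k) (norm_op u) = norm_op u"
  by (induction k) (auto simp: norm_lam[of _ n])

text \<open>The signed cofaces \<open>\<partial>\<^sub>i = (-1)\<^sup>i d\<^sup>i\<close> satisfy \<open>\<lambda> \<partial>\<^sub>i\<^sub>+\<^sub>1 = \<partial>\<^sub>i \<lambda>\<close> and \<open>\<lambda> \<partial>\<^sub>0 = \<partial>\<^sub>n\<^sub>+\<^sub>1\<close> without signs.\<close>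

definition pd :: "nat \<Rightarrow> pbwT \<Rightarrow> pbwT" where
  "pd i u = scale ((-1) ^ i) (cf i u)"

lemma lmap_pd: "lmap (pd i)"
  unfolding pd_def[abs_def] by (intro lmap_intros)

lemma pd_closed [simp]: "u \<in> V n \<Longrightarrow> pd i u \<in> V (Suc n)"
  by (simp add: pd_def)

lemma lam_pd_0: "w \<in> V n \<Longrightarrow> lam (pd 0 w) = pd (Suc n) w"
  by (simp add: pd_def lam_V[of _ "Suc n"] cycT_cf_0)

lemma lam_pd_Suc: "w \<in> V n \<Longrightarrow> i \<le> n \<Longrightarrow> lam (pd (Suc i) w) = pd i (lam w)"
  by (simp add: pd_def lam_V[of _ "Suc n"] lam_V[of _ n] cycT_cf_Suc mult.commute)

lemma bo_pd:
  assumes "u \<in> V n"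
  shows "bo hK u = (\<Sum>i\<le>Suc n. pd i u)" "bo 0 u = (\<Sum>i\<le>n. pd i u)"
  using bo_sum[OF assms] by (simp_all add: pd_def)

text \<open>By the rules for \<open>pd\<close>, \<lambda> b u is the last signed coface of u plus b'
  \<lambda> u, and that last coface is b u - b' u.\<close>

lemma lam_bo:
  assumes "u \<in> V n"
  shows "bo hK u - lam (bo hK u) = bo 0 (u - lam u)"
proof -
  have "lam (bo hK u) = lam (pd 0 u) + (\<Sum>i\<le>n. lam (pd (Suc i) u))"
    by (simp only: bo_pd[OF assms] lmap_sum[OF lmap_lam] sum.atMost_Suc_shift lam_simps)
  also have "\<dots> = pd (Suc n) u + (\<Sum>i\<le>n. pd i (lam u))"
    using assms by (simp add: lam_pd_0 lam_pd_Suc)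
  also have "\<dots> = bo hK u - bo 0 u + bo 0 (lam u)"
    using assms by (simp add: bo_pd[of _ n])
  finally show ?thesis by simp
qed

lemma pd_0_lam_pow: "w \<in> V n \<Longrightarrow> k \<le> Suc n \<Longrightarrow> pd 0 ((lam ^^ k) w) = (lam ^^ k) (pd k w)"
proof -
  have "w \<in> V n \<Longrightarrow> i + k \<le> Suc n \<Longrightarrow> pd i ((lam ^^ k) w) = (lam ^^ k) (pd (i + k) w)" for i
  proof (induction k arbitrary: w)
    case (Suc k)
    have "pd i ((lam ^^ Suc k) w) = pd i ((lam ^^ k) (lam w))"
      by (simp add: funpow_swap1)
    also have "\<dots> = (lam ^^ k) (pd (i + k) (lam w))"
      using Suc.prems by (intro Suc.IH) auto
    also have "\<dots> = (lam ^^ k) (lam (pd (Suc (i + k)) w))"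
      using Suc.prems by (simp add: lam_pd_Suc)
    also have "\<dots> = (lam ^^ Suc k) (pd (i + Suc k) w)"
      by (simp add: funpow_swap1)
    finally show ?case .
  qed simp
  from this[of 0] show "w \<in> V n \<Longrightarrow> k \<le> Suc n \<Longrightarrow> pd 0 ((lam ^^ k) w) = (lam ^^ k) (pd k w)" by simp
qed

text \<open>Both sides equal the norm of \<open>pd 0\<close> applied to the norm of
  \<open>u\<close>: all signed cofaces are \<lambda>-translates of the first one.\<close>

lemma norm_bo:
  assumes "u \<in> V n"
  shows "norm_op (bo 0 u) = bo hK (norm_op u)"
proof -
  let ?m = "norm_op (pd 0 (norm_op u))"
  have "norm_op (pd k u) = norm_op (pd 0 ((lam ^^ k) u))" if "k \<le> n" for k
    using that assms by (simp add: pd_0_lam_pow norm_lam_pow[of _ "Suc n"])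
  then have "norm_op (bo 0 u) = (\<Sum>k\<le>n. norm_op (pd 0 ((lam ^^ k) u)))"
    using assms by (simp add: bo_pd lmap_sum[OF lmap_norm_op])
  also have "\<dots> = ?m"
    using assms by (simp add: norm_op_V[of u n] lmap_sum[OF lmap_pd] lmap_sum[OF lmap_norm_op])
  finally have 1: "norm_op (bo 0 u) = ?m" .
  let ?w = "norm_op u"
  have w: "?w \<in> V n" using assms by simp
  \<comment> \<open>The operator \<lambda> fixes \<open>?w\<close> and has period n + 2 in degree n
    + 1, so \<open>pd k ?w\<close> is a translate of \<open>pd 0 ?w\<close>.\<close>
  have "pd k ?w = (lam ^^ (Suc (Suc n) - k)) (pd 0 ?w)" if "k \<le> Suc n" for k
  proof -
    have "pd k ?w = (lam ^^ (Suc (Suc n) - k)) ((lam ^^ k) (pd k ?w))"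
      using that lam_pow[OF pd_closed[OF w, of k]] by (simp add: funpow_add[symmetric, THEN fun_cong, unfolded o_apply] del: funpow.simps)
    also have "(lam ^^ k) (pd k ?w) = pd 0 ((lam ^^ k) ?w)"
      using that w by (simp add: pd_0_lam_pow)
    also have "(lam ^^ k) ?w = ?w"
      using assms by (simp add: norm_lam_pow)
    finally show ?thesis .
  qed
  then have "bo hK ?w = (\<Sum>k\<le>Suc n. (lam ^^ (Suc (Suc n) - k)) (pd 0 ?w))"
    unfolding bo_pd(1)[OF w] by (rule sum.cong[OF refl]) (simp del: funpow.simps)
  \<comment> \<open>The exponents n + 2 - k run through 1, ..., n + 2; the sum is \<lambda> applied
    to a norm, and norms are invariant.\<close>
  also have "\<dots> = (\<Sum>k\<le>Suc n. (lam ^^ Suc k) (pd 0 ?w))"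
    by (rule sum.reindex_bij_witness[of _ "\<lambda>k. Suc n - k" "\<lambda>k. Suc n - k"]) (auto simp: Suc_diff_le simp del: funpow.simps)
  also have "\<dots> = lam ?m"
    using w by (simp add: norm_op_V[of "pd 0 ?w" "Suc n"] lmap_sum[OF lmap_lam] del: sum.atMost_Suc)
  also have "\<dots> = ?m"
    using w by (intro norm_lam(2)[of _ "Suc n"]) simp
  finally show ?thesis using 1 by simp
qed

lemma norm_diff: "u \<in> V n \<Longrightarrow> norm_op (u - lam u) = 0" "u \<in> V n \<Longrightarrow> norm_op u - lam (norm_op u) = 0"
  by (simp_all add: norm_lam[of _ n])

subsection \<open>Acyclicity of the odd columns\<close>

text \<open>The counit on the last factor. As b' omits the coface that appends K, only the doubling
  of the last factor is undone, which makes this a contraction up to sign.\<close>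

fun contrB :: "pbw list \<Rightarrow> pbwT" where
  "contrB [] = 0"
| "contrB [x] = D 0 (basis x)"
| "contrB (x # y # ys) = basis x \<triangleright> contrB (y # ys)"

definition contr :: "pbwT \<Rightarrow> pbwT" where
  "contr = lin contrB"

lemma lmap_contr: "lmap contr"
  by (simp add: contr_def lmap_lin)

lemmas contr_simps [simp] = lmap_simps[OF lmap_contr]
lemmas lmap_contrI [lmap_intros] = lmap_comp[OF lmap_contr]

lemma contr_tcons: "u \<in> V (Suc n) \<Longrightarrow> contr (a \<triangleright> u) = a \<triangleright> contr u"
proof -
  assume u: "u \<in> V (Suc n)"
  have 1: "contr (basis x \<triangleright> u) = basis x \<triangleright> contr u" for x
    by (rule supp_in_eqI[OF u]) (auto simp: tensor_basis contr_def length_Suc_conv intro!: lmap_intros)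
  show ?thesis
    by (rule lmap_eqI[of _ _ a]) (auto simp: 1 intro!: lmap_intros)
qed

lemma contr_single: "contr (a \<triangleright> basis []) = D 0 a"
  by (rule lmap_eqI[of _ _ a]) (auto simp: tensor_basis contr_def intro!: lmap_intros)

lemma contr_closed [simp]: "u \<in> V (Suc n) \<Longrightarrow> contr u \<in> V n"
proof -
  have "contrB bs \<in> V (length bs - 1)" for bs
    by (induction bs rule: contrB.induct) (use D_closed[of 0] in auto)
  from this have "length bs = Suc n \<Longrightarrow> contrB bs \<in> V n" for bs
    by (metis diff_Suc_1)
  then show "u \<in> V (Suc n) \<Longrightarrow> contr u \<in> V n"
    unfolding contr_def by (rule_tac supp_in_lin) auto
qed

text \<open>Doubling the last factor and then applying the counit is the identity, which accounts
  for the extra term; earlier cofaces commute with the counit.\<close>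

lemma contr_bet: "u \<in> V (Suc n) \<Longrightarrow> contr (bet 0 u) = bet 0 (contr u) + scale ((-1) ^ n) u"
proof (induction n arbitrary: u)
  case 0
  then show ?case
  proof (rule V_Suc_eqI)
    fix a and v :: "pbwT" assume "v \<in> V 0"
    then show "contr (bet 0 (a \<triangleright> v)) = bet 0 (contr (a \<triangleright> v)) + scale ((-1) ^ 0) (a \<triangleright> v)"
    proof (rule V_0_eqI)
      have p: "pair_lin (\<lambda>a b. a \<triangleright> D 0 b) (a \<triangleright> b \<triangleright> basis []) = a \<triangleright> D 0 b" for a b
        by (rule pair_lin_tcons) (auto intro!: lmap_intros)
      have "contr (D 2 a) = pair_lin (\<lambda>a b. a \<triangleright> D 0 b) (D 2 a)"
        by (rule V_2_eqI[OF D_closed]) (auto intro!: lmap_intros simp: p contr_tcons[of _ 0] contr_single)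
      then have "contr (D 2 a) = a \<triangleright> basis []"
        using D_Suc_pair[of 0 a] D_Suc_0[of a] by simp
      moreover have "bet 0 (D 0 a) = 0"
        by (subst D_0) simp
      ultimately show "contr (bet 0 (a \<triangleright> basis [])) = bet 0 (contr (a \<triangleright> basis [])) + scale ((-1) ^ 0) (a \<triangleright> basis [])"
        by (simp add: contr_single)
    qed (auto intro!: lmap_intros)
  qed (auto intro!: lmap_intros)
next
  case (Suc n)
  from Suc.prems show ?case
  proof (rule V_Suc_eqI)
    fix a and v :: "pbwT" assume v: "v \<in> V (Suc n)"
    have "contr (z \<bowtie> v) = z \<bowtie> contr v" if "z \<in> V 2" for z
      using that v by (rule_tac V_2_eqI) (auto intro!: lmap_intros simp: tcons_tconc contr_tcons[of _ "Suc n"] contr_tcons[of _ n])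
    then show "contr (bet 0 (a \<triangleright> v)) = bet 0 (contr (a \<triangleright> v)) + scale ((-1) ^ Suc n) (a \<triangleright> v)"
      using v by (simp add: contr_tcons[of _ n] contr_tcons[of _ "Suc n"] Suc.IH)
  qed (auto intro!: lmap_intros)
qed

lemma bo_0_exact_Suc:
  assumes "u \<in> V (Suc n)" "bo 0 u = 0"
  shows "\<exists>v\<in>V n. bo 0 v = u"
proof -
  have "contr (bo 0 u) = bo 0 (contr u) - scale ((-1) ^ n) u"
    using assms(1) by (simp add: bo_def contr_bet contr_tcons[of _ n])
  then have "bo 0 (scale ((-1) ^ n) (contr u)) = u"
    using assms(2) by (simp add: power_mult_distrib[symmetric])
  then show ?thesis using assms(1) by (intro bexI[of _ "scale ((-1) ^ n) (contr u)"]) auto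
qed

end

section \<open>Hochschild cohomology\<close>

text \<open>As a coalgebra, the quantum group is that of a category on \<open>\<int>\<close>: the monomial \<open>b\<close> is
  an arrow from \<open>src b\<close> to \<open>tgt b\<close>, powers of \<open>K\<close> are the identities, and \<open>\<Delta>\<close> runs over
  factorizations.\<close>

definition src :: "pbw \<Rightarrow> int" where "src b = (case b of (j, i, n) \<Rightarrow> n - int j)"
definition tgt :: "pbw \<Rightarrow> int" where "tgt b = (case b of (j, i, n) \<Rightarrow> n + int i)"
definition idt :: "int \<Rightarrow> pbw" where "idt g = (0, 0, g)"

lemma src_tgt_simps [simp]:
  "src (j, i, n) = n - int j" "tgt (j, i, n) = n + int i" "src (idt g) = g" "tgt (idt g) = g"
  by (simp_all add: src_def tgt_def idt_def)

lemma src_le_tgt: "src b \<le> tgt b"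
  by (cases b) auto

lemma src_eq_tgt: "src b = tgt b \<longleftrightarrow> b = idt (src b)"
  by (cases b) (auto simp: idt_def)

definition factors :: "pbw \<Rightarrow> pbw list set" where
  "factors b = {[x, y] | x y. src x = src b \<and> tgt x = src y \<and> tgt y = tgt b \<and> src x \<noteq> tgt x \<and> src y \<noteq> tgt y}"

context quantum
begin

lemma D_2_idt: "D 2 (basis (idt g)) = basis [idt g, idt g]"
proof -
  have "D 2 (basis (0, 0, g)) = basis [(0, 0, g), (0, 0, g)]"
  proof (induction g rule: int_induct[where k = 0])
    case base
    show ?case by (simp add: numeral_2_eq_2 tensor_basis)
  next
    case (step1 g)
    have "D 2 (act gK (basis (0, 0, g))) = basis [(0, 0, g + 1), (0, 0, g + 1)]"
      by (simp only: D_act step1) (simp add: numeral_2_eq_2 tmul_tcons tensor_basis[symmetric] hg_star)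
    then show ?case by simp
  next
    case (step2 g)
    have "D 2 (act gKi (basis (0, 0, g))) = basis [(0, 0, g - 1), (0, 0, g - 1)]"
      by (simp only: D_act step2) (simp add: numeral_2_eq_2 tmul_tcons tensor_basis[symmetric] hg_star)
    then show ?case by simp
  qed
  then show ?thesis by (simp add: idt_def)
qed

text \<open>Coefficient 1 is asserted for the two trivial factorizations only; the others, which may
  vanish at roots of unity, are left open. The set \<open>A\<close> strengthens the induction for
  powers of E.\<close>

definition factorizes :: "pbw \<Rightarrow> pbw list set \<Rightarrow> bool" where
  "factorizes b A \<longleftrightarrow> (\<exists>y\<in>supp_in (factors b \<inter> A).
     D 2 (basis b) = basis [idt (src b), b] + basis [b, idt (tgt b)] + y)"

lemma lin_V2_closed: "z \<in> supp_in A \<Longrightarrow> (\<And>bs. bs \<in> A \<Longrightarrow> u \<bullet> basis bs \<in> supp_in C) \<Longrightarrow> u \<bullet> z \<in> supp_in C"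
  using supp_in_lin[of z A "\<lambda>bs. u \<bullet> basis bs" C] lmap_eq_lin[OF lmap_tmul(2), of u z] by simp

lemma D_2_gF: "Dg 2 gF \<bullet> basis [x, y] = (hKi \<star> basis x) \<triangleright> (hF \<star> basis y) \<triangleright> basis [] + (hF \<star> basis x) \<triangleright> basis [y]"
  by (simp add: numeral_2_eq_2 tmul_tcons tensor_basis[symmetric])

lemma D_2_gE: "Dg 2 gE \<bullet> basis [x, y] = basis x \<triangleright> (hE \<star> basis y) \<triangleright> basis [] + (hE \<star> basis x) \<triangleright> (hK \<star> basis y) \<triangleright> basis []"
  by (simp add: numeral_2_eq_2 tmul_tcons tensor_basis[symmetric])

abbreviation noF :: "pbw list set" where "noF \<equiv> {bs. \<forall>b\<in>set bs. fst b = 0}"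

text \<open>Multiply the coproduct by that of E from the left. As long as no F occurs in the
  factors, E merely raises an exponent and no commutator terms arise; hence the invariant
  \<open>noF\<close>.\<close>

lemma factorizes_E: "factorizes (0, Suc i, n) noF"
proof (induction i)
  case 0
  have "D 2 (act gE (basis (idt n))) = basis [idt n, (0, 1, n)] + basis [(0, 1, n), idt (n + 1)]"
    by (simp only: D_act D_2_idt D_2_gE) (simp add: hg_star idt_def tensor_basis[symmetric])
  then show ?case unfolding factorizes_def by (intro bexI[of _ 0]) (auto simp: idt_def)
next
  case (Suc i)
  let ?b = "(0, Suc i, n) :: pbw" and ?c = "(0, Suc (Suc i), n) :: pbw"
  obtain y where y: "y \<in> supp_in (factors ?b \<inter> noF)"
    "D 2 (basis ?b) = basis [idt n, ?b] + basis [?b, idt (n + 1 + int i)] + y"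
    using Suc unfolding factorizes_def by (auto simp: add_ac)
  have 1: "Dg 2 gE \<bullet> y \<in> supp_in (factors ?c \<inter> noF)"
  proof (rule lin_V2_closed[OF y(1)])
    fix bs assume "bs \<in> factors ?b \<inter> noF"
    then obtain i1 n1 i2 n2 where "bs = [(0, i1, n1), (0, i2, n2)]" "n1 = n" "n1 + int i1 = n2"
      "n2 + int i2 = n + 1 + int i" "i1 \<noteq> 0" "i2 \<noteq> 0"
      unfolding factors_def by auto
    then show "Dg 2 gE \<bullet> basis bs \<in> supp_in (factors ?c \<inter> noF)"
      by (auto simp: D_2_gE hg_star tensor_basis factors_def)
  qed
  \<comment> \<open>Each trivial factorization produces a trivial one of the longer monomial, with
    coefficient 1, and a cross term with two proper factors.\<close>
  have k: "Dg 2 gE \<bullet> basis [idt n, ?b] = basis [idt n, ?c] + scale (Q (int (Suc i))) (basis [(0, 1, n), (0, Suc i, n + 1)])"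
    "Dg 2 gE \<bullet> basis [?b, idt (n + 1 + int i)] = basis [?b, (0, 1, n + 1 + int i)] + basis [?c, idt (n + 2 + int i)]"
    by (simp_all add: D_2_gE hg_star tensor_basis idt_def add_ac)
  have "D 2 (basis ?c) = Dg 2 gE \<bullet> D 2 (basis ?b)"
    using D_act[of 2 gE "basis ?b"] by simp
  also have "\<dots> = basis [idt n, ?c] + basis [?c, idt (n + 2 + int i)] + (Dg 2 gE \<bullet> y
      + (scale (Q (int (Suc i))) (basis [(0, 1, n), (0, Suc i, n + 1)]) + basis [?b, (0, 1, n + 1 + int i)]))"
    by (simp only: y(2) tmul_simps k) (simp add: algebra_simps)
  finally have "D 2 (basis ?c) = basis [idt (src ?c), ?c] + basis [?c, idt (tgt ?c)] + (Dg 2 gE \<bullet> y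
      + (scale (Q (int (Suc i))) (basis [(0, 1, n), (0, Suc i, n + 1)]) + basis [?b, (0, 1, n + 1 + int i)]))"
    by (simp add: algebra_simps)
  moreover have "scale (Q (int (Suc i))) (basis [(0, 1, n), (0, Suc i, n + 1)]) + basis [?b, (0, 1, n + 1 + int i)]
     \<in> supp_in (factors ?c \<inter> noF)"
    by (intro supp_in_simps(2) supp_in_simps(5)) (auto simp: factors_def)
  ultimately show ?case
    unfolding factorizes_def using 1
    by (intro bexI[of _ "Dg 2 gE \<bullet> y + (scale (Q (int (Suc i))) (basis [(0, 1, n), (0, Suc i, n + 1)])
      + basis [?b, (0, 1, n + 1 + int i)])"]) (simp_all only: supp_in_simps)
qed

text \<open>F stands leftmost in a PBW monomial, so multiplying by it never needs reordering; all
  powers of E are therefore built first. For an identity the cross terms would be trivial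
  factorizations themselves, which the second hypothesis excludes.\<close>

lemma factorizes_step:
  assumes "factorizes (j, i, n) UNIV" "j \<noteq> 0 \<or> i \<noteq> 0"
  shows "factorizes (Suc j, i, n) UNIV"
proof -
  let ?b = "(j, i, n) :: pbw" and ?c = "(Suc j, i, n) :: pbw"
  obtain y where y: "y \<in> supp_in (factors ?b)"
    "D 2 (basis ?b) = basis [idt (n - int j), ?b] + basis [?b, idt (n + int i)] + y"
    using assms(1) unfolding factorizes_def by auto
  have 1: "Dg 2 gF \<bullet> y \<in> supp_in (factors ?c)"
  proof (rule lin_V2_closed[OF y(1)])
    fix bs assume "bs \<in> factors ?b"
    then obtain j1 i1 n1 j2 i2 n2 where "bs = [(j1, i1, n1), (j2, i2, n2)]" "n1 - int j1 = n - int j"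
      "n1 + int i1 = n2 - int j2"
      "n2 + int i2 = n + int i" "i1 \<noteq> 0 \<or> j1 \<noteq> 0" "i2 \<noteq> 0 \<or> j2 \<noteq> 0"
      unfolding factors_def by auto
    then show "Dg 2 gF \<bullet> basis bs \<in> supp_in (factors ?c)"
      by (auto simp: D_2_gF hg_star tensor_basis factors_def)
  qed
  let ?r = "basis [(1, 0, n - int j), ?b] + scale (Q (int j - int i)) (basis [(j, i, n - 1), (1, 0, n + int i)])"
  have k: "Dg 2 gF \<bullet> basis [idt (n - int j), ?b] = basis [idt (n - int j - 1), ?c] + basis [(1, 0, n - int j), ?b]"
    "Dg 2 gF \<bullet> basis [?b, idt (n + int i)] = scale (Q (int j - int i)) (basis [(j, i, n - 1), (1, 0, n + int i)]) + basis [?c, idt (n + int i)]"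
    by (simp_all add: D_2_gF hg_star tensor_basis idt_def)
  have "D 2 (basis ?c) = Dg 2 gF \<bullet> D 2 (basis ?b)"
    using D_act[of 2 gF "basis ?b"] by simp
  also have "\<dots> = basis [idt (n - int j - 1), ?c] + basis [?c, idt (n + int i)] + (Dg 2 gF \<bullet> y + ?r)"
    by (simp only: y(2) tmul_simps k) (simp add: algebra_simps)
  finally have "D 2 (basis ?c) = basis [idt (src ?c), ?c] + basis [?c, idt (tgt ?c)] + (Dg 2 gF \<bullet> y + ?r)"
    by (simp add: algebra_simps)
  moreover have "?r \<in> supp_in (factors ?c)"
    using assms(2) by (intro supp_in_simps(2) supp_in_simps(5)) (auto simp: factors_def)
  ultimately show ?thesis
    unfolding factorizes_def using 1 by (intro bexI[of _ "Dg 2 gF \<bullet> y + ?r"]) (simp_all only: supp_in_simps Int_UNIV_right)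
qed

lemma D_2_factors:
  assumes "src b \<noteq> tgt b"
  obtains y where "y \<in> supp_in (factors b)"
    "D 2 (basis b) = basis [idt (src b), b] + basis [b, idt (tgt b)] + y"
proof -
  obtain j i n where b: "b = (j, i, n)" by (cases b)
  have "factorizes (j, i, n) UNIV" if "j \<noteq> 0 \<or> i \<noteq> 0" for j
    using that
  proof (induction j)
    case 0
    then obtain i' where i: "i = Suc i'" by (cases i) auto
    from factorizes_E[of i' n] show ?case
      unfolding factorizes_def i by (auto simp: supp_in_def)
  next
    case (Suc j)
    show ?case
    proof (cases "j \<noteq> 0 \<or> i \<noteq> 0")
      case True
      then show ?thesis using Suc.IH factorizes_step by auto
    next
      case False
      then have ji: "j = 0" "i = 0" by auto
      have "D 2 (act gF (basis (idt n))) = basis [idt (n - 1), (1, 0, n)] + basis [(1, 0, n), idt n]"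
        by (simp only: D_act D_2_idt D_2_gF) (simp add: hg_star idt_def tensor_basis[symmetric])
      then show ?thesis unfolding factorizes_def ji by (intro bexI[of _ 0]) (auto simp: idt_def)
    qed
  qed
  then have "factorizes b UNIV" using assms b by auto
  then show ?thesis using that unfolding factorizes_def by auto
qed

lemma D_2_supp: "D 2 (basis b) \<in> supp_in {[x, y] | x y. src x = src b \<and> tgt x = src y \<and> tgt y = tgt b}"
proof (cases "src b = tgt b")
  case True
  then show ?thesis using D_2_idt[of "src b"] src_eq_tgt[of b] by (auto simp del: split_paired_Ex)
next
  case False
  then obtain y where y: "y \<in> supp_in (factors b)"
    "D 2 (basis b) = basis [idt (src b), b] + basis [b, idt (tgt b)] + y" by (rule D_2_factors)
  have "factors b \<subseteq> {[x, y] | x y. src x = src b \<and> tgt x = src y \<and> tgt y = tgt b}"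
    by (auto simp: factors_def)
  with y(1) have "y \<in> supp_in {[x, y] | x y. src x = src b \<and> tgt x = src y \<and> tgt y = tgt b}"
    by (auto simp: supp_in_def)
  then show ?thesis unfolding y(2) by (auto simp del: split_paired_Ex)
qed

subsection \<open>Tuples that are not composable\<close>

text \<open>The initial object varies because inductions walk along the tuple; the final one is 1,
  the object of \<sigma> = K.\<close>

primrec comp_from :: "int \<Rightarrow> pbw list \<Rightarrow> bool" where
  "comp_from g [] \<longleftrightarrow> g = 1"
| "comp_from g (x # xs) \<longleftrightarrow> src x = g \<and> comp_from (tgt x) xs"

definition mism :: "int \<Rightarrow> pbw list \<Rightarrow> bool" where
  "mism g xs \<longleftrightarrow> (case xs of [] \<Rightarrow> g \<noteq> 1 | y # ys \<Rightarrow> src y \<noteq> g)"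

lemma mism_simps [simp]: "mism g [] \<longleftrightarrow> g \<noteq> 1" "mism g (y # ys) \<longleftrightarrow> src y \<noteq> g"
  by (simp_all add: mism_def)

text \<open>A tuple of arrows from \<open>0\<close> to \<open>1\<close> has a first position where targets and sources do not
  match, unless it is composable. The cofaces preserve this mismatch, and removing an identity arrow
  in front of it is a contracting homotopy.\<close>

primrec hhB :: "pbw list \<Rightarrow> int \<Rightarrow> pbwT" where
  "hhB [] g = 0"
| "hhB (x # xs) g = (if src x \<noteq> g then 0 else if x = idt g \<and> mism g xs then basis xs
     else - (basis x \<triangleright> hhB xs (tgt x)))"

definition hh :: "int \<Rightarrow> pbwT \<Rightarrow> pbwT" where
  "hh g = lin (\<lambda>xs. hhB xs g)"

lemma lmap_hh: "lmap (hh g)"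
  by (simp add: hh_def lmap_lin)

lemmas hh_simps [simp] = lmap_simps[OF lmap_hh]
lemmas lmap_hhI [lmap_intros] = lmap_comp[OF lmap_hh]

lemma hh_basis [simp]: "hh g (basis xs) = hhB xs g"
  by (simp add: hh_def)

lemma hh_zero: "u \<in> supp_in {y # ys | y ys. src y \<noteq> g} \<Longrightarrow> hh g u = 0"
  by (rule supp_in_eqI[of u _ "hh g" "\<lambda>u. 0"]) (auto intro!: lmap_intros)

lemma hh_proper:
  assumes "src x = g" "x \<noteq> idt g"
  shows "hh g (basis x \<triangleright> u) = - (basis x \<triangleright> hh (tgt x) u)"
  by (rule lmap_eqI[of _ _ u]) (auto intro!: lmap_intros simp: tensor_basis assms)

lemma hh_idt_mism: "u \<in> supp_in {xs. mism g xs} \<Longrightarrow> hh g (basis (idt g) \<triangleright> u) = u"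
  by (rule supp_in_eqI[of u]) (auto intro!: lmap_intros simp: tensor_basis)

lemma hh_idt_match: "u \<in> supp_in {xs. \<not> mism g xs} \<Longrightarrow> hh g (basis (idt g) \<triangleright> u) = - (basis (idt g) \<triangleright> hh g u)"
  by (rule supp_in_eqI[of u]) (auto intro!: lmap_intros simp: tensor_basis)

lemma tensor_supp:
  assumes "u \<in> supp_in A"
  shows "basis x \<triangleright> u \<in> supp_in {x # xs | xs. xs \<in> A}"
  unfolding tcons_def lin_basis by (rule supp_in_lin[OF assms]) auto

lemma supp_in_mono: "u \<in> supp_in A \<Longrightarrow> A \<subseteq> C \<Longrightarrow> u \<in> supp_in C"
  by (auto simp: supp_in_def)

lemma conc_basis_supp:
  assumes "z \<in> supp_in A"
  shows "z \<bowtie> basis ys \<in> supp_in {xs @ ys | xs. xs \<in> A}"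
  unfolding tconc_def lin_basis by (rule supp_in_lin[OF assms]) auto

lemma bet_basis: "bet hK (basis (x # xs)) = D 2 (basis x) \<bowtie> basis xs - basis x \<triangleright> bet hK (basis xs)"
  using bet_tcons[of hK "basis x" "basis xs"] by (simp only: tensor_basis)

lemma bet_supp_src: "bet hK (basis (x # xs)) \<in> supp_in {y # ys | y ys. src y = src x}"
proof -
  have "D 2 (basis x) \<bowtie> basis xs \<in> supp_in {y # ys | y ys. src y = src x}"
    by (rule supp_in_mono[OF conc_basis_supp[OF D_2_supp]]) auto
  moreover have "basis x \<triangleright> bet hK (basis xs) \<in> supp_in {y # ys | y ys. src y = src x}"
    by (rule supp_in_mono[OF tensor_supp[of _ UNIV]]) (auto simp: supp_in_def simp del: split_paired_Ex)
  ultimately show ?thesis unfolding bet_basis by (rule supp_in_simps(3))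
qed

lemma hK_eq: "hK = basis (idt 1)"
  by (simp add: hg.simps idt_def)

lemma bet_mism: "mism g xs \<Longrightarrow> bet hK (basis xs) \<in> supp_in {xs. mism g xs}"
proof (cases xs)
  case Nil
  then show "mism g xs \<Longrightarrow> ?thesis" by (simp add: hK_eq tensor_basis)
next
  case (Cons x ys)
  then show "mism g xs \<Longrightarrow> ?thesis" using bet_supp_src[of x ys] by (auto intro: supp_in_mono)
qed

lemma bet_match: "\<not> mism g xs \<Longrightarrow> bet hK (basis xs) \<in> supp_in {xs. \<not> mism g xs}"
proof (cases xs)
  case Nil
  then show "\<not> mism g xs \<Longrightarrow> ?thesis" by (simp add: hK_eq tensor_basis)
next
  case (Cons x ys)
  then show "\<not> mism g xs \<Longrightarrow> ?thesis" using bet_supp_src[of x ys] by (auto intro: supp_in_mono)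
qed

definition bfrom :: "int \<Rightarrow> pbwT \<Rightarrow> pbwT" where
  "bfrom g u = basis (idt g) \<triangleright> u - bet hK u"

lemma bo_bfrom: "bo hK = bfrom 0"
  by (auto simp: bo_def bfrom_def idt_def)

lemma lmap_bfrom: "lmap (bfrom g)"
  unfolding bfrom_def[abs_def] by (intro lmap_intros)

lemmas bfrom_simps [simp] = lmap_simps[OF lmap_bfrom]

lemma bfrom_idt: "bfrom g (basis (idt g) \<triangleright> u) = basis (idt g) \<triangleright> bet hK u"
  by (simp add: bfrom_def D_2_idt tensor_basis[symmetric] tcons_tconc)

lemma bfrom_proper:
  assumes "D 2 (basis x) = basis [idt (src x), x] + basis [x, idt (tgt x)] + y"
  shows "bfrom (src x) (basis x \<triangleright> u) = - (basis x \<triangleright> bfrom (tgt x) u) - y \<bowtie> u"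
  by (simp add: bfrom_def assms tensor_basis[symmetric] tcons_tconc)

text \<open>Induction along the tuple up to its first mismatch. For a proper arrow x, the term 1 (x)
  x of its coproduct cancels d^0 and x (x) 1 acts as d^0 of the tail, so the homotopy of the tail
  reappears with two signs that compensate.\<close>

lemma hh_homotopy: "\<not> comp_from g xs \<Longrightarrow> bfrom g (hhB xs g) + hh g (bfrom g (basis xs)) = basis xs"
proof (induction xs arbitrary: g)
  case Nil
  then show ?case by (simp add: bfrom_def hK_eq tensor_basis)
next
  case (Cons x ys)
  show ?case
  proof (cases "src x = g")
    case False
    \<comment> \<open>The mismatch is at the very front: only d^0 yields a tuple starting at
      \<open>g\<close>, and the homotopy removes the identity just inserted.\<close>
    have "bet hK (basis (x # ys)) \<in> supp_in {y # ys | y ys. src y \<noteq> g}"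
      using bet_supp_src[of x ys] False by (auto intro: supp_in_mono)
    then have "hh g (bet hK (basis (x # ys))) = 0" by (rule hh_zero)
    then show ?thesis using False by (simp add: bfrom_def tensor_basis)
  next
    case src: True
    then have nc: "\<not> comp_from (tgt x) ys" using Cons.prems by simp
    show ?thesis
    proof (cases "x = idt g")
      case True
      have b: "bfrom g (basis (x # ys)) = basis (idt g) \<triangleright> bet hK (basis ys)"
        using bfrom_idt[of g "basis ys"] True by (simp add: tensor_basis)
      show ?thesis
      proof (cases "mism g ys")
        case m: True
        have "hh g (basis (idt g) \<triangleright> bet hK (basis ys)) = bet hK (basis ys)"
          by (rule hh_idt_mism[OF bet_mism[OF m]])
        then show ?thesis
          unfolding b using True m by (simp add: bfrom_def tensor_basis)
      next
        case m: False
        have "hh g (basis (idt g) \<triangleright> bet hK (basis ys)) = - (basis (idt g) \<triangleright> hh g (bet hK (basis ys)))"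
          by (rule hh_idt_match[OF bet_match[OF m]])
        moreover have "bfrom g (hhB ys g) + hh g (bfrom g (basis ys)) = basis ys"
          using Cons.IH[of g] nc True by simp
        moreover have "ys \<noteq> [] \<Longrightarrow> hh g (basis (idt g) \<triangleright> basis ys) = - (basis (idt g) \<triangleright> hhB ys g)"
          using hh_idt_match[of "basis ys" g] m by simp
        moreover have "ys \<noteq> []" using m nc True by auto
        ultimately have e: "hh g (bet hK (basis ys)) = - (basis (idt g) \<triangleright> hhB ys g) - basis ys + bfrom g (hhB ys g)"
          by (simp add: bfrom_def[of g "basis ys"] algebra_simps)
        have "bfrom g (hhB (x # ys) g) = - (basis (idt g) \<triangleright> bet hK (hhB ys g))"
          using True m by (simp add: bfrom_idt)
        moreover have "hh g (bfrom g (basis (x # ys))) = basis (idt g) \<triangleright> (basis (idt g) \<triangleright> hhB ys g + basis ys - bfrom g (hhB ys g))"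
          unfolding b hh_idt_match[OF bet_match[OF m]] e by (simp add: algebra_simps)
        ultimately show ?thesis using True by (simp add: bfrom_def tensor_basis)
      qed
    next
      case False
      then have "src x \<noteq> tgt x" using src src_eq_tgt[of x] by auto
      then obtain y where y: "y \<in> supp_in (factors x)"
        "D 2 (basis x) = basis [idt (src x), x] + basis [x, idt (tgt x)] + y" by (rule D_2_factors)
      let ?t = "tgt x"
      \<comment> \<open>Proper factorizations put two proper arrows in front; passing both gives no
        sign, and the object reached is still \<open>?t\<close>.\<close>
      have hy: "hh g (y \<bowtie> basis ys) = y \<bowtie> hhB ys ?t"
      proof (rule supp_in_eqI[OF y(1)])
        fix bs assume "bs \<in> factors x"
        then obtain p r where bs: "bs = [p, r]" "src p = src x" "tgt p = src r" "tgt r = tgt x"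
          "src p \<noteq> tgt p" "src r \<noteq> tgt r"
          unfolding factors_def by (auto simp del: split_paired_Ex)
        then have pr: "p \<noteq> idt (src x)" "r \<noteq> idt (src r)"
          by (metis src_tgt_simps(3,4))+
        have "hh g (basis bs \<bowtie> basis ys) = hh g (basis p \<triangleright> basis r \<triangleright> basis ys)"
          by (simp add: bs tensor_basis)
        also have "\<dots> = basis p \<triangleright> basis r \<triangleright> hhB ys ?t"
          using bs pr src by (simp add: hh_proper del: hh_basis) simp
        finally show "hh g (basis bs \<bowtie> basis ys) = basis bs \<bowtie> hhB ys ?t"
          by (simp add: bs tensor_basis(1)[symmetric] tcons_tconc)
      qed (auto intro!: lmap_intros)
      have b: "bfrom g (basis x \<triangleright> u) = - (basis x \<triangleright> bfrom ?t u) - y \<bowtie> u" for u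
        using bfrom_proper[OF y(2)] src by simp
      have h: "hhB (x # ys) g = - (basis x \<triangleright> hhB ys ?t)"
        using src False by simp
      have "hh g (bfrom g (basis (x # ys))) = basis x \<triangleright> hh ?t (bfrom ?t (basis ys)) - y \<bowtie> hhB ys ?t"
        unfolding tensor_basis(1)[symmetric] b using hy src False by (simp add: hh_proper)
      moreover have "bfrom g (hhB (x # ys) g) = basis x \<triangleright> bfrom ?t (hhB ys ?t) + y \<bowtie> hhB ys ?t"
        unfolding h by (simp add: b)
      ultimately have "bfrom g (hhB (x # ys) g) + hh g (bfrom g (basis (x # ys)))
        = basis x \<triangleright> (bfrom ?t (hhB ys ?t) + hh ?t (bfrom ?t (basis ys)))"
        by simp
      then show ?thesis using Cons.IH[OF nc] by (simp add: tensor_basis)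
    qed
  qed
qed

subsection \<open>Composable tuples\<close>

lemma comp_from_le: "comp_from g xs \<Longrightarrow> g \<le> 1"
proof (induction xs arbitrary: g)
  case (Cons x xs)
  then show ?case using src_le_tgt[of x] by fastforce
qed simp

lemma comp_from_1: "comp_from 1 xs \<Longrightarrow> xs = replicate (length xs) (idt 1)"
proof (induction xs)
  case (Cons x xs)
  then have "tgt x = src x" using src_le_tgt[of x] comp_from_le[of "tgt x" xs] by simp
  then show ?case using Cons src_eq_tgt[of x] by simp
qed simp

text \<open>All arrows from 0 to 1: \<open>n = j\<close> and \<open>n + i = 1\<close> leave only E
  and F K.\<close>

abbreviation X_set :: "pbw set" where "X_set \<equiv> {(0, 1, 0), (1, 0, 1)}"

definition chain :: "pbw \<Rightarrow> nat \<Rightarrow> nat \<Rightarrow> pbw list" where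
  "chain X a c = replicate a (idt 0) @ X # replicate c (idt 1)"

lemma comp_from_0: "comp_from 0 xs \<longleftrightarrow> (\<exists>X\<in>X_set. \<exists>a c. xs = chain X a c)"
proof
  show "comp_from 0 xs \<Longrightarrow> \<exists>X\<in>X_set. \<exists>a c. xs = chain X a c"
  proof (induction xs)
    case (Cons x xs)
    then have x: "src x = 0" "comp_from (tgt x) xs" by auto
    then have "tgt x = 0 \<or> tgt x = 1"
      using src_le_tgt[of x] comp_from_le[of "tgt x" xs] by auto
    then show ?case
    proof
      assume t: "tgt x = 0"
      then have xx: "x = idt 0" using src_eq_tgt[of x] x by simp
      have "comp_from 0 xs" using x t by simp
      then obtain X a c where "X \<in> X_set" "xs = chain X a c" using Cons.IH by blast
      then have "X \<in> X_set" "x # xs = chain X (Suc a) c" by (auto simp: chain_def xx)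
      then show ?thesis by blast
    next
      assume t: "tgt x = 1"
      then have "x \<in> X_set" using x(1) by (cases x) auto
      moreover have "x # xs = chain x 0 (length xs)"
        using comp_from_1[of xs] x t by (simp add: chain_def)
      ultimately show ?thesis by blast
    qed
  qed simp
  have 1: "comp_from 1 (replicate c (idt 1))" for c
    by (induction c) auto
  have "X \<in> X_set \<Longrightarrow> comp_from 0 (chain X a c)" for X a c
    using 1 by (induction a) (auto simp: chain_def)
  then show "\<exists>X\<in>X_set. \<exists>a c. xs = chain X a c \<Longrightarrow> comp_from 0 xs" by auto
qed

lemma comp_from_0_cases:
  assumes "comp_from 0 xs"
  obtains X a c where "X \<in> X_set" "xs = chain X a c"
proof -
  have "\<exists>X\<in>X_set. \<exists>a c. xs = chain X a c" using assms by (simp only: comp_from_0)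
  then show ?thesis using that by blast
qed

text \<open>Every coface lengthens the run of identities by one, so c + 1 equal terms with
  alternating signs are added.\<close>

lemma bet_replicate: "bet hK (basis (replicate c (idt 1))) = (if even c then basis (replicate (Suc c) (idt 1)) else 0)"
proof (induction c)
  case (Suc c)
  have "bet hK (basis (replicate (Suc c) (idt 1)))
      = basis (idt 1 # idt 1 # replicate c (idt 1)) - basis (idt 1) \<triangleright> bet hK (basis (replicate c (idt 1)))"
    by (simp add: bet_basis D_2_idt tensor_basis)
  also have "\<dots> = (if even (Suc c) then basis (replicate (Suc (Suc c)) (idt 1)) else 0)"
    unfolding Suc by (simp add: tensor_basis)
  finally show ?case .
qed (simp add: hK_eq tensor_basis)

lemma D_2_X: "X \<in> X_set \<Longrightarrow> D 2 (basis X) = basis [idt 0, X] + basis [X, idt 1]"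
proof -
  have "D 2 (act gF hK) = one_H \<triangleright> act gF hK \<triangleright> basis [] + act gF hK \<triangleright> hK \<triangleright> basis []"
    by (simp only: D_act D_hg Dg_2 Dg.simps(1) D_2[simplified D_hg] tmul_simps)
      (simp only: numeral_2_eq_2 tpow.simps tmul_tcons hg_rels(6) star_one tmul_Nil, simp only: hg_star)
  from this[unfolded hg.simps] D_2(1)[unfolded hg.simps]
  show "X \<in> X_set \<Longrightarrow> ?thesis"
    by (auto simp: tensor_basis idt_def)
qed

lemma bet_chain:
  assumes "X \<in> X_set"
  shows "bet hK (basis (chain X a c)) = (if even a then basis (chain X (Suc a) c) else 0)
     + (if odd c then scale ((-1) ^ a) (basis (chain X a (Suc c))) else 0)"
proof (induction a)
  case 0
  have "bet hK (basis (chain X 0 c)) = basis (chain X 1 c) + basis (chain X 0 (Suc c))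
      - basis X \<triangleright> bet hK (basis (replicate c (idt 1)))"
    by (simp add: chain_def bet_basis D_2_X[OF assms] tensor_basis)
  then show ?case by (simp add: bet_replicate tensor_basis chain_def)
next
  case (Suc a)
  have "bet hK (basis (chain X (Suc a) c)) = basis (chain X (Suc (Suc a)) c)
      - basis (idt 0) \<triangleright> bet hK (basis (chain X a c))"
    by (simp add: chain_def bet_basis D_2_idt tensor_basis)
  also have "basis (idt 0) \<triangleright> bet hK (basis (chain X a c)) = (if even a then basis (chain X (Suc (Suc a)) c) else 0)
     + (if odd c then scale ((-1) ^ a) (basis (chain X (Suc a) (Suc c))) else 0)"
    unfolding Suc by (simp add: chain_def tensor_basis)
  finally show ?case by simp
qed

text \<open>The two runs of identities contribute separately: from a to a + 1 the map is zero for
  even a and an isomorphism for odd a, and likewise for c up to sign. Hence only a = c = 0 can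
  survive.\<close>

lemma bo_chain:
  assumes "X \<in> X_set"
  shows "bo hK (basis (chain X a c)) = (if odd a then basis (chain X (Suc a) c) else 0)
     - (if odd c then scale ((-1) ^ a) (basis (chain X a (Suc c))) else 0)"
proof -
  have "one_H \<triangleright> basis (chain X a c) = basis (chain X (Suc a) c)"
    by (simp add: tensor_basis chain_def idt_def)
  then show ?thesis by (simp add: bo_def bet_chain[OF assms])
qed

definition lead :: "pbw list \<Rightarrow> nat" where
  "lead xs = length (takeWhile (\<lambda>x. x = idt 0) xs)"

text \<open>Inverts the differential at one end: at the leading identities if there are any,
  otherwise at the trailing ones. Without leading identities, odd length above 1 means that the
  number of trailing ones is even and positive.\<close>

definition hcB :: "pbw list \<Rightarrow> pbwT" where
  "hcB xs = (if \<not> comp_from 0 xs then 0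
     else if lead xs > 0 then (if even (lead xs) then basis (tl xs) else 0)
     else if odd (length xs) \<and> length xs > 1 then - basis (butlast xs) else 0)"

lemma lead_chain: "X \<in> X_set \<Longrightarrow> lead (chain X a c) = a"
  by (induction a) (auto simp: lead_def chain_def idt_def)

lemma hcB_chain:
  assumes "X \<in> X_set"
  shows "hcB (chain X a c) = (if a > 0 then (if even a then basis (chain X (a - 1) c) else 0)
     else if even c \<and> c > 0 then - basis (chain X 0 (c - 1)) else 0)"
proof -
  have "comp_from 0 (chain X a c)" using comp_from_0 assms by blast
  moreover have "tl (chain X (Suc b) c) = chain X b c" for b by (simp add: chain_def)
  moreover have "butlast (chain X 0 (Suc d)) = chain X 0 d" for d
    by (simp add: chain_def butlast_append replicate_append_same[symmetric] del: replicate_Suc)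
       (simp add: replicate_append_same[symmetric])
  ultimately show ?thesis
    using lead_chain[OF assms, of a c]
    by (cases a; cases c) (auto simp: hcB_def chain_def[of X 0] simp flip: chain_def)
qed

definition hc :: "pbwT \<Rightarrow> pbwT" where
  "hc = lin hcB"

lemma lmap_hc: "lmap hc"
  by (simp add: hc_def lmap_lin)

lemmas hc_simps [simp] = lmap_simps[OF lmap_hc]
lemmas lmap_hcI [lmap_intros] = lmap_comp[OF lmap_hc]

lemma hc_basis [simp]: "hc (basis xs) = hcB xs"
  by (simp add: hc_def)

lemma hc_homotopy:
  assumes "X \<in> X_set"
  shows "bo hK (hcB (chain X a c)) + hc (bo hK (basis (chain X a c)))
     = (if a = 0 \<and> c = 0 then 0 else basis (chain X a c))"
proof -
  consider "a = 0" "c = 0" | "a = 0" "c > 0" | b where "a = Suc b" by (cases a) auto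
  then show ?thesis
  proof cases
    case 1
    then show ?thesis by (simp add: bo_chain[OF assms] hcB_chain[OF assms])
  next
    case 2
    then obtain d where d: "c = Suc d" by (cases c) auto
    then show ?thesis using 2 by (simp add: bo_chain[OF assms] hcB_chain[OF assms])
  next
    case 3
    then show ?thesis by (simp add: bo_chain[OF assms] hcB_chain[OF assms])
  qed
qed

lemma hhB_comp: "comp_from g xs \<Longrightarrow> hhB xs g = 0"
proof (induction xs arbitrary: g)
  case (Cons x xs)
  have "\<not> mism g xs" if "x = idt g"
    using Cons.prems that by (cases xs) auto
  then show ?case using Cons by auto
qed simp

lemma bo_comp:
  assumes "comp_from 0 xs"
  shows "bo hK (basis xs) \<in> supp_in {xs. comp_from 0 xs}"
proof -
  obtain X a c where X: "X \<in> X_set" "xs = chain X a c" by (rule comp_from_0_cases[OF assms])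
  have "comp_from 0 (chain X a c)" for a c using comp_from_0 X(1) by blast
  then show ?thesis unfolding X(2) bo_chain[OF X(1)] by simp
qed

lemma bet_noncomp: "\<not> comp_from g xs \<Longrightarrow> bet hK (basis xs) \<in> supp_in {xs. \<not> comp_from g xs}"
proof (induction xs arbitrary: g)
  case (Cons x xs)
  have "D 2 (basis x) \<bowtie> basis xs \<in> supp_in {xs. \<not> comp_from g xs}"
    by (rule supp_in_mono[OF conc_basis_supp[OF D_2_supp]]) (use Cons.prems in auto)
  moreover have "basis x \<triangleright> bet hK (basis xs) \<in> supp_in {xs. \<not> comp_from g xs}"
  proof (cases "src x = g")
    case True
    then show ?thesis using Cons.prems
      by (intro supp_in_mono[OF tensor_supp[OF Cons.IH[of "tgt x"]]]) auto
  next
    case False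
    then show ?thesis
      by (intro supp_in_mono[OF tensor_supp[of _ UNIV]]) (auto simp: supp_in_def[of UNIV])
  qed
  ultimately show ?case unfolding bet_basis by (rule supp_in_simps(3))
qed (simp add: hK_eq tensor_basis)

lemma bo_noncomp:
  assumes "\<not> comp_from 0 xs"
  shows "bo hK (basis xs) \<in> supp_in {xs. \<not> comp_from 0 xs}"
  using bet_noncomp[OF assms] assms by (simp add: bo_def tensor_basis)

text \<open>Tuples composable from 0 to 1 and the remaining tuples span two subcomplexes.
  \<open>hh 0\<close> vanishes on the first and \<open>hc\<close> on the second, so the sum serves
  both.\<close>

definition homot :: "pbwT \<Rightarrow> pbwT" where
  "homot u = hh 0 u + hc u"

lemma lmap_homot: "lmap homot"
  unfolding homot_def[abs_def] by (intro lmap_intros)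

lemmas homot_simps [simp] = lmap_simps[OF lmap_homot]
lemmas lmap_homotI [lmap_intros] = lmap_comp[OF lmap_homot]

text \<open>Projection onto the span of E and F K in degree 1, the representatives of Hochschild
  cohomology.\<close>

definition harm :: "pbwT \<Rightarrow> pbwT" where
  "harm = lin (\<lambda>xs. if xs = [(0, 1, 0)] \<or> xs = [(1, 0, 1)] then basis xs else 0)"

theorem homotopy: "bo hK (homot u) + homot (bo hK u) = u - harm u"
proof -
  have "bo hK (homot (basis xs)) + homot (bo hK (basis xs)) = basis xs - harm (basis xs)" for xs
  proof (cases "comp_from 0 xs")
    case True
    then obtain X a c where X: "X \<in> X_set" "xs = chain X a c" by (rule comp_from_0_cases)
    have "hh 0 (bo hK (basis xs)) = 0"
      by (rule supp_in_eqI[OF bo_comp[OF True], of "hh 0" "\<lambda>u. 0"]) (auto intro!: lmap_intros simp: hhB_comp)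
    moreover have "harm (basis xs) = (if a = 0 \<and> c = 0 then basis xs else 0)"
      using X by (cases a; cases c) (auto simp: harm_def chain_def idt_def)
    ultimately show ?thesis
      using hc_homotopy[OF X(1), of a c] hhB_comp[OF True] by (auto simp: homot_def X(2))
  next
    case False
    have "hc (bo hK (basis xs)) = 0"
      by (rule supp_in_eqI[OF bo_noncomp[OF False], of hc "\<lambda>u. 0"]) (auto intro!: lmap_intros simp: hcB_def)
    moreover have "harm (basis xs) = 0"
      using False by (auto simp: harm_def)
    ultimately show ?thesis
      using hh_homotopy[OF False] False by (simp add: homot_def hcB_def bo_bfrom)
  qed
  then show ?thesis
    by (rule_tac lmap_eqI[of "\<lambda>u. bo hK (homot u) + homot (bo hK u)" "\<lambda>u. u - harm u"])
       (auto intro!: lmap_intros simp: harm_def)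
qed

lemma homot_closed: "u \<in> V (Suc n) \<Longrightarrow> homot u \<in> V n" and homot_0: "u \<in> V 0 \<Longrightarrow> homot u = 0"
proof -
  have "length xs = Suc n \<Longrightarrow> hhB xs g \<in> V n" for xs g n
  proof (induction xs arbitrary: g n)
    case (Cons x xs)
    show ?case
    proof (cases n)
      case 0
      then show ?thesis using Cons.prems by auto
    next
      case (Suc m)
      then show ?thesis using Cons by auto
    qed
  qed simp
  moreover have "length xs = Suc n \<Longrightarrow> hcB xs \<in> V n" for xs
    by (auto simp: hcB_def)
  ultimately show "u \<in> V (Suc n) \<Longrightarrow> homot u \<in> V n"
    unfolding homot_def hh_def hc_def by (intro supp_in_simps(2); rule_tac supp_in_lin) auto
  show "u \<in> V 0 \<Longrightarrow> homot u = 0"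
    by (rule V_0_eqI[of u homot "\<lambda>u. 0"]) (auto intro!: lmap_intros simp: homot_def hcB_def)
qed

lemma bo_exact_0:
  assumes "u \<in> V 0" "bo hK u = 0"
  shows "u = 0"
proof -
  have "harm u = 0"
    by (rule V_0_eqI[OF assms(1), of harm "\<lambda>u. 0"]) (auto intro!: lmap_intros simp: harm_def)
  then show ?thesis using homotopy[of u] homot_0[OF assms(1)] assms(2) by simp
qed

lemma bo_exact_Suc_Suc:
  assumes "u \<in> V (Suc (Suc n))" "bo hK u = 0"
  shows "\<exists>v\<in>V (Suc n). bo hK v = u"
proof -
  have "harm u = 0"
    by (rule supp_in_eqI[OF assms(1), of harm "\<lambda>u. 0"]) (auto intro!: lmap_intros simp: harm_def)
  then show ?thesis using homotopy[of u] homot_closed[OF assms(1)] assms(2) by (intro bexI[of _ "homot u"]) simp_all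
qed

section \<open>The generating cocycles in degree one\<close>

definition zE :: "pbwT" where "zE = hE \<triangleright> basis []"
definition zF :: "pbwT" where "zF = (hK \<star> hF) \<triangleright> basis []"

text \<open>The factor comes from K F = q^(-2) F K, where F K is the PBW monomial.\<close>

lemma zE_zF_eq: "zE = basis [(0, 1, 0)]" "zF = scale (Q (- 1)) (basis [(1, 0, 1)])"
  by (simp_all add: zE_def zF_def hg_star) (simp_all add: hg.simps tensor_basis)

lemma zE_zF_closed [simp]: "zE \<in> V 1" "zF \<in> V 1"
  by (simp_all add: zE_zF_eq)

lemma zE_zF_cocycle [simp]: "bo hK zE = 0" "bo hK zF = 0"
  using bo_chain[of "(0, 1, 0)" 0 0] bo_chain[of "(1, 0, 1)" 0 0]
  by (simp_all add: zE_zF_eq chain_def)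

text \<open>In degree 1, \<lambda> is - t, and t(E) = S(E) K = - E, t(K F) = S(F) S(K) K = - K
  F.\<close>

lemma zE_zF_lam [simp]: "lam zE = zE" "lam zF = zF"
proof -
  have 1: "lam (a \<triangleright> basis []) = - ((S a \<star> hK) \<triangleright> basis [])" for a
    using lam_V[of "a \<triangleright> basis []" 1] cycT_tcons[of "basis []" 0 a]
    by (simp add: tsnoc_Nil D_Suc_0 tmul_tcons)
  show "lam zE = zE" "lam zF = zF"
    by (simp_all add: zE_def zF_def 1 S_star star_assoc hg_rels(5,6))
qed

lemma harm_V_1:
  assumes "u \<in> V 1"
  shows "\<exists>a b. harm u = scale a zE + scale b zF"
proof -
  have "harm u = scale (Poly_Mapping.lookup u [(0, 1, 0)]) zE + scale (Poly_Mapping.lookup u [(1, 0, 1)] * Q 1) zF"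
    unfolding zE_zF_eq scale_simps
    by (rule supp_in_eqI[OF assms])
       (auto simp: harm_def lmap_def lookup_add lookup_single when_def scale_left_add scale_add distrib_left distrib_right mult.assoc mult.left_commute Q_norm algebra_simps split: if_splits)
  then show ?thesis by blast
qed

lemma bo_closed_V_1:
  assumes "u \<in> V 1" "bo hK u = 0"
  shows "\<exists>a b c. u = scale a zE + scale b zF + bo hK (scale c (basis []))"
proof -
  obtain a b where ab: "harm u = scale a zE + scale b zF" using harm_V_1[OF assms(1)] by blast
  have h: "homot u \<in> V 0" using homot_closed[of u 0] assms(1) by simp
  have "u = harm u + bo hK (homot u)" using homotopy[of u] assms(2) by (simp add: algebra_simps)
  then have "u = scale a zE + scale b zF + bo hK (scale (Poly_Mapping.lookup (homot u) []) (basis []))"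
    using V_0_scale[OF h] ab by simp
  then show ?thesis by blast
qed

text \<open>Coboundaries from degree 0 are multiples of 1 - K, which \<open>harm\<close> kills,
  whereas it fixes E and F K.\<close>

lemma zE_zF_indep:
  assumes "v \<in> V 0" "scale a zE + scale b zF = bo hK v"
  shows "a = 0" "b = 0"
proof -
  have "harm (bo hK v) = 0"
    by (rule V_0_eqI[OF assms(1), of "\<lambda>v. harm (bo hK v)" "\<lambda>v. 0"])
       (auto intro!: lmap_intros simp: harm_def bo_def hK_eq tensor_basis idt_def lmap_lin[THEN lmap_comp])
  then have "harm (scale a zE + scale b zF) = 0" using assms(2) by simp
  then have 0: "scale a (basis [(0, 1, 0)]) + scale (b * Q (- 1)) (basis [(1, 0, 1)]) = (0 :: pbwT)"
    by (simp add: harm_def zE_zF_eq)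
  from arg_cong[OF 0, of "\<lambda>u. Poly_Mapping.lookup u [(0, 1, 0)]"] show "a = 0"
    by (simp add: lookup_add lookup_single)
  from arg_cong[OF 0, of "\<lambda>u. Poly_Mapping.lookup u [(1, 0, 1)]"] show "b = 0"
    by (simp add: lookup_add lookup_single)
qed

end

section \<open>Quotients in coordinates\<close>

text \<open>A quotient in coordinates: \<Phi> identifies S with the carrier of M and R with N.
  Scalar multiplication is a parameter because the coordinates are vectors in one application and
  sequences of tensors in the other.\<close>

locale lin_quot =
  fixes M :: "(complex, 'a, 'm) module_scheme" and \<Phi> :: "'v :: ab_group_add \<Rightarrow> 'a"
    and sc :: "complex \<Rightarrow> 'v \<Rightarrow> 'v" and S R :: "'v set" and N :: "'a set"
  assumes inj: "inj_on \<Phi> S" and carrier: "carrier M = \<Phi> ` S" and N: "N = \<Phi> ` R" and R_subset: "R \<subseteq> S"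
    and hom_add: "x \<in> S \<Longrightarrow> y \<in> S \<Longrightarrow> \<Phi> x \<oplus>\<^bsub>M\<^esub> \<Phi> y = \<Phi> (x + y)"
    and hom_smult: "x \<in> S \<Longrightarrow> c \<odot>\<^bsub>M\<^esub> \<Phi> x = \<Phi> (sc c x)"
    and S_add: "x \<in> S \<Longrightarrow> y \<in> S \<Longrightarrow> x + y \<in> S" and S_sc: "x \<in> S \<Longrightarrow> sc c x \<in> S"
    and R_zero: "0 \<in> R" and R_diff: "x \<in> R \<Longrightarrow> y \<in> R \<Longrightarrow> x - y \<in> R" and R_sc: "x \<in> R \<Longrightarrow> sc c x \<in> R"
    and sc_add: "sc c (x + y) = sc c x + sc c y"
begin

definition cset :: "'v \<Rightarrow> 'a set" where
  "cset y = \<Phi> ` {r + y | r. r \<in> R}"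

lemma R_uminus: "x \<in> R \<Longrightarrow> - x \<in> R"
  using R_diff[OF R_zero] by simp

lemma R_add: "x \<in> R \<Longrightarrow> y \<in> R \<Longrightarrow> x + y \<in> R"
  using R_diff[of x "- y"] R_uminus by simp

lemma coset: "y \<in> S \<Longrightarrow> N +>\<^bsub>M\<^esub> \<Phi> y = cset y"
proof -
  assume y: "y \<in> S"
  have *: "\<Phi> r \<oplus>\<^bsub>M\<^esub> \<Phi> y = \<Phi> (r + y)" if "r \<in> R" for r
    using that y R_subset by (intro hom_add) auto
  have "(\<Union>h\<in>\<Phi> ` R. {h \<oplus>\<^bsub>M\<^esub> \<Phi> y}) = (\<lambda>r. \<Phi> (r + y)) ` R"
    by (auto simp: *[symmetric])
  then show ?thesis unfolding cset_def N a_r_coset_def' by auto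
qed

lemma cset_eq_iff: "x \<in> S \<Longrightarrow> y \<in> S \<Longrightarrow> cset x = cset y \<longleftrightarrow> x - y \<in> R"
proof
  assume xy: "x \<in> S" "y \<in> S" "cset x = cset y"
  have "\<Phi> (0 + x) \<in> cset x" unfolding cset_def using R_zero by blast
  then obtain r where r: "r \<in> R" "\<Phi> x = \<Phi> (r + y)" using xy(3) by (auto simp: cset_def)
  moreover have "r + y \<in> S" using r xy R_subset S_add by auto
  ultimately have "x = r + y" using inj_onD[OF inj, of x "r + y"] xy by auto
  then show "x - y \<in> R" using r by simp
next
  assume "x - y \<in> R"
  then have "{r + x | r. r \<in> R} = {r + y | r. r \<in> R}"
  proof (intro equalityI subsetI)
    fix z assume "z \<in> {r + x | r. r \<in> R}"
    then obtain r where "r \<in> R" "z = r + x" by auto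
    then have "z = (r + (x - y)) + y" "r + (x - y) \<in> R" using \<open>x - y \<in> R\<close> R_add by auto
    then show "z \<in> {r + y | r. r \<in> R}" by blast
  next
    fix z assume "z \<in> {r + y | r. r \<in> R}"
    then obtain r where "r \<in> R" "z = r + y" by auto
    then have "z = (r - (x - y)) + x" "r - (x - y) \<in> R" using \<open>x - y \<in> R\<close> R_diff by auto
    then show "z \<in> {r + x | r. r \<in> R}" by blast
  qed
  then show "cset x = cset y" by (simp add: cset_def)
qed

lemma cset_shift: "r \<in> R \<Longrightarrow> y \<in> S \<Longrightarrow> cset (r + y) = cset y"
  using R_subset by (subst cset_eq_iff) (auto intro: S_add)

lemma quot_carrier: "carrier (quot_module M N) = cset ` S"
proof -
  have "carrier (quot_module M N) = (\<Union>a\<in>carrier M. {N +>\<^bsub>M\<^esub> a})"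
    by (simp add: quot_module_def FactRing_def A_RCOSETS_def RCOSETS_def a_r_coset_def)
  also have "\<dots> = cset ` S" using coset by (auto simp: carrier)
  finally show ?thesis .
qed

lemma quot_zero: "0 \<in> S \<Longrightarrow> \<zero>\<^bsub>quot_module M N\<^esub> = cset 0"
  unfolding quot_module_def FactRing_def by (auto simp: cset_def N)

lemma quot_one: "x \<in> S \<Longrightarrow> \<one>\<^bsub>M\<^esub> = \<Phi> x \<Longrightarrow> \<one>\<^bsub>quot_module M N\<^esub> = cset x"
  unfolding quot_module_def FactRing_def by (simp add: coset)

lemma quot_add: "x \<in> S \<Longrightarrow> y \<in> S \<Longrightarrow> cset x \<oplus>\<^bsub>quot_module M N\<^esub> cset y = cset (x + y)"
proof -
  assume xy: "x \<in> S" "y \<in> S"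
  have "cset x \<oplus>\<^bsub>quot_module M N\<^esub> cset y = (\<Union>a\<in>cset x. \<Union>b\<in>cset y. {a \<oplus>\<^bsub>M\<^esub> b})"
    by (simp add: quot_module_def FactRing_def set_add_def set_mult_def)
  also have "\<dots> = cset (x + y)"
  proof (intro equalityI subsetI)
    fix z assume "z \<in> (\<Union>a\<in>cset x. \<Union>b\<in>cset y. {a \<oplus>\<^bsub>M\<^esub> b})"
    then obtain r s where rs: "r \<in> R" "s \<in> R" "z = \<Phi> (r + x) \<oplus>\<^bsub>M\<^esub> \<Phi> (s + y)" by (auto simp: cset_def)
    then have "z = \<Phi> ((r + s) + (x + y))" using xy R_subset S_add by (auto simp: hom_add subset_iff add_ac)
    then show "z \<in> cset (x + y)" using R_add rs by (auto simp: cset_def)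
  next
    fix z assume "z \<in> cset (x + y)"
    then obtain r where r: "r \<in> R" "z = \<Phi> (r + (x + y))" by (auto simp: cset_def)
    then have "z = \<Phi> (r + x) \<oplus>\<^bsub>M\<^esub> \<Phi> (0 + y)" using xy R_subset S_add by (auto simp: hom_add subset_iff add_ac)
    moreover have "\<Phi> (r + x) \<in> cset x" "\<Phi> (0 + y) \<in> cset y"
      unfolding cset_def using r R_zero by blast+
    ultimately show "z \<in> (\<Union>a\<in>cset x. \<Union>b\<in>cset y. {a \<oplus>\<^bsub>M\<^esub> b})" by blast
  qed
  finally show ?thesis .
qed

lemma UN_cset_const: "y \<in> S \<Longrightarrow> (\<And>r. r \<in> R \<Longrightarrow> F (\<Phi> (r + y)) = C) \<Longrightarrow> (\<Union>x\<in>cset y. F x) = C"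
  using R_zero by (auto simp: cset_def)

lemma quot_smult: "y \<in> S \<Longrightarrow> c \<odot>\<^bsub>quot_module M N\<^esub> cset y = cset (sc c y)"
proof -
  assume y: "y \<in> S"
  have "c \<odot>\<^bsub>quot_module M N\<^esub> cset y = (\<Union>x\<in>cset y. N +>\<^bsub>M\<^esub> (c \<odot>\<^bsub>M\<^esub> x))"
    by (simp add: quot_module_def)
  also have "\<dots> = cset (sc c y)"
  proof (rule UN_cset_const[OF y])
    fix r assume r: "r \<in> R"
    have "N +>\<^bsub>M\<^esub> (c \<odot>\<^bsub>M\<^esub> \<Phi> (r + y)) = cset (sc c r + sc c y)"
      using r y R_subset S_add S_sc R_sc by (auto simp: hom_smult sc_add[symmetric] coset subset_iff)
    also have "\<dots> = cset (sc c y)" using r y R_sc S_sc by (intro cset_shift) auto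
    finally show "N +>\<^bsub>M\<^esub> (c \<odot>\<^bsub>M\<^esub> \<Phi> (r + y)) = cset (sc c y)" .
  qed
  finally show ?thesis .
qed

end

text \<open>Identifying the record with a concrete span supplies its abelian group structure, so
  that \<open>finsum\<close> and subtraction can be computed in coordinates.\<close>

locale vmodel =
  fixes M :: "(complex, 'a, 'm) module_scheme" and \<Phi> :: "('k \<Rightarrow>\<^sub>0 complex) \<Rightarrow> 'a" and A :: "'k set"
  assumes inj: "inj_on \<Phi> (supp_in A)" and carrier: "carrier M = \<Phi> ` supp_in A"
    and hom_add: "x \<in> supp_in A \<Longrightarrow> y \<in> supp_in A \<Longrightarrow> \<Phi> x \<oplus>\<^bsub>M\<^esub> \<Phi> y = \<Phi> (x + y)"
    and hom_zero: "\<zero>\<^bsub>M\<^esub> = \<Phi> 0"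
    and hom_smult: "x \<in> supp_in A \<Longrightarrow> c \<odot>\<^bsub>M\<^esub> \<Phi> x = \<Phi> (scale c x)"
begin

lemma abelian_group: "abelian_group M"
proof (rule abelian_groupI)
  fix x assume "x \<in> carrier M"
  then obtain a where "a \<in> supp_in A" "x = \<Phi> a" by (auto simp: carrier)
  then show "\<exists>y\<in>carrier M. y \<oplus>\<^bsub>M\<^esub> x = \<zero>\<^bsub>M\<^esub>"
    by (intro bexI[of _ "\<Phi> (- a)"]) (auto simp: carrier hom_zero hom_add)
qed (auto simp: carrier hom_zero hom_add add_ac)

lemma a_inv: "x \<in> supp_in A \<Longrightarrow> \<ominus>\<^bsub>M\<^esub> \<Phi> x = \<Phi> (- x)"
proof -
  interpret abelian_group M by (rule abelian_group)
  show "x \<in> supp_in A \<Longrightarrow> \<ominus>\<^bsub>M\<^esub> \<Phi> x = \<Phi> (- x)"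
    by (rule minus_equality) (auto simp: carrier hom_zero hom_add)
qed

lemma a_minus: "x \<in> supp_in A \<Longrightarrow> y \<in> supp_in A \<Longrightarrow> \<Phi> x \<ominus>\<^bsub>M\<^esub> \<Phi> y = \<Phi> (x - y)"
  by (simp add: a_minus_def a_inv hom_add)

lemma finsum: "(\<And>i. i \<in> I \<Longrightarrow> f i = \<Phi> (g i)) \<Longrightarrow> (\<And>i. i \<in> I \<Longrightarrow> g i \<in> supp_in A) \<Longrightarrow>
    (\<Oplus>\<^bsub>M\<^esub>i\<in>I. f i) = \<Phi> (\<Sum>i\<in>I. g i)"
proof (induction I rule: infinite_finite_induct)
  interpret abelian_group M by (rule abelian_group)
  case (infinite I)
  then show ?case by (simp add: hom_zero[symmetric] finsum_infinite)
next
  interpret abelian_group M by (rule abelian_group)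
  case empty
  then show ?case by (simp add: hom_zero)
next
  interpret abelian_group M by (rule abelian_group)
  case (insert i I)
  have s: "sum g I \<in> supp_in A" using insert.prems by (intro supp_in_sum) auto
  have "(\<Oplus>\<^bsub>M\<^esub>j\<in>insert i I. f j) = f i \<oplus>\<^bsub>M\<^esub> (\<Oplus>\<^bsub>M\<^esub>j\<in>I. f j)"
    using insert.hyps insert.prems by (intro finsum_insert) (auto simp: carrier)
  then show ?case using insert s by (simp add: hom_add)
qed

lemma lin_ext:
  assumes "\<And>k. k \<in> Poly_Mapping.keys x \<Longrightarrow> f k = \<Phi> (g k)" "\<And>k. k \<in> Poly_Mapping.keys x \<Longrightarrow> g k \<in> supp_in A"
  shows "lin_ext M f x = \<Phi> (lin g x)"
  unfolding lin_ext_def lin_def using assms by (intro finsum) (auto simp: hom_smult)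

end

text \<open>A concrete first isomorphism theorem: \<Lambda> maps onto the span of A with kernel N,
  so cosets are its fibres. It serves for the algebra and for every tensor power.\<close>

locale free_quot =
  fixes M :: "(complex, 'b \<Rightarrow>\<^sub>0 complex) module" and B :: "'b set" and N :: "('b \<Rightarrow>\<^sub>0 complex) set"
    and \<Lambda> :: "('b \<Rightarrow>\<^sub>0 complex) \<Rightarrow> ('k \<Rightarrow>\<^sub>0 complex)" and A :: "'k set"
  assumes fcarrier: "carrier M = supp_in B"
    and fops: "x \<oplus>\<^bsub>M\<^esub> y = x + y" "\<zero>\<^bsub>M\<^esub> = 0" "c \<odot>\<^bsub>M\<^esub> x = scale c x"
    and lmap: "lmap \<Lambda>" and range: "\<And>b. b \<in> B \<Longrightarrow> \<Lambda> (basis b) \<in> supp_in A"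
    and surj: "\<And>k. k \<in> A \<Longrightarrow> \<exists>b\<in>B. \<Lambda> (basis b) = basis k"
    and kernel: "N = {x \<in> supp_in B. \<Lambda> x = 0}"
begin

definition fib :: "('k \<Rightarrow>\<^sub>0 complex) \<Rightarrow> ('b \<Rightarrow>\<^sub>0 complex) set" where
  "fib v = {x \<in> supp_in B. \<Lambda> x = v}"

lemmas Lam_simps = lmap_simps[OF lmap]

lemma range_supp: "x \<in> supp_in B \<Longrightarrow> \<Lambda> x \<in> supp_in A"
  unfolding lmap_eq_lin[OF lmap, of x] by (rule supp_in_lin) (use range in auto)

lemma surj_supp: "v \<in> supp_in A \<Longrightarrow> \<exists>x\<in>supp_in B. \<Lambda> x = v"
proof -
  assume v: "v \<in> supp_in A"
  obtain s where s: "\<And>k. k \<in> A \<Longrightarrow> s k \<in> B \<and> \<Lambda> (basis (s k)) = basis k"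
    using surj by metis
  have "\<Lambda> (lin (\<lambda>k. basis (s k)) v) = lin (\<lambda>k. \<Lambda> (basis (s k))) v"
    by (rule lmap_lin_comp[OF lmap])
  also have "\<dots> = lin basis v"
    by (rule lin_cong) (use s supp_in_keys[OF v] in auto)
  finally have "\<Lambda> (lin (\<lambda>k. basis (s k)) v) = v" by simp
  moreover have "lin (\<lambda>k. basis (s k)) v \<in> supp_in B"
    using v by (rule supp_in_lin) (use s in auto)
  ultimately show ?thesis by blast
qed

sublocale Q: lin_quot M "\<lambda>x. x" scale "supp_in B" N N
  by unfold_locales (auto simp: fcarrier fops kernel Lam_simps scale_add inj_on_def)

lemma cset_fib: "x \<in> supp_in B \<Longrightarrow> Q.cset x = fib (\<Lambda> x)"
proof -
  assume x: "x \<in> supp_in B"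
  have "y \<in> Q.cset x" if "y \<in> supp_in B" "\<Lambda> y = \<Lambda> x" for y
    unfolding Q.cset_def image_ident using that x
    by (intro CollectI exI[of _ "y - x"]) (auto simp: kernel Lam_simps)
  moreover have "y \<in> supp_in B \<and> \<Lambda> y = \<Lambda> x" if "y \<in> Q.cset x" for y
    using that x unfolding Q.cset_def image_ident by (auto simp: kernel Lam_simps)
  ultimately show ?thesis by (auto simp: fib_def)
qed

lemma fib_obtain:
  assumes "v \<in> supp_in A"
  obtains x where "x \<in> supp_in B" "\<Lambda> x = v" "fib v = Q.cset x"
  using surj_supp[OF assms] cset_fib by blast

lemma coset_fib: "x \<in> supp_in B \<Longrightarrow> N +>\<^bsub>M\<^esub> x = fib (\<Lambda> x)"
  using Q.coset[of x] cset_fib by simp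

lemma vmodel: "vmodel (quot_module M N) fib A"
proof
  show "inj_on fib (supp_in A)"
  proof (rule inj_onI)
    fix u v assume "u \<in> supp_in A" "v \<in> supp_in A" "fib u = fib v"
    then show "u = v" using surj_supp[of u] by (auto simp: fib_def)
  qed
  show "carrier (quot_module M N) = fib ` supp_in A"
  proof -
    have "fib ` supp_in A = Q.cset ` supp_in B"
    proof (intro equalityI subsetI)
      fix z assume "z \<in> fib ` supp_in A"
      then show "z \<in> Q.cset ` supp_in B" using fib_obtain by (metis (no_types, lifting) image_iff)
    next
      fix z assume "z \<in> Q.cset ` supp_in B"
      then show "z \<in> fib ` supp_in A" using cset_fib range_supp by auto
    qed
    then show ?thesis by (simp add: Q.quot_carrier)
  qed
  show "\<zero>\<^bsub>quot_module M N\<^esub> = fib 0"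
    using Q.quot_zero cset_fib[of 0] by (simp add: Lam_simps)
  fix u v assume u: "u \<in> supp_in A"
  obtain x where x: "x \<in> supp_in B" "\<Lambda> x = u" "fib u = Q.cset x" by (rule fib_obtain[OF u])
  show "c \<odot>\<^bsub>quot_module M N\<^esub> fib u = fib (scale c u)" for c
    using Q.quot_smult[OF x(1), of c] cset_fib[of "scale c x"] x by (simp add: Lam_simps)
  assume v: "v \<in> supp_in A"
  obtain y where y: "y \<in> supp_in B" "\<Lambda> y = v" "fib v = Q.cset y" by (rule fib_obtain[OF v])
  show "fib u \<oplus>\<^bsub>quot_module M N\<^esub> fib v = fib (u + v)"
    using Q.quot_add[OF x(1) y(1)] cset_fib[of "x + y"] x y by (simp add: Lam_simps)
qed

lemma fib_mult:
  assumes "\<And>x y. x \<in> supp_in B \<Longrightarrow> y \<in> supp_in B \<Longrightarrow> x \<otimes>\<^bsub>M\<^esub> y \<in> supp_in B \<and> \<Lambda> (x \<otimes>\<^bsub>M\<^esub> y) = \<mu> (\<Lambda> x) (\<Lambda> y)"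
    and "u \<in> supp_in A" "v \<in> supp_in A"
  shows "fib u \<otimes>\<^bsub>quot_module M N\<^esub> fib v = fib (\<mu> u v)"
proof -
  have "fib u \<otimes>\<^bsub>quot_module M N\<^esub> fib v = (\<Union>a\<in>fib u. \<Union>b\<in>fib v. N +>\<^bsub>M\<^esub> (a \<otimes>\<^bsub>M\<^esub> b))"
    by (simp add: quot_module_def FactRing_def rcoset_mult_def)
  also have "\<dots> = (\<Union>a\<in>fib u. \<Union>b\<in>fib v. fib (\<mu> u v))"
    using assms(1) by (intro SUP_cong refl) (auto simp: fib_def[of u] fib_def[of v] coset_fib)
  also have "\<dots> = fib (\<mu> u v)"
    using surj_supp[OF assms(2)] surj_supp[OF assms(3)] by (auto simp: fib_def[of u] fib_def[of v])
  finally show ?thesis .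
qed

text \<open>The \<open>the_elem\<close> in \<open>quot_lift\<close> is meaningful here because
  \<open>f\<close> factors through \<Lambda>, which makes \<open>lin_ext\<close> constant on each
  fibre.\<close>

lemma quot_lift:
  assumes "vmodel W \<Phi> C" "v \<in> supp_in A" "lmap G"
    and "\<And>b. b \<in> B \<Longrightarrow> f b = \<Phi> (G (\<Lambda> (basis b))) \<and> G (\<Lambda> (basis b)) \<in> supp_in C"
  shows "quot_lift W f (fib v) = \<Phi> (G v)"
proof -
  interpret W: vmodel W \<Phi> C by fact
  have "lin_ext W f x = \<Phi> (G v)" if "x \<in> fib v" for x
  proof -
    have x: "x \<in> supp_in B" "\<Lambda> x = v" using that by (auto simp: fib_def)
    have "lin_ext W f x = \<Phi> (lin (\<lambda>b. G (\<Lambda> (basis b))) x)"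
      by (rule W.lin_ext) (use assms(4) supp_in_keys[OF x(1)] in auto)
    also have "lin (\<lambda>b. G (\<Lambda> (basis b))) x = G (\<Lambda> x)"
      using lmap_eq_lin[OF lmap_comp[OF assms(3) lmap], of x] by simp
    finally show ?thesis using x by simp
  qed
  moreover have "fib v \<noteq> {}" using surj_supp[OF assms(2)] by (auto simp: fib_def)
  ultimately have "lin_ext W f ` fib v = {\<Phi> (G v)}" by auto
  then show ?thesis by (simp add: quot_lift_def)
qed

end

lemma m_inv_free:
  assumes "carrier M = supp_in B" "\<And>x y. x \<oplus>\<^bsub>M\<^esub> y = x + y" "\<zero>\<^bsub>M\<^esub> = (0 :: 'b \<Rightarrow>\<^sub>0 complex)" "x \<in> supp_in B"
  shows "m_inv (add_monoid M) x = - x"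
  unfolding m_inv_def using assms
  by (intro the_equality) (auto simp: eq_neg_iff_add_eq_0)

section \<open>Comparison with the abstract quantum group\<close>

context quantum
begin

text \<open>The ground field as degree 0 tensors; the counit then fits the scheme of the
  coproducts.\<close>

lemma vmodel_complex: "vmodel complex_alg (\<lambda>u. Poly_Mapping.lookup u []) {bs :: pbw list. length bs = 0}"
proof
  show "inj_on (\<lambda>u. Poly_Mapping.lookup u []) (V 0 :: pbwT set)"
  proof (rule inj_onI)
    fix u v :: "pbwT"
    assume "u \<in> V 0" "v \<in> V 0" "Poly_Mapping.lookup u [] = Poly_Mapping.lookup v []"
    then show "u = v" using V_0_scale[of u] V_0_scale[of v] by simp
  qed
  have "z \<in> (\<lambda>u. Poly_Mapping.lookup u []) ` (V 0 :: pbwT set)" for z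
    by (rule image_eqI[of _ _ "scale z (basis [])"]) auto
  then show "carrier complex_alg = (\<lambda>u. Poly_Mapping.lookup u []) ` (V 0 :: pbwT set)"
    by (auto simp: complex_alg_def)
qed (auto simp: complex_alg_def lookup_add)

abbreviation Aq :: "(complex, (gen list \<Rightarrow>\<^sub>0 complex) set) module" where "Aq \<equiv> Uq_alg q"

lemma free_quot_A: "free_quot free_alg UNIV I_rel Psi UNIV"
proof
  fix k :: pbw
  show "\<exists>b\<in>UNIV. Psi (basis b) = basis k"
    using Psi_pbw_word[of k] by (intro bexI[of _ "pbw_word k"]) auto
qed (auto simp: supp_in_def I_rel_eq intro: lmap_Psi)

interpretation A: free_quot free_alg UNIV I_rel Psi UNIV
  by (rule free_quot_A)

definition PhiA :: "pbwV \<Rightarrow> (gen list \<Rightarrow>\<^sub>0 complex) set" where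
  "PhiA v = {p. Psi p = v}"

lemma PhiA_fib: "PhiA = A.fib"
  by (auto simp: fun_eq_iff PhiA_def A.fib_def supp_in_def)

lemma Aq_quot: "Aq = quot_module free_alg I_rel"
  by (simp add: Uq_alg_def I_rel_def)

lemma vmodel_Aq: "vmodel Aq PhiA UNIV"
  unfolding Aq_quot PhiA_fib by (rule A.vmodel)

lemma Aq_mult: "PhiA x \<otimes>\<^bsub>Aq\<^esub> PhiA y = PhiA (x \<star> y)"
  unfolding Aq_quot PhiA_fib by (rule A.fib_mult) (auto simp: Psi_fmult supp_in_def)

lemma Aq_one: "\<one>\<^bsub>Aq\<^esub> = PhiA one_H"
  using A.Q.quot_one[of "basis []"] A.cset_fib[of "basis []"]
  by (simp add: Aq_quot PhiA_fib supp_in_def)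

lemma Aq_carrier: "carrier Aq = range PhiA"
  using vmodel.carrier[OF vmodel_Aq] by (simp add: supp_in_def)

lemma PhiA_in [simp]: "PhiA x \<in> carrier Aq"
  by (simp add: Aq_carrier)

lemma Uq_gen_PhiA: "Uq_gen q g = PhiA (hg g)"
  using A.coset_fib[of "basis [g]"]
  by (simp add: Uq_gen_def I_rel_def[symmetric] PhiA_fib supp_in_def act_one)

lemma Aq_ops: "PhiA x \<oplus>\<^bsub>Aq\<^esub> PhiA y = PhiA (x + y)" "c \<odot>\<^bsub>Aq\<^esub> PhiA x = PhiA (scale c x)"
  "\<ominus>\<^bsub>Aq\<^esub> PhiA x = PhiA (- x)"
  using vmodel.hom_add[OF vmodel_Aq, of x y] vmodel.hom_smult[OF vmodel_Aq, of x c] vmodel.a_inv[OF vmodel_Aq, of x]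
  by (simp_all add: supp_in_def)

definition psi :: "(gen list \<Rightarrow>\<^sub>0 complex) set \<Rightarrow> pbwV" where
  "psi = inv_into UNIV PhiA"

lemma inj_PhiA: "inj PhiA"
  using vmodel.inj[OF vmodel_Aq] by (simp add: supp_in_def)

lemma psi_PhiA [simp]: "psi (PhiA x) = x"
  unfolding psi_def by (rule inv_f_f[OF inj_PhiA])

lemma Uq_hom_PhiA:
  assumes "vmodel W \<Phi> C" "lmap G" "\<And>w. foldr (\<lambda>g r. f g \<otimes>\<^bsub>W\<^esub> r) w \<one>\<^bsub>W\<^esub> = \<Phi> (G (foldr act w one_H))"
    "\<And>x. G x \<in> supp_in C"
  shows "Uq_hom W f (PhiA v) = \<Phi> (G v)"
  unfolding Uq_hom_def PhiA_fib
  by (rule A.quot_lift[OF assms(1)]) (auto simp: supp_in_def[of UNIV] assms)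

subsection \<open>Tensor powers\<close>

primrec LamL :: "(gen list \<Rightarrow>\<^sub>0 complex) set list \<Rightarrow> pbwT" where
  "LamL [] = basis []"
| "LamL (h # hs) = psi h \<triangleright> LamL hs"

abbreviation tlists :: "nat \<Rightarrow> (gen list \<Rightarrow>\<^sub>0 complex) set list set" where
  "tlists n \<equiv> {hs. length hs = n \<and> set hs \<subseteq> carrier Aq}"

lemma LamL_closed [simp]: "LamL hs \<in> V (length hs)"
  by (induction hs) auto

lemma LamL_append: "LamL (xs @ ys) = LamL xs \<bowtie> LamL ys"
  by (induction xs) (auto simp: tcons_tconc)

lemma LamL_PhiA: "LamL (map (\<lambda>b. PhiA (basis b)) bs) = basis bs"
  by (induction bs) (auto simp: tensor_basis)

lemma map2_PhiA:
  "length hs = length gs \<Longrightarrow> set hs \<subseteq> carrier Aq \<Longrightarrow> set gs \<subseteq> carrier Aq \<Longrightarrow>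
   LamL (map2 (mult Aq) hs gs) = LamL hs \<bullet> LamL gs \<and> set (map2 (mult Aq) hs gs) \<subseteq> carrier Aq"
proof (induction hs gs rule: list_induct2)
  case (Cons h hs g gs)
  then obtain x y where "h = PhiA x" "g = PhiA y" by (auto simp: Aq_carrier)
  then show ?case using Cons by (simp add: Aq_mult tmul_tcons)
qed simp

lemma LamL_map2: "hs \<in> tlists n \<Longrightarrow> gs \<in> tlists n \<Longrightarrow> LamL (map2 (mult Aq) hs gs) = LamL hs \<bullet> LamL gs"
  and map2_tlists: "hs \<in> tlists n \<Longrightarrow> gs \<in> tlists n \<Longrightarrow> map2 (mult Aq) hs gs \<in> tlists n"
  using map2_PhiA[of hs gs] by auto

lemma free_tensor_simps:
  "carrier (free_tensor Aq n) = supp_in (tlists n)" "x \<oplus>\<^bsub>free_tensor Aq n\<^esub> y = x + y"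
  "\<zero>\<^bsub>free_tensor Aq n\<^esub> = 0" "c \<odot>\<^bsub>free_tensor Aq n\<^esub> x = scale c x"
  "x \<otimes>\<^bsub>free_tensor Aq n\<^esub> y = lin (\<lambda>a. lin (\<lambda>b. basis (map2 (mult Aq) a b)) y) x"
  "\<one>\<^bsub>free_tensor Aq n\<^esub> = basis (replicate n \<one>\<^bsub>Aq\<^esub>)"
  by (auto simp: free_tensor_def supp_in_def bilin_ext_lin)

lemma submodule_free_tensorD:
  assumes "submodule N complex_alg (free_tensor Aq n)"
  shows "0 \<in> N" "x \<in> N \<Longrightarrow> y \<in> N \<Longrightarrow> x + y \<in> N" "x \<in> N \<Longrightarrow> scale c x \<in> N"
proof -
  interpret submodule N complex_alg "free_tensor Aq n" by fact
  show "0 \<in> N" using one_closed by (simp add: free_tensor_simps)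
  show "x \<in> N \<Longrightarrow> y \<in> N \<Longrightarrow> x + y \<in> N" using m_closed[of x y] by (simp add: free_tensor_simps)
  show "x \<in> N \<Longrightarrow> scale c x \<in> N" using smult_closed[of c x] by (simp add: free_tensor_simps complex_alg_def)
qed

lemma lin_closed_in:
  assumes "0 \<in> N" "\<And>x y. x \<in> N \<Longrightarrow> y \<in> N \<Longrightarrow> x + y \<in> N" "\<And>c x. x \<in> N \<Longrightarrow> scale c x \<in> N"
    and "\<And>k. k \<in> Poly_Mapping.keys x \<Longrightarrow> f k \<in> N"
  shows "lin f x \<in> N"
proof -
  have "A \<subseteq> Poly_Mapping.keys x \<Longrightarrow> (\<Sum>k\<in>A. scale (Poly_Mapping.lookup x k) (f k)) \<in> N" for A
    by (induction A rule: infinite_finite_induct) (auto intro: assms)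
  then show ?thesis by (simp add: lin_def)
qed

lemma multilinear_expand:
  assumes "submodule N complex_alg (free_tensor Aq n)" "multilinear_rels Aq n \<subseteq> N"
    and "ps \<in> tlists k" "hs \<in> tlists m" "k + 1 + m = n"
  shows "basis (ps @ PhiA v # hs) - lin (\<lambda>b. basis (ps @ PhiA (basis b) # hs)) v \<in> N"
proof -
  note N = submodule_free_tensorD[OF assms(1)]
  have rel: "basis (ps @ PhiA (scale a x + scale b y) # hs) - scale a (basis (ps @ PhiA x # hs)) - scale b (basis (ps @ PhiA y # hs)) \<in> N"
    for a b x y
  proof -
    have "Poly_Mapping.single (ps @ [(a \<odot>\<^bsub>Aq\<^esub> PhiA x) \<oplus>\<^bsub>Aq\<^esub> (b \<odot>\<^bsub>Aq\<^esub> PhiA y)] @ hs) 1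
        - Poly_Mapping.single (ps @ [PhiA x] @ hs) a - Poly_Mapping.single (ps @ [PhiA y] @ hs) b \<in> multilinear_rels Aq n"
      unfolding multilinear_rels_def using assms(3-5)
      by (intro CollectI exI[of _ ps] exI[of _ hs] exI[of _ "PhiA x"] exI[of _ "PhiA y"] exI[of _ a] exI[of _ b]) simp
    then show ?thesis using assms(2) by (auto simp: Aq_ops single_scale[of _ a] single_scale[of _ b])
  qed
  let ?P = "\<lambda>v. basis (ps @ PhiA v # hs) - lin (\<lambda>b. basis (ps @ PhiA (basis b) # hs)) v \<in> N"
  \<comment> \<open>Partial sums of \<open>v\<close>: a new summand is split off by the relation
    with coefficients \<open>lookup v b\<close> and 1; the empty sum is the relation with all
    coefficients 0.\<close>
  have "?P (\<Sum>b\<in>A. scale (Poly_Mapping.lookup v b) (basis b))" for A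
  proof (induction A rule: infinite_finite_induct)
    case (insert b A)
    let ?s = "\<Sum>b\<in>A. scale (Poly_Mapping.lookup v b) (basis b)"
    from N(2)[OF rel[of "Poly_Mapping.lookup v b" "basis b" 1 ?s] insert.IH]
    show ?case using insert.hyps by (simp add: algebra_simps)
  qed (use rel[of 0 0 0 0] in auto)
  from this[of "Poly_Mapping.keys v"] show ?thesis
    by (metis lin_basis_id lin_def)
qed

text \<open>The prefix \<open>ps\<close> collects the slots already expanded into basis elements;
  each step moves one slot over.\<close>

lemma tensor_expand:
  assumes "submodule N complex_alg (free_tensor Aq n)" "multilinear_rels Aq n \<subseteq> N"
    and "ps \<in> tlists k" "hs \<in> tlists m" "k + m = n"
  shows "basis (ps @ hs) - lin (\<lambda>bs. basis (ps @ map (\<lambda>b. PhiA (basis b)) bs)) (LamL hs) \<in> N"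
  using assms(3-5)
proof (induction hs arbitrary: ps k m)
  case Nil
  then show ?case using submodule_free_tensorD(1)[OF assms(1)] by simp
next
  case (Cons h hs)
  note N = submodule_free_tensorD[OF assms(1)]
  obtain v where v: "h = PhiA v" using Cons.prems by (auto simp: Aq_carrier)
  obtain m' where m: "m = Suc m'" "hs \<in> tlists m'" using Cons.prems by (cases m) auto
  have 1: "basis (ps @ PhiA v # hs) - lin (\<lambda>b. basis (ps @ PhiA (basis b) # hs)) v \<in> N"
    using Cons.prems m by (intro multilinear_expand[OF assms(1,2)]) auto
  have "basis ((ps @ [PhiA (basis b)]) @ hs) - lin (\<lambda>bs. basis ((ps @ [PhiA (basis b)]) @ map (\<lambda>b. PhiA (basis b)) bs)) (LamL hs) \<in> N" for b
    using Cons.prems m by (intro Cons.IH[of _ "Suc k" m']) auto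
  then have "lin (\<lambda>b. basis (ps @ PhiA (basis b) # hs) - lin (\<lambda>bs. basis (ps @ PhiA (basis b) # map (\<lambda>b. PhiA (basis b)) bs)) (LamL hs)) v \<in> N"
    by (intro lin_closed_in N) auto
  from N(2)[OF 1 this] show ?case
    by (simp add: v lin_fun_diff tcons_def lin_lin)
qed

lemma Lam_rels: "r \<in> multilinear_rels Aq n \<Longrightarrow> r \<in> supp_in (tlists n) \<and> lin LamL r = 0"
proof -
  assume "r \<in> multilinear_rels Aq n"
  then obtain xs ys x y a b where r: "r = Poly_Mapping.single (xs @ [(a \<odot>\<^bsub>Aq\<^esub> PhiA x) \<oplus>\<^bsub>Aq\<^esub> (b \<odot>\<^bsub>Aq\<^esub> PhiA y)] @ ys) 1
        - Poly_Mapping.single (xs @ [PhiA x] @ ys) a - Poly_Mapping.single (xs @ [PhiA y] @ ys) b"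
    "length xs + 1 + length ys = n" "set xs \<subseteq> carrier Aq" "set ys \<subseteq> carrier Aq"
    unfolding multilinear_rels_def by (auto simp: Aq_carrier)
  have "xs @ PhiA z # ys \<in> tlists n" for z using r by auto
  then show ?thesis
    unfolding r(1) Aq_ops single_scale[of _ a] single_scale[of _ b]
    by (auto simp: LamL_append)
qed

text \<open>The kernel is a submodule containing the relations. Conversely, modulo any such
  submodule a vector equals the standard lift of its coordinates, hence lies in it when these
  vanish.\<close>

lemma tensor_null_eq: "tensor_null Aq n = {x \<in> supp_in (tlists n). lin LamL x = 0}"
proof (intro equalityI subsetI)
  let ?K = "{x \<in> supp_in (tlists n). lin LamL x = 0}"
  have "submodule ?K complex_alg (free_tensor Aq n)"
  proof (rule submodule.intro)
    show "subgroup ?K (add_monoid (free_tensor Aq n))"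
    proof (rule subgroup.intro)
      fix x assume x: "x \<in> ?K"
      have "m_inv (add_monoid (free_tensor Aq n)) x = - x"
        using x by (intro m_inv_free[of _ "tlists n"]) (auto simp: free_tensor_simps)
      then show "m_inv (add_monoid (free_tensor Aq n)) x \<in> ?K" using x by simp
    qed (auto simp: free_tensor_simps)
    show "submodule_axioms ?K complex_alg (free_tensor Aq n)"
      by unfold_locales (auto simp: free_tensor_simps)
  qed
  then show "x \<in> tensor_null Aq n \<Longrightarrow> x \<in> ?K" for x
    unfolding tensor_null_def using Lam_rels by blast
  show "x \<in> tensor_null Aq n" if x: "x \<in> ?K" for x
    unfolding tensor_null_def
  proof (intro InterI)
    fix N assume "N \<in> {N. submodule N complex_alg (free_tensor Aq n) \<and> multilinear_rels Aq n \<subseteq> N}"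
    then have N: "submodule N complex_alg (free_tensor Aq n)" "multilinear_rels Aq n \<subseteq> N" by auto
    let ?s = "lin (\<lambda>bs. basis (map (\<lambda>b. PhiA (basis b)) bs))"
    have "basis hs - ?s (LamL hs) \<in> N" if "hs \<in> tlists n" for hs
      using tensor_expand[OF N, of "[]" 0 hs n] that by simp
    moreover have "k \<in> tlists n" if "k \<in> Poly_Mapping.keys x" for k
      using supp_in_keys[of x "tlists n" k] x that by simp
    ultimately have "lin (\<lambda>hs. basis hs - ?s (LamL hs)) x \<in> N"
      by (intro lin_closed_in submodule_free_tensorD[OF N(1)]) auto
    moreover have "lin (\<lambda>hs. basis hs - ?s (LamL hs)) x = x - ?s (lin LamL x)"
      by (simp add: lin_fun_diff lin_lin)
    ultimately show "x \<in> N" using x by simp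
  qed
qed

lemma free_quot_T: "free_quot (free_tensor Aq n) (tlists n) (tensor_null Aq n) (lin LamL) {bs. length bs = n}"
proof
  fix bs :: "pbw list" assume "bs \<in> {bs. length bs = n}"
  then show "\<exists>b\<in>tlists n. lin LamL (basis b) = basis bs"
    using LamL_PhiA[of bs] by (intro bexI[of _ "map (\<lambda>b. PhiA (basis b)) bs"]) auto
next
  fix hs assume "hs \<in> tlists n"
  then show "lin LamL (basis hs) \<in> V n" using LamL_closed[of hs] by auto
qed (auto simp: free_tensor_simps tensor_null_eq intro: lmap_lin)

interpretation T: free_quot "free_tensor Aq n" "tlists n" "tensor_null Aq n" "lin LamL" "{bs. length bs = n}" for n
  by (rule free_quot_T)

definition PhiT :: "nat \<Rightarrow> pbwT \<Rightarrow> ((gen list \<Rightarrow>\<^sub>0 complex) set list \<Rightarrow>\<^sub>0 complex) set" where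
  "PhiT n v = {x \<in> supp_in (tlists n). lin LamL x = v}"

lemma PhiT_fib: "PhiT n = T.fib n"
  by (auto simp: fun_eq_iff PhiT_def T.fib_def)

abbreviation TP :: "nat \<Rightarrow> (complex, ((gen list \<Rightarrow>\<^sub>0 complex) set list \<Rightarrow>\<^sub>0 complex) set) module" where
  "TP n \<equiv> tensor_power Aq n"

lemma vmodel_TP: "vmodel (TP n) (PhiT n) {bs. length bs = n}"
  unfolding tensor_power_def PhiT_fib by (rule T.vmodel)

lemma pure_PhiT: "hs \<in> tlists n \<Longrightarrow> pure_tensor Aq hs = PhiT n (LamL hs)"
  using T.coset_fib[of "basis hs" n] by (auto simp: pure_tensor_def PhiT_fib)

lemma TP_mult: "u \<in> V n \<Longrightarrow> v \<in> V n \<Longrightarrow> PhiT n u \<otimes>\<^bsub>TP n\<^esub> PhiT n v = PhiT n (u \<bullet> v)"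
  unfolding tensor_power_def PhiT_fib
proof (rule T.fib_mult)
  fix x y assume x: "x \<in> supp_in (tlists n)" and y: "y \<in> supp_in (tlists n)"
  have "x \<otimes>\<^bsub>free_tensor Aq n\<^esub> y \<in> supp_in (tlists n)"
    unfolding free_tensor_simps
    by (rule supp_in_lin[OF x], rule supp_in_lin[OF y]) (simp only: supp_in_simps map2_tlists)
  moreover have "lin LamL (x \<otimes>\<^bsub>free_tensor Aq n\<^esub> y) = lin LamL x \<bullet> lin LamL y"
  proof -
    have "lin LamL (x \<otimes>\<^bsub>free_tensor Aq n\<^esub> y) = lin (\<lambda>a. lin (\<lambda>b. LamL (map2 (mult Aq) a b)) y) x"
      by (simp add: free_tensor_simps lin_lin)
    also have "\<dots> = lin (\<lambda>a. lin (\<lambda>b. LamL a \<bullet> LamL b) y) x"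
      by (rule lin_cong, rule lin_cong) (rule LamL_map2[OF supp_in_keys[OF x] supp_in_keys[OF y]])
    also have "\<dots> = lin LamL x \<bullet> lin LamL y"
      by (simp add: lmap_lin_comp[OF lmap_tmul(1)] lmap_lin_comp[OF lmap_tmul(2)]) (rule lin_commute)
    finally show ?thesis .
  qed
  ultimately show "x \<otimes>\<^bsub>free_tensor Aq n\<^esub> y \<in> supp_in (tlists n) \<and> lin LamL (x \<otimes>\<^bsub>free_tensor Aq n\<^esub> y) = lin LamL x \<bullet> lin LamL y"
    by blast
qed

lemma LamL_replicate: "LamL (replicate n \<one>\<^bsub>Aq\<^esub>) = one_T n"
  by (induction n) (auto simp: Aq_one)

lemma TP_one: "\<one>\<^bsub>TP n\<^esub> = PhiT n (one_T n)"
proof -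
  have "replicate n \<one>\<^bsub>Aq\<^esub> \<in> tlists n" by (auto simp: Aq_one)
  then show ?thesis
    unfolding tensor_power_def PhiT_fib
    using T.Q.quot_one[of "basis (replicate n \<one>\<^bsub>Aq\<^esub>)" n] T.cset_fib[of "basis (replicate n \<one>\<^bsub>Aq\<^esub>)" n]
    by (simp add: free_tensor_simps LamL_replicate)
qed

lemma TP_quot_lift:
  assumes "vmodel W \<Phi> C" "v \<in> V n" "lmap G"
    and "\<And>hs. hs \<in> tlists n \<Longrightarrow> f hs = \<Phi> (G (LamL hs))" "\<And>u. u \<in> V n \<Longrightarrow> G u \<in> supp_in C"
  shows "quot_lift W f (PhiT n v) = \<Phi> (G v)"
proof -
  have "LamL hs \<in> V n" if "hs \<in> tlists n" for hs using that LamL_closed[of hs] by auto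
  then show ?thesis
    unfolding PhiT_fib by (intro T.quot_lift[OF assms(1-3)]) (use assms(4,5) in auto)
qed

end

section \<open>Comparison of the cocyclic modules\<close>

context quantum
begin

lemma TP_foldr:
  assumes "\<And>g. f g \<in> V n" "x \<in> V n"
  shows "foldr (\<lambda>g r. PhiT n (f g) \<otimes>\<^bsub>TP n\<^esub> r) w (PhiT n x) = PhiT n (foldr (\<lambda>g r. f g \<bullet> r) w x)"
proof -
  have "foldr (\<lambda>g r. f g \<bullet> r) w x \<in> V n" for w
    using assms by (induction w) auto
  then show ?thesis using assms by (induction w) (simp_all add: TP_mult)
qed

lemma TP_add: "u \<in> V n \<Longrightarrow> v \<in> V n \<Longrightarrow> PhiT n u \<oplus>\<^bsub>TP n\<^esub> PhiT n v = PhiT n (u + v)"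
  by (rule vmodel.hom_add[OF vmodel_TP])

lemma Uq_comult_gen_PhiT: "Uq_comult_gen q g = PhiT 2 (Dg 2 g)"
proof -
  have p: "pure_tensor Aq [PhiA x, PhiA y] = PhiT 2 (x \<triangleright> y \<triangleright> basis [])" for x y
    using pure_PhiT[of "[PhiA x, PhiA y]" 2] by simp
  have c: "x \<triangleright> y \<triangleright> basis [] \<in> V 2" for x y :: "pbw \<Rightarrow>\<^sub>0 complex"
    using tensor_closed(1)[OF tensor_closed(1), of "basis []" 0 x y] by (simp add: numeral_2_eq_2)
  show ?thesis
    by (cases g) (simp_all add: Uq_comult_gen_def Uq_gen_PhiA Aq_one p TP_add c Dg_2 del: Dg.simps)
qed

lemma comult_PhiA: "Uq_hom (TP 2) (Uq_comult_gen q) (PhiA v) = PhiT 2 (D 2 v)"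
proof (rule Uq_hom_PhiA[OF vmodel_TP])
  show "foldr (\<lambda>g r. Uq_comult_gen q g \<otimes>\<^bsub>TP 2\<^esub> r) w \<one>\<^bsub>TP 2\<^esub> = PhiT 2 (D 2 (foldr act w one_H))" for w
    using D_Psi[of 2 "basis w"] by (simp add: Uq_comult_gen_PhiT TP_one TP_foldr del: Dg.simps tpow.simps)
  show "D 2 x \<in> V 2" for x by (rule D_closed)
qed (rule lmap_D)

lemma counit_PhiA: "Uq_hom complex_alg Uq_counit_gen (PhiA v) = eps v"
  unfolding eps_def
proof (rule Uq_hom_PhiA[OF vmodel_complex, of "D 0"])
  fix w
  have "foldr (\<lambda>g r. Uq_counit_gen g * r) w 1 = eps (foldr act w one_H)"
    by (induction w) (auto simp: eps_act Uq_counit_gen_def split: gen.split)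
  then show "foldr (\<lambda>g r. Uq_counit_gen g \<otimes>\<^bsub>complex_alg\<^esub> r) w \<one>\<^bsub>complex_alg\<^esub>
      = Poly_Mapping.lookup (D 0 (foldr act w one_H)) []"
    by (simp add: complex_alg_def eps_def)
  show "D 0 x \<in> V 0" for x by (rule D_closed)
qed (rule lmap_D)

lemma antipode_PhiA: "Uq_hom (op_alg Aq) (Uq_antipode_gen q) (PhiA v) = PhiA (S v)"
proof (rule Uq_hom_PhiA)
  show "vmodel (op_alg Aq) PhiA UNIV"
    using vmodel_Aq by (simp add: vmodel_def op_alg_def)
  have g: "Uq_antipode_gen q g = PhiA (Sg g)" for g
    by (cases g) (simp_all add: Uq_antipode_gen_def Uq_gen_PhiA Aq_mult Aq_ops)
  have "foldr (\<lambda>g r. r \<otimes>\<^bsub>Aq\<^esub> PhiA (Sg g)) w (PhiA one_H) = PhiA (foldr (\<lambda>g v. v \<star> Sg g) w one_H)" for w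
    by (induction w) (simp_all add: Aq_mult)
  then show "foldr (\<lambda>g r. Uq_antipode_gen q g \<otimes>\<^bsub>op_alg Aq\<^esub> r) w \<one>\<^bsub>op_alg Aq\<^esub> = PhiA (S (foldr act w one_H))" for w
    using S_Psi[of "basis w"] by (simp add: g op_alg_def Aq_one)
qed (auto simp: lmap_S supp_in_def)

abbreviation Hq :: "(gen list \<Rightarrow>\<^sub>0 complex) set hopf" where "Hq \<equiv> Uq q"

lemma Hq_simps:
  "carrier Hq = carrier Aq" "mult Hq = mult Aq" "one Hq = one Aq" "zero Hq = zero Aq"
  "add Hq = add Aq" "smult Hq = smult Aq"
  "comult Hq (PhiA v) = PhiT 2 (D 2 v)" "counit Hq (PhiA v) = eps v" "antipode Hq (PhiA v) = PhiA (S v)"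
  using comult_PhiA counit_PhiA antipode_PhiA by (simp_all add: Uq_def)

lemma tensor_Hq:
  "tensor_power Hq n = TP n" "pure_tensor Hq hs = pure_tensor Aq hs"
proof -
  have f: "free_tensor Hq n = free_tensor Aq n" for n
    by (simp add: free_tensor_def Hq_simps)
  have "multilinear_rels Hq n = multilinear_rels Aq n" for n
    by (simp add: multilinear_rels_def Hq_simps)
  then have "tensor_null Hq n = tensor_null Aq n" for n
    by (simp add: tensor_null_def f)
  then show "tensor_power Hq n = TP n" "pure_tensor Hq hs = pure_tensor Aq hs"
    by (simp_all add: tensor_power_def pure_tensor_def f)
qed

lemma vmodel_Hq: "vmodel Hq PhiA UNIV"
  using vmodel_Aq by (simp add: vmodel_def Hq_simps)

lemma tlists_2: "hs \<in> tlists 2 \<Longrightarrow> \<exists>x y. hs = [PhiA x, PhiA y]"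
  by (auto simp: numeral_2_eq_2 length_Suc_conv Aq_carrier)

text \<open>With the counit as character the twist disappears by the counit axiom
  \<open>D_counit\<close>.\<close>

lemma twisted_antipode_PhiA: "twisted_antipode Hq (counit Hq) (PhiA v) = PhiA (S v)"
proof -
  let ?G = "\<lambda>z. S (pair_lin (\<lambda>a b. scale (eps a) b) z)"
  have p: "pair_lin (\<lambda>a b. scale (eps a) b) (a \<triangleright> b \<triangleright> basis []) = scale (eps a) b" for a b
    by (rule pair_lin_tcons) (auto simp: lmap_def scale_add scale_left_add mult.commute)
  have "quot_lift Hq (\<lambda>hs. counit Hq (hs ! 0) \<odot>\<^bsub>Hq\<^esub> antipode Hq (hs ! 1)) (PhiT 2 (D 2 v)) = PhiA (?G (D 2 v))"
  proof (rule TP_quot_lift[OF vmodel_Hq D_closed])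
    fix hs assume "hs \<in> tlists 2"
    then obtain x y where "hs = [PhiA x, PhiA y]" using tlists_2 by blast
    then show "counit Hq (hs ! 0) \<odot>\<^bsub>Hq\<^esub> antipode Hq (hs ! 1) = PhiA (?G (LamL hs))"
      by (simp add: Hq_simps Aq_ops p)
  qed (auto intro!: lmap_intros simp: supp_in_def[of UNIV])
  then show ?thesis by (simp add: twisted_antipode_def Hq_simps D_counit)
qed

lemma pure_Cons: "hs \<in> tlists n \<Longrightarrow> pure_tensor Hq (PhiA x # hs) = PhiT (Suc n) (x \<triangleright> LamL hs)"
  using pure_PhiT[of "PhiA x # hs" "Suc n"] by (simp add: tensor_Hq)

lemma iter_comult_PhiA: "iter_comult Hq n (PhiA v) = PhiT n (D n v)"
proof (induction n arbitrary: v)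
  case 0
  have "pure_tensor Aq [] = PhiT 0 (basis [])"
    using pure_PhiT[of "[]" 0] by simp
  then show ?case
    using vmodel.hom_smult[OF vmodel_TP, of "basis []" 0 "eps v"] by (simp add: Hq_simps tensor_Hq D_0)
next
  case (Suc n)
  have p: "pair_lin (\<lambda>a b. a \<triangleright> D n b) (a \<triangleright> b \<triangleright> basis []) = a \<triangleright> D n b" for a b
    by (rule pair_lin_tcons) (auto intro!: lmap_intros)
  have inner: "quot_lift (TP (Suc n)) (\<lambda>gs. pure_tensor Hq (PhiA x # gs)) (PhiT n (D n y)) = PhiT (Suc n) (x \<triangleright> D n y)" for x y
    by (rule TP_quot_lift[OF vmodel_TP D_closed]) (auto intro!: lmap_intros simp: pure_Cons)
  have "quot_lift (TP (Suc n)) (\<lambda>hs. quot_lift (TP (Suc n)) (\<lambda>gs. pure_tensor Hq (hs ! 0 # gs)) (iter_comult Hq n (hs ! 1))) (PhiT 2 (D 2 v))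
    = PhiT (Suc n) (pair_lin (\<lambda>a b. a \<triangleright> D n b) (D 2 v))"
  proof (rule TP_quot_lift[OF vmodel_TP D_closed])
    fix hs assume "hs \<in> tlists 2"
    then obtain x y where "hs = [PhiA x, PhiA y]" using tlists_2 by blast
    then show "quot_lift (TP (Suc n)) (\<lambda>gs. pure_tensor Hq (hs ! 0 # gs)) (iter_comult Hq n (hs ! 1))
        = PhiT (Suc n) (pair_lin (\<lambda>a b. a \<triangleright> D n b) (LamL hs))"
      by (simp add: Suc.IH inner p)
  next
    fix u :: "pbwT" assume "u \<in> V 2"
    then show "pair_lin (\<lambda>a b. a \<triangleright> D n b) u \<in> V (Suc n)"
      unfolding pair_lin_def by (rule supp_in_lin) simp
  qed (rule lmap_pair_lin)
  then show ?case by (simp add: tensor_Hq Hq_simps D_Suc_pair[symmetric])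
qed

lemma diag_act_PhiA: "v \<in> V n \<Longrightarrow> diag_act Hq n (PhiA h) (PhiT n v) = PhiT n (D n h \<bullet> v)"
  by (simp add: diag_act_def iter_comult_PhiA tensor_Hq TP_mult)

abbreviation Kq :: "(gen list \<Rightarrow>\<^sub>0 complex) set" where "Kq \<equiv> Uq_gen q gK"

lemma dd_conc:
  "dd (length hs) (LamL hs) = LamL hs \<triangleleft> hK"
  "j < length hs \<Longrightarrow> dd j (LamL hs) = LamL (take j hs) \<bowtie> D 2 (psi (hs ! j)) \<bowtie> LamL (drop (Suc j) hs)"
proof -
  show "dd (length hs) (LamL hs) = LamL hs \<triangleleft> hK"
    by (rule dd_snoc(3)[OF LamL_closed])
  show "j < length hs \<Longrightarrow> dd j (LamL hs) = LamL (take j hs) \<bowtie> D 2 (psi (hs ! j)) \<bowtie> LamL (drop (Suc j) hs)"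
  proof (induction j arbitrary: hs)
    case 0
    then show ?case by (cases hs) auto
  next
    case (Suc j)
    then show ?case by (cases hs) (auto simp: tcons_tconc)
  qed
qed

lemma coface_PhiT:
  assumes "v \<in> V n" "i \<le> Suc n"
  shows "hopf_coface Hq Kq n i (PhiT n v) = PhiT (Suc n) (cf i v)"
  unfolding hopf_coface_def tensor_Hq(1) Suc_eq_plus1[symmetric]
proof (rule TP_quot_lift[OF vmodel_TP assms(1) lmap_cf])
  fix hs assume hs: "hs \<in> tlists n"
  consider "i = 0" | j where "i = Suc j" "j < n" | "i = Suc n" using assms(2) by (cases i) (auto simp: le_less)
  then show "(if i = 0 then pure_tensor Hq (\<one>\<^bsub>Hq\<^esub> # hs)
      else if i \<le> n then quot_lift (TP (Suc n)) (\<lambda>gs. pure_tensor Hq (take (i - 1) hs @ gs @ drop i hs)) (comult Hq (hs ! (i - 1)))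
      else pure_tensor Hq (hs @ [Kq])) = PhiT (Suc n) (cf i (LamL hs))"
  proof cases
    case 1
    then show ?thesis using hs by (simp add: Hq_simps Aq_one pure_Cons cf_def)
  next
    case (2 j)
    have "hs ! j \<in> set hs" using hs 2 by (intro nth_mem) simp
    then have "hs ! j \<in> range PhiA" using hs by (auto simp: Aq_carrier)
    then obtain x where x: "hs ! j = PhiA x" by blast
    have "quot_lift (TP (Suc n)) (\<lambda>gs. pure_tensor Hq (take j hs @ gs @ drop (Suc j) hs)) (PhiT 2 (D 2 x))
      = PhiT (Suc n) (LamL (take j hs) \<bowtie> D 2 x \<bowtie> LamL (drop (Suc j) hs))"
    proof (rule TP_quot_lift[OF vmodel_TP D_closed])
      fix gs assume "gs \<in> tlists 2"
      then have "take j hs @ gs @ drop (Suc j) hs \<in> tlists (Suc n)"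
        using hs 2 by (auto dest: in_set_takeD in_set_dropD)
      then show "pure_tensor Hq (take j hs @ gs @ drop (Suc j) hs)
          = PhiT (Suc n) (LamL (take j hs) \<bowtie> LamL gs \<bowtie> LamL (drop (Suc j) hs))"
        by (simp only: tensor_Hq pure_PhiT LamL_append)
    next
      fix u :: "pbwT" assume u: "u \<in> V 2"
      have "LamL (take j hs) \<bowtie> u \<bowtie> LamL (drop (Suc j) hs) \<in> V (length (take j hs) + (2 + length (drop (Suc j) hs)))"
        by (intro tensor_closed LamL_closed u)
      then show "LamL (take j hs) \<bowtie> u \<bowtie> LamL (drop (Suc j) hs) \<in> V (Suc n)"
        using hs 2 by (simp add: min_def)
    qed (intro lmap_intros)
    then show ?thesis using hs 2 x dd_conc(2)[of j hs] by (simp add: Hq_simps cf_def)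
  next
    case 3
    have "hs @ [Kq] \<in> tlists (Suc n)" using hs by (simp add: Uq_gen_PhiA)
    then have "pure_tensor Hq (hs @ [Kq]) = PhiT (Suc n) (LamL (hs @ [Kq]))"
      by (simp only: tensor_Hq pure_PhiT)
    then show ?thesis using hs dd_conc(1)[of hs] 3 by (simp add: cf_def LamL_append Uq_gen_PhiA tsnoc_conc)
  qed
qed simp

lemma cyc_PhiT:
  assumes "v \<in> V n"
  shows "hopf_cyc Hq (counit Hq) Kq n (PhiT n v) = PhiT n (cycT v)"
proof (cases n)
  case 0
  then have "cycT v = v" using assms by (intro V_0_eqI[of v cycT "\<lambda>v. v"]) (auto intro!: lmap_intros lmap_cycT)
  then show ?thesis by (simp add: hopf_cyc_def 0)
next
  case (Suc m)
  have "quot_lift (TP n) (\<lambda>hs. diag_act Hq n (twisted_antipode Hq (counit Hq) (hd hs)) (pure_tensor Hq (tl hs @ [Kq]))) (PhiT n v)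
     = PhiT n (cycT v)"
  proof (rule TP_quot_lift[OF vmodel_TP assms lmap_cycT])
    fix hs assume hs: "hs \<in> tlists n"
    then obtain x gs where x: "hs = PhiA x # gs" "gs \<in> tlists m" using Suc by (cases hs) (auto simp: Aq_carrier)
    have g: "LamL gs \<in> V m" using x LamL_closed[of gs] by simp
    have "gs @ [Kq] \<in> tlists n" using x Suc by (simp add: Uq_gen_PhiA)
    then have "pure_tensor Hq (gs @ [Kq]) = PhiT n (LamL (gs @ [Kq]))"
      by (simp only: tensor_Hq pure_PhiT)
    also have "LamL (gs @ [Kq]) = LamL gs \<triangleleft> hK"
      by (simp add: LamL_append Uq_gen_PhiA tsnoc_conc)
    finally show "diag_act Hq n (twisted_antipode Hq (counit Hq) (hd hs)) (pure_tensor Hq (tl hs @ [Kq])) = PhiT n (cycT (LamL hs))"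
      using g by (simp add: x twisted_antipode_PhiA diag_act_PhiA Suc cycT_tcons[OF g])
  qed simp
  then show ?thesis by (simp add: hopf_cyc_def tensor_Hq Suc)
qed

abbreviation Xq :: "((gen list \<Rightarrow>\<^sub>0 complex) set list \<Rightarrow>\<^sub>0 complex) set cocyclic" where
  "Xq \<equiv> hopf_cocyclic Hq (counit Hq) Kq"

lemma Xq_cochains: "cochains Xq n = TP n"
  by (simp add: hopf_cocyclic_def tensor_Hq)

lemma TP_smult: "u \<in> V n \<Longrightarrow> c \<odot>\<^bsub>TP n\<^esub> PhiT n u = PhiT n (scale c u)"
  by (rule vmodel.hom_smult[OF vmodel_TP])

lemma TP_zero: "\<zero>\<^bsub>TP n\<^esub> = PhiT n 0"
  by (rule vmodel.hom_zero[OF vmodel_TP])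

lemma TP_carrier: "carrier (TP n) = PhiT n ` V n"
  by (rule vmodel.carrier[OF vmodel_TP])

lemma TP_inj: "inj_on (PhiT n) (V n)"
  by (rule vmodel.inj[OF vmodel_TP])

lemma TP_neg: "u \<in> V n \<Longrightarrow> \<ominus>\<^bsub>TP n\<^esub> PhiT n u = PhiT n (- u)"
  by (rule vmodel.a_inv[OF vmodel_TP])

lemma hoch_b_PhiT: "v \<in> V n \<Longrightarrow> hoch_b Xq n (PhiT n v) = PhiT (Suc n) (bo hK v)"
  unfolding hoch_b_def Xq_cochains Suc_eq_plus1[symmetric]
  by (subst vmodel.finsum[OF vmodel_TP, where g = "\<lambda>i. scale ((-1) ^ i) (cf i v)"])
     (auto simp: hopf_cocyclic_def coface_PhiT TP_smult bo_sum simp del: sum.atMost_Suc)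

lemma hoch_b'_PhiT: "v \<in> V n \<Longrightarrow> hoch_b' Xq n (PhiT n v) = PhiT (Suc n) (bo 0 v)"
  unfolding hoch_b'_def Xq_cochains Suc_eq_plus1[symmetric]
  by (subst vmodel.finsum[OF vmodel_TP, where g = "\<lambda>i. scale ((-1) ^ i) (cf i v)"])
     (auto simp: hopf_cocyclic_def coface_PhiT TP_smult bo_sum simp del: sum.atMost_Suc)

lemma cyc_sign_PhiT: "v \<in> V n \<Longrightarrow> cyc_sign Xq n (PhiT n v) = PhiT n (lam v)"
  by (simp add: cyc_sign_def Xq_cochains TP_smult lam_V)
     (simp add: hopf_cocyclic_def cyc_PhiT TP_smult)

lemma cyc_norm_PhiT: "v \<in> V n \<Longrightarrow> cyc_norm Xq n (PhiT n v) = PhiT n (norm_op v)"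
proof -
  assume v: "v \<in> V n"
  have "(cyc_sign Xq n ^^ j) (PhiT n v) = PhiT n ((lam ^^ j) v)" for j
    using v by (induction j) (auto simp: cyc_sign_PhiT)
  then show ?thesis
    unfolding cyc_norm_def Xq_cochains
    by (subst vmodel.finsum[OF vmodel_TP, where g = "\<lambda>j. (lam ^^ j) v"]) (use v in \<open>auto simp: norm_op_V\<close>)
qed

end

section \<open>Direct limits along isomorphisms\<close>

lemma push_add: "push f k (i + j) x = push f (k + i) j (push f k i x)"
  by (induction j) (auto simp: add.assoc)

text \<open>With bijective transition maps the limit is its first term: each class meets every stage
  in exactly one element, which collapses the unions in the operations of
  \<open>dirlim\<close>.\<close>

locale iso_system =
  fixes W :: "nat \<Rightarrow> (complex, 'v) module" and f :: "nat \<Rightarrow> 'v \<Rightarrow> 'v"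
  assumes bij: "bij_betw (f k) (carrier (W k)) (carrier (W (Suc k)))"
    and f_add: "x \<in> carrier (W k) \<Longrightarrow> y \<in> carrier (W k) \<Longrightarrow> f k (x \<oplus>\<^bsub>W k\<^esub> y) = f k x \<oplus>\<^bsub>W (Suc k)\<^esub> f k y"
    and f_smult: "x \<in> carrier (W k) \<Longrightarrow> f k (c \<odot>\<^bsub>W k\<^esub> x) = c \<odot>\<^bsub>W (Suc k)\<^esub> f k x"
    and W_add: "x \<in> carrier (W k) \<Longrightarrow> y \<in> carrier (W k) \<Longrightarrow> x \<oplus>\<^bsub>W k\<^esub> y \<in> carrier (W k)"
    and W_smult: "x \<in> carrier (W k) \<Longrightarrow> c \<odot>\<^bsub>W k\<^esub> x \<in> carrier (W k)"
begin

lemma push_bij: "bij_betw (push f 0 k) (carrier (W 0)) (carrier (W k))"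
proof (induction k)
  case (Suc k)
  have "push f 0 (Suc k) = f k \<circ> push f 0 k" by auto
  then show ?case using bij_betw_trans[OF Suc bij[of k]] by (simp only:)
qed (simp add: bij_betw_def inj_on_def)

lemma push_in: "x \<in> carrier (W 0) \<Longrightarrow> push f 0 k x \<in> carrier (W k)"
  using bij_betwE[OF push_bij] by blast

lemma push_inj: "x \<in> carrier (W 0) \<Longrightarrow> y \<in> carrier (W 0) \<Longrightarrow> push f 0 k x = push f 0 k y \<Longrightarrow> x = y"
  using push_bij[of k] by (auto simp: bij_betw_def dest: inj_onD)

lemma push_surj:
  assumes "y \<in> carrier (W k)"
  obtains x where "x \<in> carrier (W 0)" "y = push f 0 k x"
  using assms push_bij[of k] by (auto simp: bij_betw_def)

lemma push_hom: "x \<in> carrier (W 0) \<Longrightarrow> y \<in> carrier (W 0) \<Longrightarrow>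
    push f 0 k (x \<oplus>\<^bsub>W 0\<^esub> y) = push f 0 k x \<oplus>\<^bsub>W k\<^esub> push f 0 k y"
  by (induction k) (auto simp: f_add push_in)

lemma push_smult: "x \<in> carrier (W 0) \<Longrightarrow> push f 0 k (c \<odot>\<^bsub>W 0\<^esub> x) = c \<odot>\<^bsub>W k\<^esub> push f 0 k x"
  by (induction k) (auto simp: f_smult push_in)

lemma dirlim_in_push:
  assumes z: "z \<in> carrier (W 0)"
  shows "dirlim_in W f k (push f 0 k z) = {(l, push f 0 l z) | l. True}"
proof (intro equalityI subsetI)
  fix P assume "P \<in> dirlim_in W f k (push f 0 k z)"
  then obtain l y i j where P: "P = (l, y)" "y \<in> carrier (W l)" "k + i = l + j" "push f k i (push f 0 k z) = push f l j y"
    by (auto simp: dirlim_in_def dirlim_rel_def)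
  obtain z' where z': "z' \<in> carrier (W 0)" "y = push f 0 l z'" using push_surj[OF P(2)] .
  have "push f 0 (l + j) z = push f 0 (l + j) z'"
    using P(4) push_add[of f 0 k i z] push_add[of f 0 l j z'] z'(2) P(3) by simp
  then have "z = z'" using push_inj z z' by blast
  then show "P \<in> {(l, push f 0 l z) | l. True}" using P z' by simp
next
  fix P assume "P \<in> {(l, push f 0 l z) | l. True}"
  then obtain l where P: "P = (l, push f 0 l z)" by auto
  have "push f k l (push f 0 k z) = push f l k (push f 0 l z)"
    using push_add[of f 0 k l z] push_add[of f 0 l k z] by (simp add: add.commute)
  then have "\<exists>i j. k + i = l + j \<and> push f k i (push f 0 k z) = push f l j (push f 0 l z)"
    by (intro exI[of _ l] exI[of _ k]) (simp add: add.commute)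
  then show "P \<in> dirlim_in W f k (push f 0 k z)"
    using P push_in[OF z] by (auto simp: dirlim_in_def dirlim_rel_def)
qed

lemma dirlim_in_0: "z \<in> carrier (W 0) \<Longrightarrow> dirlim_in W f 0 z = {(l, push f 0 l z) | l. True}"
  using dirlim_in_push[of z 0] by simp

lemma dirlim_bij: "bij_betw (dirlim_in W f 0) (carrier (W 0)) (carrier (dirlim W f))"
proof (rule bij_betwI')
  fix x y assume xy: "x \<in> carrier (W 0)" "y \<in> carrier (W 0)"
  show "dirlim_in W f 0 x = dirlim_in W f 0 y \<longleftrightarrow> x = y"
  proof
    assume "dirlim_in W f 0 x = dirlim_in W f 0 y"
    then have "(0, push f 0 0 x) \<in> {(l, push f 0 l y) | l. True}"
      using dirlim_in_0[OF xy(1)] dirlim_in_0[OF xy(2)] by blast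
    then show "x = y" by simp
  qed simp
next
  fix x assume "x \<in> carrier (W 0)"
  then show "dirlim_in W f 0 x \<in> carrier (dirlim W f)"
    by (auto simp: dirlim_def quotient_def dirlim_in_def)
next
  fix P assume "P \<in> carrier (dirlim W f)"
  then obtain k x where kx: "x \<in> carrier (W k)" "P = dirlim_in W f k x"
    by (auto simp: dirlim_def quotient_def dirlim_in_def)
  obtain z where "z \<in> carrier (W 0)" "x = push f 0 k z" using push_surj[OF kx(1)] .
  then show "\<exists>x\<in>carrier (W 0). P = dirlim_in W f 0 x"
    using kx dirlim_in_push[of z k] dirlim_in_0[of z] by auto
qed

lemma dirlim_add:
  assumes "x \<in> carrier (W 0)" "y \<in> carrier (W 0)"
  shows "dirlim_in W f 0 x \<oplus>\<^bsub>dirlim W f\<^esub> dirlim_in W f 0 y = dirlim_in W f 0 (x \<oplus>\<^bsub>W 0\<^esub> y)"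
proof -
  have "dirlim_in W f k (push f 0 k x \<oplus>\<^bsub>W k\<^esub> push f 0 k y) = dirlim_in W f 0 (x \<oplus>\<^bsub>W 0\<^esub> y)" for k
    using assms W_add by (simp add: push_hom[symmetric] dirlim_in_push dirlim_in_0)
  then show ?thesis
    unfolding dirlim_def by (simp add: dirlim_in_0[OF assms(1)] dirlim_in_0[OF assms(2)]) auto
qed

lemma dirlim_smult:
  assumes "x \<in> carrier (W 0)"
  shows "c \<odot>\<^bsub>dirlim W f\<^esub> dirlim_in W f 0 x = dirlim_in W f 0 (c \<odot>\<^bsub>W 0\<^esub> x)"
proof -
  have "dirlim_in W f k (c \<odot>\<^bsub>W k\<^esub> push f 0 k x) = dirlim_in W f 0 (c \<odot>\<^bsub>W 0\<^esub> x)" for k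
    using assms W_smult by (simp add: push_smult[symmetric] dirlim_in_push dirlim_in_0)
  then show ?thesis
    unfolding dirlim_def by (simp add: dirlim_in_0[OF assms(1)]) auto
qed

end

section \<open>Cyclic cohomology of the quantum group\<close>

type_synonym tensor_seq = "nat \<Rightarrow> pbwT"

text \<open>Entries beyond column n are 0 rather than undefined, so that sequences add pointwise;
  \<open>PhiTot\<close> restores the restricted functions of \<open>tot\<close>.\<close>

definition Tot :: "nat \<Rightarrow> tensor_seq set" where
  "Tot n = {y. (\<forall>p\<le>n. y p \<in> V (n - p)) \<and> (\<forall>p>n. y p = 0)}"

definition fsc :: "complex \<Rightarrow> tensor_seq \<Rightarrow> tensor_seq" where
  "fsc c y = (\<lambda>p. scale c (y p))"

definition shiftT :: "tensor_seq \<Rightarrow> tensor_seq" where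
  "shiftT y = (\<lambda>p. if p < 2 then 0 else y (p - 2))"

definition at_col :: "nat \<Rightarrow> pbwT \<Rightarrow> tensor_seq" where
  "at_col k v = (\<lambda>p. if p = k then v else 0)"

lemma Tot_V: "y \<in> Tot n \<Longrightarrow> y p \<in> V (n - p)"
  by (cases "p \<le> n") (auto simp: Tot_def)

lemma Tot_zero: "y \<in> Tot n \<Longrightarrow> n < p \<Longrightarrow> y p = 0"
  by (auto simp: Tot_def)

lemma Tot_closed [simp]:
  "0 \<in> Tot n" "x \<in> Tot n \<Longrightarrow> y \<in> Tot n \<Longrightarrow> x + y \<in> Tot n"
  "x \<in> Tot n \<Longrightarrow> y \<in> Tot n \<Longrightarrow> x - y \<in> Tot n" "x \<in> Tot n \<Longrightarrow> fsc c x \<in> Tot n"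
  by (auto simp: Tot_def fsc_def)

lemma at_col_Tot: "k \<le> n \<Longrightarrow> v \<in> V (n - k) \<Longrightarrow> at_col k v \<in> Tot n"
  by (auto simp: Tot_def at_col_def)

lemma shiftT_Tot: "y \<in> Tot n \<Longrightarrow> shiftT y \<in> Tot (n + 2)"
proof -
  assume y: "y \<in> Tot n"
  have "shiftT y p \<in> V (n + 2 - p)" for p
  proof (cases "p < 2")
    case False
    then have "n - (p - 2) = n + 2 - p" by simp
    then show ?thesis using False Tot_V[OF y, of "p - 2"] by (simp add: shiftT_def)
  qed (simp add: shiftT_def)
  moreover have "shiftT y p = 0" if "n + 2 < p" for p
    using that Tot_zero[OF y, of "p - 2"] by (simp add: shiftT_def)
  ultimately show ?thesis unfolding Tot_def by blast
qed

lemma shiftT_simps: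
  "shiftT (x + y) = shiftT x + shiftT y" "shiftT (x - y) = shiftT x - shiftT y"
  "shiftT (fsc c y) = fsc c (shiftT y)" "shiftT 0 = 0"
  by (auto simp: shiftT_def fsc_def fun_eq_iff)

lemma shiftT_inj: "shiftT x = shiftT y \<Longrightarrow> x = y"
proof
  fix p assume "shiftT x = shiftT y"
  then have "shiftT x (p + 2) = shiftT y (p + 2)" by simp
  then show "x p = y p" by (simp add: shiftT_def)
qed

lemma shiftT_obtain:
  assumes "w \<in> Tot (n + 2)" "w 0 = 0" "w 1 = 0"
  obtains y where "y \<in> Tot n" "w = shiftT y"
proof
  have "w (p + 2) \<in> V (n - p)" for p
    using Tot_V[OF assms(1), of "p + 2"] by simp
  moreover have "w (p + 2) = 0" if "n < p" for p
    using that by (intro Tot_zero[OF assms(1)]) simp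
  ultimately show "(\<lambda>p. w (p + 2)) \<in> Tot n" unfolding Tot_def by blast
  show "w = shiftT (\<lambda>p. w (p + 2))"
  proof
    fix p :: nat
    show "w p = shiftT (\<lambda>p. w (p + 2)) p"
    proof (cases "p < 2")
      case True
      then have "p = 0 \<or> p = 1" by arith
      then show ?thesis using assms(2,3) by (auto simp: shiftT_def)
    next
      case False
      then have "p - 2 + 2 = p" by simp
      then show ?thesis using False by (simp only: shiftT_def if_False)
    qed
  qed
qed

context quantum
begin

definition dtot :: "tensor_seq \<Rightarrow> tensor_seq" where
  "dtot y = (\<lambda>p. (if even p then bo hK (y p) else - bo 0 (y p))
     + (if p = 0 then 0 else if odd p then y (p - 1) - lam (y (p - 1)) else norm_op (y (p - 1))))"

lemma dtot_simps:
  "dtot (x + y) = dtot x + dtot y" "dtot (x - y) = dtot x - dtot y"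
  "dtot (fsc c y) = fsc c (dtot y)" "dtot 0 = 0"
  by (auto simp: dtot_def fsc_def fun_eq_iff scale_add scale_diff)

lemma dtot_Tot: "y \<in> Tot n \<Longrightarrow> dtot y \<in> Tot (Suc n)"
proof -
  assume y: "y \<in> Tot n"
  have "dtot y p \<in> V (Suc n - p)" if p: "p \<le> Suc n" for p
  proof -
    have "bo e (y p) \<in> V (Suc n - p)" for e
      using bo_closed[OF Tot_V[OF y, of p], of e] Tot_zero[OF y, of p] p
      by (cases "p \<le> n") (simp_all add: Suc_diff_le)
    moreover have "p \<noteq> 0 \<Longrightarrow> y (p - 1) \<in> V (Suc n - p)"
      using Tot_V[OF y, of "p - 1"] by (cases p) auto
    ultimately show ?thesis by (auto simp: dtot_def)
  qed
  then show ?thesis using Tot_zero[OF y] by (auto simp: Tot_def dtot_def)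
qed

text \<open>By columns: b b = 0 and b' b' = 0, together with (1 - \<lambda>) b = b' (1 - \<lambda>),
  N b' = b N and N (1 - \<lambda>) = (1 - \<lambda>) N = 0. The minus sign on odd columns makes the
  mixed terms cancel.\<close>

lemma dtot_dtot:
  assumes "y \<in> Tot n"
  shows "dtot (dtot y) = 0"
proof
  fix p :: nat
  note V = Tot_V[OF assms]
  consider "p = 0" | "p = 1" | r where "p = r + 2" "even r" | r where "p = r + 2" "odd r"
  proof -
    have "p = 0 \<or> p = 1 \<or> (\<exists>r. p = r + 2)" by presburger
    then show ?thesis using that by blast
  qed
  then show "dtot (dtot y) p = 0 p"
  proof cases
    case 1
    then show ?thesis by (simp add: dtot_def bo_bo)
  next
    case 2
    then show ?thesis using lam_bo[OF V[of 0]] by (simp add: dtot_def bo_bo)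
  next
    case (3 r)
    then show ?thesis
      using norm_bo[OF V[of "r + 1"]] norm_diff(1)[OF V[of r]] by (simp add: dtot_def bo_bo)
  next
    case (4 r)
    then show ?thesis
      using lam_bo[OF V[of "r + 1"]] norm_diff(2)[OF V[of r]] by (simp add: dtot_def bo_bo algebra_simps)
  qed
qed

lemma dtot_shiftT: "dtot (shiftT y) = shiftT (dtot y)"
proof
  fix p :: nat
  have "p = 0 \<or> p = 1 \<or> p = 2 \<or> (\<exists>r. p = r + 3)" by presburger
  then consider "p = 0" | "p = 1" | "p = 2" | r where "p = r + 3" by blast
  then show "dtot (shiftT y) p = shiftT (dtot y) p"
    by cases (simp_all add: dtot_def shiftT_def)
qed

text \<open>Exactness of b in column 0, in degree at least 2, and of b' in column 1 allow a
  coboundary to clear both columns. Only two entries of \<open>dtot z\<close> have to vanish, since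
  for the injectivity of the periodicity operator \<open>dtot z\<close> is itself a shift.\<close>

lemma reduce:
  assumes "z \<in> Tot (Suc (Suc m))" "dtot z 0 = 0" "dtot z 1 = 0"
  obtains x y where "x \<in> Tot (Suc m)" "y \<in> Tot m" "z = dtot x + shiftT y"
proof -
  have "bo hK (z 0) = 0" "z 0 \<in> V (Suc (Suc m))"
    using assms(2) Tot_V[OF assms(1), of 0] by (auto simp: dtot_def)
  then obtain v where v: "v \<in> V (Suc m)" "bo hK v = z 0" using bo_exact_Suc_Suc by blast
  let ?x = "at_col 0 v"
  have x: "?x \<in> Tot (Suc m)" using v by (simp add: at_col_Tot)
  define w where "w = z - dtot ?x"
  have w: "w \<in> Tot (Suc (Suc m))" unfolding w_def using assms(1) dtot_Tot[OF x] by simp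
  have w0: "w 0 = 0" using v by (simp add: w_def dtot_def at_col_def)
  have "dtot w = dtot z" unfolding w_def by (simp add: dtot_simps dtot_dtot[OF x])
  then have "dtot w 1 = 0" using assms(3) by simp
  then have "bo 0 (w 1) = 0" using w0 by (simp add: dtot_def)
  moreover have "w 1 \<in> V (Suc m)" using Tot_V[OF w, of 1] by simp
  ultimately obtain u where u: "u \<in> V m" "bo 0 u = w 1" using bo_0_exact_Suc by blast
  \<comment> \<open>The vertical map of column 1 is - b', hence the sign; column 0 stays
    untouched.\<close>
  let ?x' = "at_col 1 (- u)"
  have x': "?x' \<in> Tot (Suc m)" using u by (intro at_col_Tot) auto
  define w' where "w' = w - dtot ?x'"
  have w': "w' \<in> Tot (m + 2)" unfolding w'_def using w dtot_Tot[OF x'] by simp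
  have "w' 0 = 0" "w' 1 = 0" using w0 u by (simp_all add: w'_def dtot_def at_col_def)
  then obtain y where y: "y \<in> Tot m" "w' = shiftT y" using shiftT_obtain[OF w'] by blast
  have "z = dtot (?x + ?x') + shiftT y"
    unfolding dtot_simps y(2)[symmetric] w'_def w_def by simp
  then show ?thesis using x x' y(1) by (intro that[of "?x + ?x'" y]) simp_all
qed

section \<open>Cocycles, coboundaries and periodicity\<close>

definition Zc :: "nat \<Rightarrow> tensor_seq set" where
  "Zc n = {y \<in> Tot n. dtot y = 0}"

definition Bc :: "nat \<Rightarrow> tensor_seq set" where
  "Bc n = (if n = 0 then {0} else dtot ` Tot (n - 1))"

lemma Bc_subset: "Bc n \<subseteq> Zc n"
  using dtot_dtot dtot_Tot by (cases n) (auto simp: Bc_def Zc_def dtot_simps)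

lemma Bc_subspace: "0 \<in> Bc n" "x \<in> Bc n \<Longrightarrow> y \<in> Bc n \<Longrightarrow> x - y \<in> Bc n" "x \<in> Bc n \<Longrightarrow> fsc c x \<in> Bc n"
proof -
  show "0 \<in> Bc n" unfolding Bc_def using dtot_simps(4) Tot_closed(1) by (metis image_eqI singletonI)
  show "x \<in> Bc n \<Longrightarrow> y \<in> Bc n \<Longrightarrow> x - y \<in> Bc n"
    by (auto simp: Bc_def dtot_simps(2)[symmetric])
  have "fsc c 0 = 0" by (auto simp: fsc_def)
  then show "x \<in> Bc n \<Longrightarrow> fsc c x \<in> Bc n"
    by (auto simp: Bc_def dtot_simps(3)[symmetric])
qed

lemma Zc_shiftT: "y \<in> Zc n \<Longrightarrow> shiftT y \<in> Zc (n + 2)"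
  using shiftT_Tot by (auto simp: Zc_def dtot_shiftT shiftT_simps)

lemma Bc_shiftT: "y \<in> Bc n \<Longrightarrow> shiftT y \<in> Bc (n + 2)"
proof (cases n)
  case 0
  assume "y \<in> Bc n"
  with 0 have "shiftT y = 0" by (simp add: Bc_def shiftT_simps)
  then show ?thesis using Bc_subspace(1) by simp
next
  case (Suc m)
  assume "y \<in> Bc n"
  then obtain z where "z \<in> Tot m" "y = dtot z" using Suc by (auto simp: Bc_def)
  then have "shiftT y = dtot (shiftT z)" "shiftT z \<in> Tot (m + 2)"
    by (simp add: dtot_shiftT, intro shiftT_Tot)
  then show ?thesis using Suc by (auto simp: Bc_def)
qed

text \<open>Surjectivity of the periodicity operator, in every degree.\<close>

lemma Zc_reduce:
  assumes "y \<in> Zc (n + 2)"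
  obtains x where "x \<in> Zc n" "y - shiftT x \<in> Bc (n + 2)"
proof -
  have y: "y \<in> Tot (Suc (Suc n))" "dtot y = 0" using assms by (auto simp: Zc_def)
  then obtain z x where zx: "z \<in> Tot (Suc n)" "x \<in> Tot n" "y = dtot z + shiftT x"
    using reduce[of y n] by (metis zero_fun_apply)
  have "shiftT (dtot x) = dtot y" using zx dtot_dtot by (simp add: dtot_simps dtot_shiftT)
  then have "dtot x = 0" using y shiftT_inj[of "dtot x" 0] by (simp add: shiftT_simps)
  then have "x \<in> Zc n" using zx by (simp add: Zc_def)
  moreover have "y - shiftT x \<in> Bc (n + 2)" using zx by (auto simp: Bc_def)
  ultimately show ?thesis using that by blast
qed

text \<open>Injectivity of the periodicity operator: up to a coboundary, a primitive of
  \<open>shiftT y\<close> is itself a shift.\<close>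

lemma Bc_shiftT_iff:
  assumes "shiftT y \<in> Bc (Suc n + 2)"
  shows "y \<in> Bc (Suc n)"
proof -
  obtain z where z: "z \<in> Tot (Suc (Suc n))" "shiftT y = dtot z" using assms by (auto simp: Bc_def)
  have "dtot z 0 = 0" "dtot z 1 = 0" unfolding z(2)[symmetric] by (simp_all add: shiftT_def)
  then obtain x w where xw: "x \<in> Tot (Suc n)" "w \<in> Tot n" "z = dtot x + shiftT w"
    using reduce[OF z(1)] by metis
  then have "shiftT y = shiftT (dtot w)" using z dtot_dtot by (simp add: dtot_simps dtot_shiftT)
  then have "y = dtot w" by (rule shiftT_inj)
  then show ?thesis using xw by (auto simp: Bc_def)
qed

text \<open>In degree 0 the map b is injective; surjectivity of the periodicity operator carries the
  vanishing upwards.\<close>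

lemma Zc_even: "Zc (2 * k) = Bc (2 * k)"
proof (induction k)
  case 0
  have "y = 0" if "y \<in> Zc 0" for y
  proof
    fix p
    have "bo hK (y 0) = dtot y 0" by (simp add: dtot_def)
    then have "y 0 = 0" using that bo_exact_0[of "y 0"] Tot_V[of y 0 0] by (simp add: Zc_def)
    then show "y p = 0 p" using that Tot_zero[of y 0 p] by (cases "p = 0") (auto simp: Zc_def)
  qed
  then show ?case using Bc_subset[of 0] by (auto simp: Bc_def)
next
  case (Suc k)
  have "y \<in> Bc (2 * k + 2)" if y: "y \<in> Zc (2 * k + 2)" for y
  proof -
    obtain x where x: "x \<in> Zc (2 * k)" "y - shiftT x \<in> Bc (2 * k + 2)" using Zc_reduce[OF y] .
    then have "shiftT x \<in> Bc (2 * k + 2)" using Suc Bc_shiftT by blast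
    then have "0 - shiftT x \<in> Bc (2 * k + 2)" using Bc_subspace(1,2) by blast
    from Bc_subspace(2)[OF x(2) this] show ?thesis by simp
  qed
  then show ?case using Bc_subset[of "2 * k + 2"] by auto
qed

lemma at_col_0_Zc: "at_col 0 (scale a zE + scale b zF) \<in> Zc 1"
proof -
  have "dtot (at_col 0 (scale a zE + scale b zF)) = 0"
    by (rule ext) (auto simp: dtot_def at_col_def)
  moreover have "scale a zE + scale b zF \<in> V (1 - 0)"
    by (simp del: One_nat_def)
  ultimately show ?thesis unfolding Zc_def using at_col_Tot by blast
qed

lemma Zc_1:
  assumes "y \<in> Zc 1"
  obtains a b where "y - at_col 0 (scale a zE + scale b zF) \<in> Bc 1"
proof -
  have y: "y \<in> Tot 1" "dtot y = 0" using assms by (auto simp: Zc_def)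
  have "bo hK (y 0) = dtot y 0" "norm_op (y 1) = dtot y 2 - bo hK (y 2)"
    by (simp_all add: dtot_def)
  then have 0: "bo hK (y 0) = 0" "norm_op (y 1) = 0" using y Tot_zero[OF y(1), of 2] by simp_all
  obtain a b c where abc: "y 0 = scale a zE + scale b zF + bo hK (scale c (basis []))"
    using bo_closed_V_1[OF _ 0(1)] Tot_V[OF y(1), of 0] by auto
  \<comment> \<open>The norm is the identity in degree 0.\<close>
  have "y 1 = 0" using 0(2) norm_op_V[of "y 1" 0] Tot_V[OF y(1), of 1] by simp
  \<comment> \<open>Since \<lambda> fixes degree 0, the coboundary below has no entry in column
    1.\<close>
  moreover have "lam (basis []) = basis []" using lam_V[of "basis []" 0] by simp
  ultimately have "y - at_col 0 (scale a zE + scale b zF) = dtot (at_col 0 (scale c (basis [])))"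
    using abc Tot_zero[OF y(1)] by (auto simp: fun_eq_iff dtot_def at_col_def) (metis One_nat_def Suc_lessI gr0I)
  moreover have "at_col 0 (scale c (basis [])) \<in> Tot 0" by (simp add: at_col_Tot)
  ultimately show ?thesis using that by (auto simp: Bc_def)
qed

lemma at_col_0_Bc:
  assumes "at_col 0 (scale a zE + scale b zF) \<in> Bc 1"
  shows "a = 0 \<and> b = 0"
proof -
  obtain z where z: "z \<in> Tot 0" "at_col 0 (scale a zE + scale b zF) = dtot z"
    using assms by (auto simp: Bc_def)
  have "scale a zE + scale b zF = dtot z 0" unfolding z(2)[symmetric] by (simp add: at_col_def)
  then have "scale a zE + scale b zF = bo hK (z 0)" by (simp add: dtot_def)
  then show ?thesis using zE_zF_indep[of "z 0" a b] Tot_V[OF z(1), of 0] by simp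
qed

subsection \<open>Transfer to the cyclic bicomplex\<close>

definition PhiTot :: "nat \<Rightarrow> tensor_seq \<Rightarrow> nat \<Rightarrow> ((gen list \<Rightarrow>\<^sub>0 complex) set list \<Rightarrow>\<^sub>0 complex) set" where
  "PhiTot n y = (\<lambda>p\<in>{..n}. PhiT (n - p) (y p))"

lemma PhiTot_inj: "inj_on (PhiTot n) (Tot n)"
proof (rule inj_onI, rule ext)
  fix x y p assume x: "x \<in> Tot n" and y: "y \<in> Tot n" and e: "PhiTot n x = PhiTot n y"
  show "x p = y p"
  proof (cases "p \<le> n")
    case True
    then have "PhiT (n - p) (x p) = PhiT (n - p) (y p)"
      using fun_cong[OF e, of p] by (simp add: PhiTot_def)
    then show ?thesis using TP_inj Tot_V[OF x] Tot_V[OF y] by (meson inj_onD)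
  next
    case False
    then show ?thesis using Tot_zero[OF x] Tot_zero[OF y] by simp
  qed
qed

lemma tot_carrier: "carrier (tot Xq n) = PhiTot n ` Tot n"
proof (intro equalityI subsetI)
  fix x assume x: "x \<in> carrier (tot Xq n)"
  then have x: "x \<in> (\<Pi>\<^sub>E p\<in>{..n}. PhiT (n - p) ` V (n - p))"
    by (simp add: tot_def Xq_cochains TP_carrier)
  then have "\<forall>p. \<exists>v. p \<le> n \<longrightarrow> v \<in> V (n - p) \<and> x p = PhiT (n - p) v"
    by (force simp: PiE_iff)
  then obtain y where y: "\<And>p. p \<le> n \<Longrightarrow> y p \<in> V (n - p) \<and> x p = PhiT (n - p) (y p)" by metis
  have "x = PhiTot n (\<lambda>p. if p \<le> n then y p else 0)"
    using x y by (auto simp: PhiTot_def fun_eq_iff PiE_iff extensional_def)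
  moreover have "(\<lambda>p. if p \<le> n then y p else 0) \<in> Tot n" using y by (auto simp: Tot_def)
  ultimately show "x \<in> PhiTot n ` Tot n" by blast
next
  fix x assume "x \<in> PhiTot n ` Tot n"
  then show "x \<in> carrier (tot Xq n)"
    using Tot_V by (auto simp: tot_def Xq_cochains TP_carrier PhiTot_def)
qed

lemma tot_ops:
  "x \<in> Tot n \<Longrightarrow> y \<in> Tot n \<Longrightarrow> PhiTot n x \<oplus>\<^bsub>tot Xq n\<^esub> PhiTot n y = PhiTot n (x + y)"
  "x \<in> Tot n \<Longrightarrow> c \<odot>\<^bsub>tot Xq n\<^esub> PhiTot n x = PhiTot n (fsc c x)"
  "\<zero>\<^bsub>tot Xq n\<^esub> = PhiTot n 0"
  using Tot_V[of x n] Tot_V[of y n]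
  by (auto simp: tot_def Xq_cochains PhiTot_def fun_eq_iff TP_add TP_smult TP_zero fsc_def)

lemma vert_diff_PhiT:
  "v \<in> V m \<Longrightarrow> vert_diff Xq p m (PhiT m v) = PhiT (Suc m) (if even p then bo hK v else - bo 0 v)"
  by (simp add: vert_diff_def hoch_b_PhiT hoch_b'_PhiT Xq_cochains TP_neg)

lemma horiz_diff_PhiT:
  "v \<in> V m \<Longrightarrow> horiz_diff Xq p m (PhiT m v) = PhiT m (if even p then v - lam v else norm_op v)"
  by (simp add: horiz_diff_def cyc_sign_PhiT cyc_norm_PhiT Xq_cochains vmodel.a_minus[OF vmodel_TP])

lemma tot_diff_PhiTot:
  assumes "y \<in> Tot n"
  shows "tot_diff Xq n (PhiTot n y) = PhiTot (Suc n) (dtot y)"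
proof
  fix p
  show "tot_diff Xq n (PhiTot n y) p = PhiTot (Suc n) (dtot y) p"
  proof (cases "p \<le> Suc n")
    case p: True
    let ?v = "if even p then bo hK (y p) else - bo 0 (y p)"
    let ?h = "if p = 0 then 0 else if odd p then y (p - 1) - lam (y (p - 1)) else norm_op (y (p - 1))"
    have v: "(if p \<le> n then vert_diff Xq p (n - p) (PhiTot n y p) else \<zero>\<^bsub>cochains Xq (n + 1 - p)\<^esub>) = PhiT (Suc n - p) ?v"
      using p Tot_V[OF assms, of p] Tot_zero[OF assms, of p]
      by (auto simp: PhiTot_def vert_diff_PhiT Suc_diff_le Xq_cochains TP_zero)
    have "0 < p \<Longrightarrow> y (p - 1) \<in> V (Suc n - p)" using Tot_V[OF assms, of "p - 1"] by (cases p) auto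
    then have h: "(if 0 < p then horiz_diff Xq (p - 1) (n + 1 - p) (PhiTot n y (p - 1)) else \<zero>\<^bsub>cochains Xq (n + 1 - p)\<^esub>)
        = PhiT (Suc n - p) ?h"
      using p by (cases p) (auto simp: PhiTot_def horiz_diff_PhiT Xq_cochains TP_zero)
    have vV: "?v \<in> V (Suc n - p)"
      using bo_closed[OF Tot_V[OF assms, of p]] Tot_zero[OF assms, of p] p
      by (cases "p \<le> n") (simp_all add: Suc_diff_le)
    have hV: "?h \<in> V (Suc n - p)"
      using \<open>0 < p \<Longrightarrow> y (p - 1) \<in> V (Suc n - p)\<close> by auto
    have "tot_diff Xq n (PhiTot n y) p = PhiT (Suc n - p) ?v \<oplus>\<^bsub>cochains Xq (n + 1 - p)\<^esub> PhiT (Suc n - p) ?h"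
      unfolding v[symmetric] h[symmetric] using p by (simp add: tot_diff_def)
    also have "\<dots> = PhiT (Suc n - p) (?v + ?h)"
      using TP_add[OF vV hV] by (simp only: Xq_cochains Suc_eq_plus1)
    also have "\<dots> = PhiTot (Suc n) (dtot y) p"
      using p by (simp add: PhiTot_def dtot_def)
    finally show ?thesis .
  qed (simp add: tot_diff_def PhiTot_def)
qed

lemma cyclic_Z_carrier: "carrier (cyclic_Z Xq n) = PhiTot n ` Zc n"
proof -
  have "tot_diff Xq n (PhiTot n y) = \<zero>\<^bsub>tot Xq (n + 1)\<^esub> \<longleftrightarrow> dtot y = 0" if y: "y \<in> Tot n" for y
    unfolding tot_diff_PhiTot[OF y] tot_ops(3)
    using inj_onD[OF PhiTot_inj[of "Suc n"], of "dtot y" 0] dtot_Tot[OF y] by auto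
  then show ?thesis by (auto simp: cyclic_Z_def tot_carrier Zc_def)
qed

lemma cyclic_B_eq: "cyclic_B Xq n = PhiTot n ` Bc n"
proof (cases n)
  case (Suc m)
  then show ?thesis
    by (simp add: cyclic_B_def Bc_def tot_carrier image_image tot_diff_PhiTot cong: image_cong_simp)
qed (simp add: cyclic_B_def Bc_def tot_ops)

lemma lin_quot_HC: "lin_quot (cyclic_Z Xq n) (PhiTot n) fsc (Zc n) (Bc n) (cyclic_B Xq n)"
proof
  show "inj_on (PhiTot n) (Zc n)"
    using PhiTot_inj by (rule inj_on_subset) (auto simp: Zc_def)
  show "carrier (cyclic_Z Xq n) = PhiTot n ` Zc n" by (rule cyclic_Z_carrier)
  show "cyclic_B Xq n = PhiTot n ` Bc n" by (rule cyclic_B_eq)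
  show "Bc n \<subseteq> Zc n" by (rule Bc_subset)
  show "fsc c (x + y) = fsc c x + fsc c y" for c x y by (auto simp: fsc_def fun_eq_iff scale_add)
  have "fsc c 0 = 0" for c by (auto simp: fsc_def)
  then show "x \<in> Zc n \<Longrightarrow> fsc c x \<in> Zc n" for x c by (auto simp: Zc_def dtot_simps)
  show "x \<in> Zc n \<Longrightarrow> y \<in> Zc n \<Longrightarrow> x + y \<in> Zc n" for x y by (auto simp: Zc_def dtot_simps)
  show "x \<in> Zc n \<Longrightarrow> y \<in> Zc n \<Longrightarrow> PhiTot n x \<oplus>\<^bsub>cyclic_Z Xq n\<^esub> PhiTot n y = PhiTot n (x + y)" for x y
    using tot_ops(1) by (simp add: cyclic_Z_def Zc_def)
  show "x \<in> Zc n \<Longrightarrow> c \<odot>\<^bsub>cyclic_Z Xq n\<^esub> PhiTot n x = PhiTot n (fsc c x)" for x c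
    using tot_ops(2) by (simp add: cyclic_Z_def Zc_def)
qed (fact Bc_subspace)+

interpretation HC: lin_quot "cyclic_Z Xq n" "PhiTot n" fsc "Zc n" "Bc n" "cyclic_B Xq n" for n
  by (rule lin_quot_HC)

definition cls :: "nat \<Rightarrow> tensor_seq \<Rightarrow> (nat \<Rightarrow> ((gen list \<Rightarrow>\<^sub>0 complex) set list \<Rightarrow>\<^sub>0 complex) set) set" where
  "cls n = lin_quot.cset (PhiTot n) (Bc n)"

lemma HC_carrier: "carrier (HC Xq n) = cls n ` Zc n"
  unfolding HC_def cls_def by (rule HC.quot_carrier)

lemma HC_add: "x \<in> Zc n \<Longrightarrow> y \<in> Zc n \<Longrightarrow> cls n x \<oplus>\<^bsub>HC Xq n\<^esub> cls n y = cls n (x + y)"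
  unfolding HC_def cls_def by (rule HC.quot_add)

lemma HC_smult: "x \<in> Zc n \<Longrightarrow> c \<odot>\<^bsub>HC Xq n\<^esub> cls n x = cls n (fsc c x)"
  unfolding HC_def cls_def by (rule HC.quot_smult)

lemma Zc_closed: "0 \<in> Zc n" "x \<in> Zc n \<Longrightarrow> y \<in> Zc n \<Longrightarrow> x + y \<in> Zc n" "x \<in> Zc n \<Longrightarrow> fsc c x \<in> Zc n"
  using HC.S_add HC.S_sc by (auto simp: Zc_def dtot_simps)

lemma HC_zero: "\<zero>\<^bsub>HC Xq n\<^esub> = cls n 0"
  unfolding HC_def cls_def by (rule HC.quot_zero[OF Zc_closed(1)])

lemma cls_eq_iff: "x \<in> Zc n \<Longrightarrow> y \<in> Zc n \<Longrightarrow> cls n x = cls n y \<longleftrightarrow> x - y \<in> Bc n"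
  unfolding cls_def by (rule HC.cset_eq_iff)

text \<open>The union over representatives defining \<open>HC_S\<close> is constant, because shifts
  of coboundaries are coboundaries.\<close>

lemma HC_S_cls: "y \<in> Zc n \<Longrightarrow> HC_S Xq n (cls n y) = cls (n + 2) (shiftT y)"
  unfolding HC_S_def cls_def
proof (rule HC.UN_cset_const)
  fix r assume y: "y \<in> Zc n" and r: "r \<in> Bc n"
  have s: "tot_shift Xq n (PhiTot n z) = PhiTot (n + 2) (shiftT z)" for z
    by (auto simp: tot_shift_def PhiTot_def shiftT_def fun_eq_iff Xq_cochains TP_zero)
  have "shiftT (r + y) = shiftT r + shiftT y" by (rule shiftT_simps)
  then show "cyclic_B Xq (n + 2) +>\<^bsub>cyclic_Z Xq (n + 2)\<^esub> tot_shift Xq n (PhiTot n (r + y)) = HC.cset (n + 2) (shiftT y)"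
    unfolding s using HC.coset[of "shiftT (r + y)" "n + 2"] HC.cset_shift[of "shiftT r" "n + 2" "shiftT y"]
      Zc_shiftT[OF y] Bc_shiftT[OF r] Bc_subset[of "n + 2"] Zc_closed(2)[of "shiftT r" "n + 2"] by auto
qed

lemma HC_system:
  assumes "\<And>k. bij_betw (HC_S Xq (r + 2 * k)) (carrier (HC Xq (r + 2 * k))) (carrier (HC Xq (r + 2 * Suc k)))"
  shows "iso_system (\<lambda>k. HC Xq (r + 2 * k)) (\<lambda>k. HC_S Xq (r + 2 * k))"
proof
  fix k x assume "x \<in> carrier (HC Xq (r + 2 * k))"
  then obtain u where u: "u \<in> Zc (r + 2 * k)" "x = cls (r + 2 * k) u" by (auto simp: HC_carrier)
  have e: "r + 2 * Suc k = (r + 2 * k) + 2" by simp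
  note S = HC_S_cls[of _ "r + 2 * k"] Zc_shiftT[of _ "r + 2 * k"]
  show "HC_S Xq (r + 2 * k) (c \<odot>\<^bsub>HC Xq (r + 2 * k)\<^esub> x) = c \<odot>\<^bsub>HC Xq (r + 2 * Suc k)\<^esub> HC_S Xq (r + 2 * k) x" for c
    unfolding e u(2) using u(1) S by (simp only: HC_smult Zc_closed shiftT_simps)
  show "c \<odot>\<^bsub>HC Xq (r + 2 * k)\<^esub> x \<in> carrier (HC Xq (r + 2 * k))" for c
    using u Zc_closed by (simp add: HC_carrier HC_smult)
  fix y assume "y \<in> carrier (HC Xq (r + 2 * k))"
  then obtain v where v: "v \<in> Zc (r + 2 * k)" "y = cls (r + 2 * k) v" by (auto simp: HC_carrier)
  show "HC_S Xq (r + 2 * k) (x \<oplus>\<^bsub>HC Xq (r + 2 * k)\<^esub> y) = HC_S Xq (r + 2 * k) x \<oplus>\<^bsub>HC Xq (r + 2 * Suc k)\<^esub> HC_S Xq (r + 2 * k) y"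
    unfolding e u(2) v(2) using u(1) v(1) S by (simp only: HC_add Zc_closed shiftT_simps)
  show "x \<oplus>\<^bsub>HC Xq (r + 2 * k)\<^esub> y \<in> carrier (HC Xq (r + 2 * k))"
    using u v Zc_closed by (simp add: HC_carrier HC_add)
qed (rule assms)

lemma HC_S_in: "U \<in> carrier (HC Xq n) \<Longrightarrow> HC_S Xq n U \<in> carrier (HC Xq (n + 2))"
  using Zc_shiftT by (auto simp: HC_carrier HC_S_cls)

lemma HC_S_surj:
  assumes "U \<in> carrier (HC Xq (n + 2))"
  shows "\<exists>U'\<in>carrier (HC Xq n). U = HC_S Xq n U'"
proof -
  obtain y where y: "y \<in> Zc (n + 2)" "U = cls (n + 2) y" using assms by (auto simp: HC_carrier)
  obtain x where x: "x \<in> Zc n" "y - shiftT x \<in> Bc (n + 2)" using Zc_reduce[OF y(1)] .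
  then have "U = HC_S Xq n (cls n x)" using y cls_eq_iff[OF y(1) Zc_shiftT[OF x(1)]] by (simp add: HC_S_cls)
  then show ?thesis using x by (auto simp: HC_carrier)
qed

lemma HC_even: "carrier (HC Xq (2 * k)) = {\<zero>\<^bsub>HC Xq (2 * k)\<^esub>}"
proof -
  have "cls (2 * k) y = cls (2 * k) 0" if "y \<in> Zc (2 * k)" for y
    using that Zc_even[of k] cls_eq_iff[OF that Zc_closed(1)] by simp
  then have "cls (2 * k) ` Zc (2 * k) = {cls (2 * k) 0}" using Zc_closed(1) by blast
  then show ?thesis by (simp only: HC_carrier HC_zero)
qed

lemma HP_0: "carrier (HP Xq 0) = {\<zero>\<^bsub>HP Xq 0\<^esub>}"
proof -
  \<comment> \<open>Maps between zero spaces are bijective, so the limit is its first term, which is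
    zero.\<close>
  have b: "bij_betw (HC_S Xq (0 + 2 * k)) (carrier (HC Xq (0 + 2 * k))) (carrier (HC Xq (0 + 2 * Suc k)))" for k
    using HC_S_in[of _ "2 * k"] HC_even[of k] HC_even[of "Suc k"] by (auto simp: bij_betw_def)
  interpret iso_system "\<lambda>k. HC Xq (0 + 2 * k)" "\<lambda>k. HC_S Xq (0 + 2 * k)"
    by (rule HC_system[OF b])
  have "carrier (HP Xq 0) = dirlim_in (\<lambda>k. HC Xq (0 + 2 * k)) (\<lambda>k. HC_S Xq (0 + 2 * k)) 0 ` carrier (HC Xq (0 + 2 * 0))"
    using dirlim_bij by (simp add: HP_def bij_betw_def)
  also have "\<dots> = {\<zero>\<^bsub>HP Xq 0\<^esub>}"
    using HC_even[of 0] by (simp add: HP_def dirlim_def)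
  finally show ?thesis .
qed

lemma HC_S_bij_odd: "bij_betw (HC_S Xq (1 + 2 * k)) (carrier (HC Xq (1 + 2 * k))) (carrier (HC Xq (1 + 2 * Suc k)))"
proof (rule bij_betwI')
  have e: "1 + 2 * Suc k = (1 + 2 * k) + 2" by simp
  fix U assume U: "U \<in> carrier (HC Xq (1 + 2 * k))"
  show "HC_S Xq (1 + 2 * k) U \<in> carrier (HC Xq (1 + 2 * Suc k))"
    unfolding e by (rule HC_S_in[OF U])
  fix U' assume U': "U' \<in> carrier (HC Xq (1 + 2 * k))"
  obtain x y where xy: "x \<in> Zc (1 + 2 * k)" "y \<in> Zc (1 + 2 * k)" "U = cls (1 + 2 * k) x" "U' = cls (1 + 2 * k) y"
    using U U' by (auto simp: HC_carrier)
  show "HC_S Xq (1 + 2 * k) U = HC_S Xq (1 + 2 * k) U' \<longleftrightarrow> U = U'"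
  proof
    assume "HC_S Xq (1 + 2 * k) U = HC_S Xq (1 + 2 * k) U'"
    then have "shiftT (x - y) \<in> Bc (Suc (2 * k) + 2)"
      using xy cls_eq_iff[OF Zc_shiftT[OF xy(1)] Zc_shiftT[OF xy(2)]] by (simp add: HC_S_cls shiftT_simps)
    from Bc_shiftT_iff[OF this] show "U = U'" using xy by (simp add: cls_eq_iff)
  qed simp
next
  fix U assume "U \<in> carrier (HC Xq (1 + 2 * Suc k))"
  then show "\<exists>U'\<in>carrier (HC Xq (1 + 2 * k)). U = HC_S Xq (1 + 2 * k) U'"
    using HC_S_surj[of U "1 + 2 * k"] by simp
qed

lemma HC_class_cls: "v \<in> V 1 \<Longrightarrow> at_col 0 v \<in> Zc 1 \<Longrightarrow> HC_class Xq 1 (PhiT 1 v) = cls 1 (at_col 0 v)"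
proof -
  assume v: "v \<in> V 1" "at_col 0 v \<in> Zc 1"
  have "(\<lambda>p\<in>{..1}. if p = 0 then PhiT 1 v else \<zero>\<^bsub>cochains Xq (1 - p)\<^esub>) = PhiTot 1 (at_col 0 v)"
    by (auto simp: PhiTot_def at_col_def fun_eq_iff Xq_cochains TP_zero)
  then show ?thesis unfolding HC_class_def cls_def using HC.coset[OF v(2)] by simp
qed

lemma HC_1_bij: "bij_betw (\<lambda>(a, b). cls 1 (at_col 0 (scale a zE + scale b zF))) UNIV (carrier (HC Xq 1))"
proof (rule bij_betwI')
  fix s t :: "complex \<times> complex"
  obtain a b a' b' where st: "s = (a, b)" "t = (a', b')" by (cases s; cases t) auto
  show "((\<lambda>(a, b). cls 1 (at_col 0 (scale a zE + scale b zF))) s = (\<lambda>(a, b). cls 1 (at_col 0 (scale a zE + scale b zF))) t) = (s = t)"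
  proof
    assume "(\<lambda>(a, b). cls 1 (at_col 0 (scale a zE + scale b zF))) s = (\<lambda>(a, b). cls 1 (at_col 0 (scale a zE + scale b zF))) t"
    then have "at_col 0 (scale a zE + scale b zF) - at_col 0 (scale a' zE + scale b' zF) \<in> Bc 1"
      using at_col_0_Zc by (simp add: st cls_eq_iff del: One_nat_def)
    moreover have "at_col 0 (scale a zE + scale b zF) - at_col 0 (scale a' zE + scale b' zF)
       = at_col 0 (scale (a - a') zE + scale (b - b') zF)"
      by (auto simp: at_col_def fun_eq_iff scale_left_diff)
    ultimately show "s = t" using at_col_0_Bc[of "a - a'" "b - b'"] by (simp add: st)
  qed simp
next
  fix s :: "complex \<times> complex"
  show "(\<lambda>(a, b). cls 1 (at_col 0 (scale a zE + scale b zF))) s \<in> carrier (HC Xq 1)"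
    using at_col_0_Zc by (auto simp: HC_carrier split: prod.split)
next
  fix U assume "U \<in> carrier (HC Xq 1)"
  then obtain y where y: "y \<in> Zc 1" "U = cls 1 y" by (auto simp: HC_carrier)
  obtain a b where "y - at_col 0 (scale a zE + scale b zF) \<in> Bc 1" using Zc_1[OF y(1)] .
  then have "U = cls 1 (at_col 0 (scale a zE + scale b zF))"
    using y at_col_0_Zc by (simp add: cls_eq_iff del: One_nat_def)
  then show "\<exists>s\<in>UNIV. U = (\<lambda>(a, b). cls 1 (at_col 0 (scale a zE + scale b zF))) s" by auto
qed

lemma HP_1: "\<exists>\<phi> :: complex \<times> complex \<Rightarrow> _.
                bij_betw \<phi> UNIV (carrier (HP Xq 1))
              \<and> (\<forall>a b a' b'. \<phi> (a + a', b + b') = \<phi> (a, b) \<oplus>\<^bsub>HP Xq 1\<^esub> \<phi> (a', b'))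
              \<and> (\<forall>c a b. \<phi> (c * a, c * b) = c \<odot>\<^bsub>HP Xq 1\<^esub> \<phi> (a, b))
              \<and> \<phi> (1, 0) = HP_class Xq 1 (PhiT 1 zE)
              \<and> \<phi> (0, 1) = HP_class Xq 1 (PhiT 1 zF)"
proof -
  let ?W = "\<lambda>k. HC Xq (1 + 2 * k)" and ?f = "\<lambda>k. HC_S Xq (1 + 2 * k)"
  interpret iso_system ?W ?f by (rule HC_system[OF HC_S_bij_odd])
  have HP: "HP Xq 1 = dirlim ?W ?f" by (simp add: HP_def)
  let ?c = "\<lambda>a b. cls 1 (at_col 0 (scale a zE + scale b zF))"
  have c: "?c a b \<in> carrier (?W 0)" for a b
    using at_col_0_Zc by (auto simp: HC_carrier)
  define \<phi> where "\<phi> = dirlim_in ?W ?f 0 \<circ> (\<lambda>(a, b). ?c a b)"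
  have "bij_betw \<phi> UNIV (carrier (HP Xq 1))"
    unfolding \<phi>_def HP using HC_1_bij dirlim_bij by (intro bij_betw_trans) auto
  moreover have "\<phi> (a + a', b + b') = \<phi> (a, b) \<oplus>\<^bsub>HP Xq 1\<^esub> \<phi> (a', b')" for a b a' b'
  proof -
    have "at_col 0 (scale a zE + scale b zF) + at_col 0 (scale a' zE + scale b' zF)
       = at_col 0 (scale (a + a') zE + scale (b + b') zF)"
      by (auto simp: at_col_def fun_eq_iff scale_left_add)
    then have "?c a b \<oplus>\<^bsub>HC Xq 1\<^esub> ?c a' b' = ?c (a + a') (b + b')"
      by (simp only: HC_add[OF at_col_0_Zc at_col_0_Zc])
    then show ?thesis
      using dirlim_add[OF c c, of a b a' b'] by (simp add: \<phi>_def HP del: One_nat_def)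
  qed
  moreover have "\<phi> (x * a, x * b) = x \<odot>\<^bsub>HP Xq 1\<^esub> \<phi> (a, b)" for x a b
  proof -
    have "fsc x (at_col 0 (scale a zE + scale b zF)) = at_col 0 (scale (x * a) zE + scale (x * b) zF)"
      by (auto simp: at_col_def fsc_def fun_eq_iff scale_add)
    then have "x \<odot>\<^bsub>HC Xq 1\<^esub> ?c a b = ?c (x * a) (x * b)"
      by (simp only: HC_smult[OF at_col_0_Zc])
    then show ?thesis
      using dirlim_smult[OF c, of x a b] by (simp add: \<phi>_def HP del: One_nat_def)
  qed
  \<comment> \<open>Degree 1 is stage 0 of the odd system, as \<open>1 div 2 = 0\<close>, so
    \<open>HP_class\<close> uses the same structure map as \<open>\<phi>\<close>.\<close>
  moreover have "\<phi> (1, 0) = HP_class Xq 1 (PhiT 1 zE)" "\<phi> (0, 1) = HP_class Xq 1 (PhiT 1 zF)"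
    using HC_class_cls[OF zE_zF_closed(1)] HC_class_cls[OF zE_zF_closed(2)] at_col_0_Zc[of 1 0] at_col_0_Zc[of 0 1]
    by (simp_all add: \<phi>_def HP_class_def del: One_nat_def)
  ultimately show ?thesis by (intro exI[of _ \<phi>]) blast
qed

lemma generators_PhiT:
  "pure_tensor Hq [Uq_gen q gE] = PhiT 1 zE"
  "pure_tensor Hq [Kq \<otimes>\<^bsub>Hq\<^esub> Uq_gen q gF] = PhiT 1 zF"
  using pure_Cons[of "[]" 0 hE] pure_Cons[of "[]" 0 "hK \<star> hF"]
  by (simp_all add: Uq_gen_PhiA Hq_simps Aq_mult zE_def zF_def)

end

theorem proposition5p9:
  fixes q :: complex
  assumes "q \<noteq> 0" and "q\<^sup>2 \<noteq> 1"
  shows "let H = Uq q;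
             E = Uq_gen q gE; F = Uq_gen q gF; K = Uq_gen q gK;
             X = hopf_cocyclic H (counit H) K
         in carrier (HP X 0) = {\<zero>\<^bsub>HP X 0\<^esub>}
          \<and> (\<exists>\<phi> :: complex \<times> complex \<Rightarrow> _.
                bij_betw \<phi> UNIV (carrier (HP X 1))
              \<and> (\<forall>a b a' b'. \<phi> (a + a', b + b') = \<phi> (a, b) \<oplus>\<^bsub>HP X 1\<^esub> \<phi> (a', b'))
              \<and> (\<forall>c a b. \<phi> (c * a, c * b) = c \<odot>\<^bsub>HP X 1\<^esub> \<phi> (a, b))
              \<and> \<phi> (1, 0) = HP_class X 1 (pure_tensor H [E])
              \<and> \<phi> (0, 1) = HP_class X 1 (pure_tensor H [K \<otimes>\<^bsub>H\<^esub> F]))"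
proof -
  interpret quantum q by unfold_locales fact+
  show ?thesis
    unfolding Let_def generators_PhiT using HP_0 HP_1 by (rule conjI)
qed

end
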